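(* Let $\mathbb{R}^3_+=\{x\in\mathbb{R}^3:x_3>0\}$ and let $(u,v)$ be a bounded solution of the system $$\begin{cases}-\Delta u=uv^2 & \text{in }\mathbb{R}^3_+,\\ -\Delta v=u^2v & \text{in }\mathbb{R}^3_+,\\ \frac{\partial u}{\partial\nu}=\frac{\partial v}{\partial\nu}=0 & \text{on }\partial\mathbb{R}^3_+.\end{cases}$$ If $(u,v)$ has finite Morse index, then $u\equiv v\equiv0$.
   Context: Solutions are real-valued pairs $(u,v)\in H^1_{loc}(\overline{\mathbb{R}^3_+})\times H^1_{loc}(\overline{\mathbb{R}^3_+})$ (no sign condition), satisfying the system in the weak Neumann sense: $\int_{\mathbb{R}^3_+}\nabla u\cdot\nabla\phi\,dx=\int_{\mathbb{R}^3_+}uv^2\phi\,dx$ and $\int_{\mathbb{R}^3_+}\nabla v\cdot\nabla\phi\,dx=\int_{\mathbb{R}^3_+}u^2v\phi\,dx$ for all $\phi\in C_c^1(\overline{\mathbb{R}^3_+})$ (test functions need not vanish on $\partial\mathbb{R}^3_+$). Bounded means $u,v\in L^\infty(\mathbb{R}^3_+)$. The Morse index of $(u,v)$ is the maximal dimension of a subspace $W\subset C_c^1(\overline{\mathbb{R}^3_+})\times C_c^1(\overline{\mathbb{R}^3_+})$ such that $\tilde Q_{u,v}(\phi,\psi)<0$ for every nonzero $(\phi,\psi)\in W$, where $$\tilde Q_{u,v}(\phi,\psi)=\int_{\mathbb{R}^3_+}(|\nabla\phi|^2+|\nabla\psi|^2)dx-\int_{\mathbb{R}^3_+}\left(v^2\phi^2+u^2\psi^2+4uv\phi\psi\right)dx.$$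 *)

theory Defs
  imports "HOL-Analysis.Analysis" "HOL-Library.Function_Algebras" "HOL-Library.Extended_Nat"
begin

text \<open>Real-valued functions as a real vector space under the pointwise operations.\<close>

instantiation "fun" :: (type, real_vector) real_vector
begin

definition scaleR_fun :: "real \<Rightarrow> ('a \<Rightarrow> 'b) \<Rightarrow> 'a \<Rightarrow> 'b"
  where "scaleR_fun c f = (\<lambda>x. c *\<^sub>R f x)"

instance
  by standard (auto simp: scaleR_fun_def fun_eq_iff scaleR_add_right scaleR_add_left)

end

definition halfspace :: "(real^3) set"
  where "halfspace = {x. x $ 3 > 0}"

definition grad :: "('a::real_inner \<Rightarrow> real) \<Rightarrow> 'a \<Rightarrow> 'a"
  where "grad f x = (THE D. GDERIV f x :> D)"

text \<open>
  \<open>C1c S\<close> is the space of continuously differentiable functions with compact support in \<open>S\<close>,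
  used for open \<open>S\<close> and for the closed half-space.  In the latter case the functions are
  \<open>C\<^sup>1\<close> up to the boundary and need not vanish there: the derivative at a boundary point is
  taken within \<open>S\<close>.  A function on \<open>S\<close> is represented by its extension by zero to the whole
  space, so distinct elements of \<open>C1c S\<close> differ on \<open>S\<close>.
\<close>

definition C1c :: "('a::euclidean_space) set \<Rightarrow> ('a \<Rightarrow> real) set"
  where "C1c S = {\<phi>.
    (\<exists>K. compact K \<and> K \<subseteq> S \<and> (\<forall>x. x \<notin> K \<longrightarrow> \<phi> x = 0)) \<and>
    (\<exists>G. continuous_on S G \<and>
         (\<forall>x\<in>S. (\<phi> has_derivative (\<lambda>h. h \<bullet> G x)) (at x within S)))}"

text \<open>
  Square integrability on bounded parts of the half-space, up to the boundary.
\<close>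

definition L2loc :: "(real^3 \<Rightarrow> 'b::euclidean_space) \<Rightarrow> bool"
  where "L2loc f \<longleftrightarrow> f \<in> borel_measurable (lebesgue_on halfspace) \<and>
    (\<forall>R. integrable (lebesgue_on (halfspace \<inter> ball 0 R)) (\<lambda>x. (norm (f x))\<^sup>2))"

definition weak_gradient :: "(real^3 \<Rightarrow> real) \<Rightarrow> (real^3 \<Rightarrow> real^3) \<Rightarrow> bool"
  where "weak_gradient u g \<longleftrightarrow>
    (\<forall>\<phi>\<in>C1c halfspace.
      (\<integral>x. u x *\<^sub>R grad \<phi> x \<partial>lebesgue_on halfspace)
        = - (\<integral>x. \<phi> x *\<^sub>R g x \<partial>lebesgue_on halfspace))"

text \<open>
  \<open>H1loc_grad u g\<close>: the function \<open>u\<close> is in \<open>H\<^sup>1\<close> on bounded parts of the half-space, with weak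
  gradient \<open>g\<close>, which is determined by \<open>u\<close> up to a null set.
\<close>

definition H1loc_grad :: "(real^3 \<Rightarrow> real) \<Rightarrow> (real^3 \<Rightarrow> real^3) \<Rightarrow> bool"
  where "H1loc_grad u g \<longleftrightarrow> L2loc u \<and> L2loc g \<and> weak_gradient u g"

definition weak_Neumann_solution :: "(real^3 \<Rightarrow> real) \<Rightarrow> (real^3 \<Rightarrow> real) \<Rightarrow> bool"
  where "weak_Neumann_solution u v \<longleftrightarrow>
    (\<exists>gu gv. H1loc_grad u gu \<and> H1loc_grad v gv \<and>
      (\<forall>\<phi>\<in>C1c (closure halfspace).
        (\<integral>x. gu x \<bullet> grad \<phi> x \<partial>lebesgue_on halfspace)
          = (\<integral>x. u x * (v x)\<^sup>2 * \<phi> x \<partial>lebesgue_on halfspace) \<and>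
        (\<integral>x. gv x \<bullet> grad \<phi> x \<partial>lebesgue_on halfspace)
          = (\<integral>x. (u x)\<^sup>2 * v x * \<phi> x \<partial>lebesgue_on halfspace)))"

definition ess_bounded :: "(real^3 \<Rightarrow> real) \<Rightarrow> bool"
  where "ess_bounded f \<longleftrightarrow> f \<in> borel_measurable (lebesgue_on halfspace) \<and>
    (\<exists>C. AE x in lebesgue_on halfspace. \<bar>f x\<bar> \<le> C)"

definition Qform :: "(real^3 \<Rightarrow> real) \<Rightarrow> (real^3 \<Rightarrow> real) \<Rightarrow>
    (real^3 \<Rightarrow> real) \<Rightarrow> (real^3 \<Rightarrow> real) \<Rightarrow> real"
  where "Qform u v \<phi> \<psi> =
    (\<integral>x. (norm (grad \<phi> x))\<^sup>2 + (norm (grad \<psi> x))\<^sup>2 \<partial>lebesgue_on halfspace)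
    - (\<integral>x. (v x)\<^sup>2 * (\<phi> x)\<^sup>2 + (u x)\<^sup>2 * (\<psi> x)\<^sup>2 + 4 * u x * v x * \<phi> x * \<psi> x
         \<partial>lebesgue_on halfspace)"

text \<open>\<open>dim\<close> is 0 on infinite-dimensional subspaces, which have to get dimension \<open>\<infinity>\<close> here.\<close>

definition edim :: "('a::real_vector) set \<Rightarrow> enat"
  where "edim W = (if \<exists>B. finite B \<and> W \<subseteq> span B then enat (dim W) else \<infinity>)"

definition morse_index :: "(real^3 \<Rightarrow> real) \<Rightarrow> (real^3 \<Rightarrow> real) \<Rightarrow> enat"
  where "morse_index u v =
    Sup {edim W | W. subspace W \<and>
           W \<subseteq> C1c (closure halfspace) \<times> C1c (closure halfspace) \<and>
           (\<forall>(\<phi>, \<psi>)\<in>W. (\<phi>, \<psi>) \<noteq> 0 \<longrightarrow> Qform u v \<phi> \<psi> < 0)}"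

end

theory Submission
  imports Defs
begin

text \<open>
  Finite Morse index makes the second variation nonnegative on functions supported outside some
  ball. Testing it there with \<open>(\<eta> v, \<eta> u)\<close> and the equations with \<open>\<eta>\<^sup>2 u\<close> and \<open>\<eta>\<^sup>2 v\<close>
  gives \<open>\<integral> w\<^sup>2 \<eta>\<^sup>2 \<le> \<integral> w |\<nabla>\<eta>|\<^sup>2\<close> with \<open>w = u\<^sup>2 + v\<^sup>2\<close>.  Taking for \<open>\<eta>\<close> the square of a
  cutoff \<open>\<theta>\<close>, Young's inequality bounds \<open>\<integral> w\<^sup>2\<close> by \<open>\<integral> |\<nabla>\<theta>|\<^sup>4\<close>, which stays bounded in
  dimension three, and then the Dirichlet integrals are finite too.  The nonlinearity being
  subcritical, a Pohozaev identity now forces \<open>\<integral> u\<^sup>2 v\<^sup>2 = 0\<close>.  It is obtained without regularity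
  theory by testing the equation for \<open>u\<close> with the dilates \<open>u(c x)\<close> and \<open>u(x / c)\<close> and letting
  \<open>c\<close> decrease to \<open>1\<close>: dilations preserve the half-space, so the boundary plays no role.  Hence the
  gradients vanish, \<open>u\<close> and \<open>v\<close> are invariant under dilations, and being in \<open>L\<^sup>4\<close> they are zero.
\<close>

section \<open>Square-integrable functions\<close>

text \<open>The solutions are only bounded and in H^1, test functions must be C^1 up to the
  boundary, and weak gradients are tested only inside the half-space. Products of a solution with a
  cutoff are therefore reached as L2 limits, with kernels shifted inwards so that a mean taken at a
  boundary point uses interior data alone. For the dilations write Q = u^2 v^2. Since (u v^2, u^2 v)
  is the gradient of Q/2, the source terms for the factor c amount to 3/2 times the integral of Q
  plus 1/2 times that of its dilate, up to O((c-1)^2). The Dirichlet terms for c and 1/c differ by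
  the factor c^(n-2), so the first-order balance has coefficient n-4 in dimension n, here -1; this
  sign is the subcriticality. At a finite radius the balance has an error carried by the gradient of
  the cutoff. It is bounded by a quantity that tends to 0 because the gradients are in L2, times one
  that stays bounded because u and v are in L^4. This is why integrability has to precede the
  dilations.\<close>

definition square_integrable :: "'a measure \<Rightarrow> ('a \<Rightarrow> 'b::euclidean_space) \<Rightarrow> bool"
  where "square_integrable M f \<longleftrightarrow> f \<in> borel_measurable M \<and> integrable M (\<lambda>x. (norm (f x))\<^sup>2)"

text \<open>Square integrability of all terms and of the limit is part of the notion: the Bochner
  integral of a non-integrable function is 0, so the limit condition alone could hold for the wrong
  reason.\<close>

definition L2_tendsto :: "'a measure \<Rightarrow> (nat \<Rightarrow> 'a \<Rightarrow> 'b::euclidean_space) \<Rightarrow> ('a \<Rightarrow> 'b) \<Rightarrow> bool"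
  where "L2_tendsto M F f \<longleftrightarrow> (\<forall>n. square_integrable M (F n)) \<and> square_integrable M f \<and>
    (\<lambda>n. \<integral>x. (norm (F n x - f x))\<^sup>2 \<partial>M) \<longlonglongrightarrow> 0"

lemma square_integrable_integrable:
  "square_integrable M f \<Longrightarrow> integrable M (\<lambda>x. (norm (f x))\<^sup>2)"
  by (simp add: square_integrable_def)

lemma square_integrable_bound:
  assumes "integrable M h" "f \<in> borel_measurable M" "\<And>x. (norm (f x))\<^sup>2 \<le> h x"
  shows "square_integrable M f"
  unfolding square_integrable_def
proof (intro conjI)
  show "integrable M (\<lambda>x. (norm (f x))\<^sup>2)"
    by (rule Bochner_Integration.integrable_bound[OF assms(1)])
      (use assms in \<open>auto intro: order_trans abs_ge_self\<close>)
qed (use assms in auto)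

lemma norm_mult_le_squares: "norm a * norm b \<le> (norm a)\<^sup>2 + (norm b)\<^sup>2"
  for a :: "'a::real_normed_vector" and b :: "'b::real_normed_vector"
proof -
  have "2 * (norm a * norm b) \<le> (norm a)\<^sup>2 + (norm b)\<^sup>2"
    using sum_squares_bound[of "norm a" "norm b"] by simp
  moreover have "0 \<le> norm a * norm b" by simp
  ultimately show ?thesis by linarith
qed

lemma square_integrable_norm_mult:
  assumes "square_integrable M f" "square_integrable M g"
  shows "integrable M (\<lambda>x. norm (f x) * norm (g x))"
proof (rule Bochner_Integration.integrable_bound[where f="\<lambda>x. (norm (f x))\<^sup>2 + (norm (g x))\<^sup>2"])
  show "integrable M (\<lambda>x. (norm (f x))\<^sup>2 + (norm (g x))\<^sup>2)"
    using assms by (simp add: square_integrable_def)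
qed (use assms norm_mult_le_squares in \<open>auto simp: square_integrable_def abs_mult\<close>)

lemma square_integrable_inner:
  assumes "square_integrable M f" "square_integrable M g"
  shows "integrable M (\<lambda>x. f x \<bullet> g x)"
  by (rule Bochner_Integration.integrable_bound[OF square_integrable_norm_mult[OF assms]])
    (use assms in \<open>auto simp: square_integrable_def Cauchy_Schwarz_ineq2 abs_mult\<close>)

lemma norm_add_squared_le: "(norm (a + b))\<^sup>2 \<le> 2 * (norm a)\<^sup>2 + 2 * (norm b)\<^sup>2"
  for a b :: "'a::real_inner"
  using zero_le_power2[of "norm (a - b)"]
  by (simp add: power2_norm_eq_inner inner_add_left inner_add_right inner_diff_left inner_diff_right inner_commute)

lemma norm_diff_squared_le: "(norm (a - b))\<^sup>2 \<le> 2 * (norm a)\<^sup>2 + 2 * (norm b)\<^sup>2"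
  for a b :: "'a::real_inner"
  using norm_add_squared_le[of a "- b"] by simp

lemma square_integrable_add:
  assumes "square_integrable M f" "square_integrable M g"
  shows "square_integrable M (\<lambda>x. f x + g x)"
  by (rule square_integrable_bound[where h="\<lambda>x. 2 * (norm (f x))\<^sup>2 + 2 * (norm (g x))\<^sup>2"])
    (use assms norm_add_squared_le in \<open>auto simp: square_integrable_def\<close>)

lemma square_integrable_diff:
  assumes "square_integrable M f" "square_integrable M g"
  shows "square_integrable M (\<lambda>x. f x - g x)"
  by (rule square_integrable_bound[where h="\<lambda>x. 2 * (norm (f x))\<^sup>2 + 2 * (norm (g x))\<^sup>2"])
    (use assms norm_diff_squared_le in \<open>auto simp: square_integrable_def\<close>)

lemma square_integrable_bounded_scaleR:
  assumes "square_integrable M f" "m \<in> borel_measurable M" "\<And>x. \<bar>m x\<bar> \<le> K"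
  shows "square_integrable M (\<lambda>x. m x *\<^sub>R f x)"
proof (rule square_integrable_bound[where h="\<lambda>x. K\<^sup>2 * (norm (f x))\<^sup>2"])
  show "(norm (m x *\<^sub>R f x))\<^sup>2 \<le> K\<^sup>2 * (norm (f x))\<^sup>2" for x
    using power_mono[OF assms(3)[of x], of 2]
    by (simp add: power_mult_distrib mult_right_mono)
qed (use assms in \<open>auto simp: square_integrable_def\<close>)

text \<open>The quadratic polynomial \<open>t \<mapsto> B - 2 * t * c + t^2 * A\<close>, the
  integral of a square, is nonnegative for every \<open>t\<close>.\<close>

lemma L2_Cauchy_Schwarz:
  assumes "square_integrable M f" "square_integrable M g"
  shows "(\<integral>x. norm (f x) * norm (g x) \<partial>M)
    \<le> sqrt (\<integral>x. (norm (f x))\<^sup>2 \<partial>M) * sqrt (\<integral>x. (norm (g x))\<^sup>2 \<partial>M)"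
proof -
  define A B c where "A = (\<integral>x. (norm (f x))\<^sup>2 \<partial>M)" and "B = (\<integral>x. (norm (g x))\<^sup>2 \<partial>M)"
    and "c = (\<integral>x. norm (f x) * norm (g x) \<partial>M)"
  note [simp] = square_integrable_norm_mult[OF assms] square_integrable_integrable[OF assms(1)]
    square_integrable_integrable[OF assms(2)]
  have nonneg: "0 \<le> A" "0 \<le> B" "0 \<le> c" by (auto simp: A_def B_def c_def)
  have quad: "0 \<le> B - 2 * t * c + t\<^sup>2 * A" for t
  proof -
    have "0 \<le> (\<integral>x. (norm (g x) - t * norm (f x))\<^sup>2 \<partial>M)" by simp
    also have "\<dots> = (\<integral>x. (norm (g x))\<^sup>2 - 2 * t * (norm (f x) * norm (g x)) + t\<^sup>2 * (norm (f x))\<^sup>2 \<partial>M)"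
      by (rule Bochner_Integration.integral_cong) (auto simp: power2_eq_square algebra_simps)
    also have "\<dots> = B - 2 * t * c + t\<^sup>2 * A"
      by (simp add: A_def B_def c_def)
    finally show ?thesis .
  qed
  have "c\<^sup>2 \<le> A * B"
  proof (cases "A = 0")
    case True
    have "c = 0"
    proof (rule ccontr)
      assume "c \<noteq> 0"
      \<comment> \<open>For \<open>A = 0\<close> the polynomial is affine in \<open>t\<close>; at
        this value of \<open>t\<close> it would equal \<open>- B - 2\<close>.\<close>
      then have "2 * ((B + 1) / c) * c = 2 * B + 2" by simp
      then show False using quad[of "(B + 1) / c"] True nonneg by simp
    qed
    then show ?thesis using True by simp
  next
    case False
    then show ?thesis using quad[of "c / A"] nonneg
      by (simp add: field_simps power2_eq_square)
  qed
  then have "c \<le> sqrt (A * B)" by (rule real_le_rsqrt)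
  then show ?thesis by (simp add: A_def B_def c_def real_sqrt_mult)
qed

lemma L2_Cauchy_Schwarz_inner:
  assumes "square_integrable M f" "square_integrable M g"
  shows "\<bar>\<integral>x. f x \<bullet> g x \<partial>M\<bar>
    \<le> sqrt (\<integral>x. (norm (f x))\<^sup>2 \<partial>M) * sqrt (\<integral>x. (norm (g x))\<^sup>2 \<partial>M)"
proof -
  have "\<bar>\<integral>x. f x \<bullet> g x \<partial>M\<bar> \<le> (\<integral>x. norm (f x) * norm (g x) \<partial>M)"
    unfolding real_norm_def[symmetric]
    by (rule order_trans[OF integral_norm_bound integral_mono])
      (use assms in \<open>auto intro!: square_integrable_norm_mult square_integrable_inner simp: Cauchy_Schwarz_ineq2\<close>)
  also note L2_Cauchy_Schwarz[OF assms]
  finally show ?thesis .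
qed

lemma L2_tendsto_add:
  assumes "L2_tendsto M F f" "L2_tendsto M G g"
  shows "L2_tendsto M (\<lambda>n x. F n x + G n x) (\<lambda>x. f x + g x)"
  unfolding L2_tendsto_def
proof (intro conjI allI)
  note A = assms[unfolded L2_tendsto_def]
  show "square_integrable M (\<lambda>x. F n x + G n x)" for n
    using A by (auto intro: square_integrable_add)
  show "square_integrable M (\<lambda>x. f x + g x)"
    using A by (auto intro: square_integrable_add)
  have int: "integrable M (\<lambda>x. (norm (F n x - f x))\<^sup>2)" "integrable M (\<lambda>x. (norm (G n x - g x))\<^sup>2)" for n
    using A by (auto intro!: square_integrable_integrable square_integrable_diff)
  show "(\<lambda>n. \<integral>x. (norm (F n x + G n x - (f x + g x)))\<^sup>2 \<partial>M) \<longlonglongrightarrow> 0"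
  proof (rule tendsto_sandwich[OF _ _ tendsto_const])
    show "(\<lambda>n. 2 * (\<integral>x. (norm (F n x - f x))\<^sup>2 \<partial>M) + 2 * (\<integral>x. (norm (G n x - g x))\<^sup>2 \<partial>M)) \<longlonglongrightarrow> 0"
      using A by (auto intro!: tendsto_eq_intros)
    have "(\<integral>x. (norm (F n x + G n x - (f x + g x)))\<^sup>2 \<partial>M)
        \<le> (\<integral>x. 2 * (norm (F n x - f x))\<^sup>2 + 2 * (norm (G n x - g x))\<^sup>2 \<partial>M)" for n
      by (rule integral_mono)
        (use A int in \<open>auto intro!: square_integrable_integrable square_integrable_diff square_integrable_add
            order_trans[OF _ norm_add_squared_le] simp: algebra_simps\<close>)
    then show "\<forall>\<^sub>F n in sequentially. (\<integral>x. (norm (F n x + G n x - (f x + g x)))\<^sup>2 \<partial>M)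
       \<le> 2 * (\<integral>x. (norm (F n x - f x))\<^sup>2 \<partial>M) + 2 * (\<integral>x. (norm (G n x - g x))\<^sup>2 \<partial>M)"
      using int by simp
  qed simp
qed

lemma L2_tendsto_inner:
  assumes "L2_tendsto M F f" "L2_tendsto M G g"
  shows "(\<lambda>n. \<integral>x. F n x \<bullet> G n x \<partial>M) \<longlonglongrightarrow> (\<integral>x. f x \<bullet> g x \<partial>M)"
proof -
  note A = assms[unfolded L2_tendsto_def]
  define \<alpha> \<beta> where "\<alpha> n = (\<integral>x. (norm (F n x - f x))\<^sup>2 \<partial>M)" and "\<beta> n = (\<integral>x. (norm (G n x - g x))\<^sup>2 \<partial>M)" for n
  define a b where "a = (\<integral>x. (norm (f x))\<^sup>2 \<partial>M)" and "b = (\<integral>x. (norm (g x))\<^sup>2 \<partial>M)"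
  have sq: "square_integrable M (\<lambda>x. F n x - f x)" "square_integrable M (\<lambda>x. G n x - g x)"
     "square_integrable M f" "square_integrable M g" for n
    using A by (auto intro: square_integrable_diff)
  have bd: "\<bar>(\<integral>x. F n x \<bullet> G n x \<partial>M) - (\<integral>x. f x \<bullet> g x \<partial>M)\<bar>
      \<le> sqrt (\<alpha> n) * sqrt (\<beta> n) + sqrt (\<alpha> n) * sqrt b + sqrt a * sqrt (\<beta> n)" for n
  proof -
    have "(\<integral>x. F n x \<bullet> G n x \<partial>M)
      = (\<integral>x. (F n x - f x) \<bullet> (G n x - g x) + (F n x - f x) \<bullet> g x + f x \<bullet> (G n x - g x) + f x \<bullet> g x \<partial>M)"
      by (rule Bochner_Integration.integral_cong) (auto simp: algebra_simps)
    also have "\<dots> = (\<integral>x. (F n x - f x) \<bullet> (G n x - g x) \<partial>M) + (\<integral>x. (F n x - f x) \<bullet> g x \<partial>M)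
       + (\<integral>x. f x \<bullet> (G n x - g x) \<partial>M) + (\<integral>x. f x \<bullet> g x \<partial>M)"
      using sq by (simp add: square_integrable_inner)
    finally show ?thesis
      using L2_Cauchy_Schwarz_inner[OF sq(1)[of n] sq(2)[of n]] L2_Cauchy_Schwarz_inner[OF sq(1)[of n] sq(4)]
        L2_Cauchy_Schwarz_inner[OF sq(3) sq(2)[of n]]
      unfolding \<alpha>_def \<beta>_def a_def b_def by linarith
  qed
  have "(\<lambda>n. (\<integral>x. F n x \<bullet> G n x \<partial>M) - (\<integral>x. f x \<bullet> g x \<partial>M)) \<longlonglongrightarrow> 0"
  proof (rule Lim_null_comparison)
    show "\<forall>\<^sub>F n in sequentially. norm ((\<integral>x. F n x \<bullet> G n x \<partial>M) - (\<integral>x. f x \<bullet> g x \<partial>M))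
      \<le> sqrt (\<alpha> n) * sqrt (\<beta> n) + sqrt (\<alpha> n) * sqrt b + sqrt a * sqrt (\<beta> n)"
      using bd by auto
    have "(\<lambda>n. \<alpha> n) \<longlonglongrightarrow> 0" "(\<lambda>n. \<beta> n) \<longlonglongrightarrow> 0" using A by (auto simp: \<alpha>_def \<beta>_def)
    then show "(\<lambda>n. sqrt (\<alpha> n) * sqrt (\<beta> n) + sqrt (\<alpha> n) * sqrt b + sqrt a * sqrt (\<beta> n)) \<longlonglongrightarrow> 0"
      by (auto intro!: tendsto_eq_intros)
  qed
  then show ?thesis by (simp add: LIM_zero_iff)
qed

lemma L2_tendsto_norm:
  assumes "L2_tendsto M F f"
  shows "(\<lambda>n. \<integral>x. (norm (F n x))\<^sup>2 \<partial>M) \<longlonglongrightarrow> (\<integral>x. (norm (f x))\<^sup>2 \<partial>M)"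
  using L2_tendsto_inner[OF assms assms] by (simp add: power2_norm_eq_inner)

lemma L2_tendsto_const: "square_integrable M f \<Longrightarrow> L2_tendsto M (\<lambda>n. f) f"
  by (simp add: L2_tendsto_def)

text \<open>Convergence survives any pointwise Lipschitz operation. The instances are multiplication
  of a convergent sequence by a fixed bounded scalar or vector field.\<close>

lemma L2_tendsto_dominated:
  assumes F: "L2_tendsto M F f" and G: "\<And>n. G n \<in> borel_measurable M" "g \<in> borel_measurable M"
    and le: "\<And>n x. norm (G n x) \<le> K * norm (F n x)" "\<And>x. norm (g x) \<le> K * norm (f x)"
      "\<And>n x. norm (G n x - g x) \<le> K * norm (F n x - f x)"
  shows "L2_tendsto M G g"
  unfolding L2_tendsto_def
proof (intro conjI allI)
  note A = F[unfolded L2_tendsto_def]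
  have sq: "(norm a)\<^sup>2 \<le> K\<^sup>2 * (norm b)\<^sup>2" if "norm a \<le> K * norm b" for a :: 'c and b :: 'b
    using power_mono[OF that, of 2] by (simp add: power_mult_distrib)
  show "square_integrable M (G n)" for n
    by (rule square_integrable_bound[where h="\<lambda>x. K\<^sup>2 * (norm (F n x))\<^sup>2"])
      (use A G sq[OF le(1)] in \<open>auto intro: square_integrable_integrable\<close>)
  show "square_integrable M g"
    by (rule square_integrable_bound[where h="\<lambda>x. K\<^sup>2 * (norm (f x))\<^sup>2"])
      (use A G sq[OF le(2)] in \<open>auto intro: square_integrable_integrable\<close>)
  have d: "square_integrable M (\<lambda>x. F n x - f x)" for n
    using A by (auto intro: square_integrable_diff)
  show "(\<lambda>n. \<integral>x. (norm (G n x - g x))\<^sup>2 \<partial>M) \<longlonglongrightarrow> 0"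
  proof (rule tendsto_sandwich[OF _ _ tendsto_const])
    show "(\<lambda>n. K\<^sup>2 * (\<integral>x. (norm (F n x - f x))\<^sup>2 \<partial>M)) \<longlonglongrightarrow> 0"
      using A by (auto intro!: tendsto_eq_intros)
    have "(\<integral>x. (norm (G n x - g x))\<^sup>2 \<partial>M) \<le> (\<integral>x. K\<^sup>2 * (norm (F n x - f x))\<^sup>2 \<partial>M)" for n
    proof (rule integral_mono[OF square_integrable_integrable])
      show "integrable M (\<lambda>x. K\<^sup>2 * (norm (F n x - f x))\<^sup>2)"
        by (intro integrable_mult_right square_integrable_integrable d)
      then show "square_integrable M (\<lambda>x. G n x - g x)"
        by (rule square_integrable_bound) (use G sq[OF le(3)] in auto)
    qed (rule sq[OF le(3)])
    then show "\<forall>\<^sub>F n in sequentially. (\<integral>x. (norm (G n x - g x))\<^sup>2 \<partial>M) \<le> K\<^sup>2 * (\<integral>x. (norm (F n x - f x))\<^sup>2 \<partial>M)"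
      by simp
  qed simp
qed

lemma L2_tendsto_bounded_scaleR:
  assumes F: "L2_tendsto M F f" and m: "m \<in> borel_measurable M" "\<And>x. \<bar>m x\<bar> \<le> K"
  shows "L2_tendsto M (\<lambda>n x. m x *\<^sub>R F n x) (\<lambda>x. m x *\<^sub>R f x)"
  by (rule L2_tendsto_dominated[OF F, where K=K])
    (use F m in \<open>auto simp: L2_tendsto_def square_integrable_def mult_right_mono intro!: borel_measurable_scaleR simp flip: scaleR_diff_right\<close>)

lemma L2_tendsto_scaleR_bounded:
  fixes F :: "nat \<Rightarrow> 'a \<Rightarrow> real" and w :: "'a \<Rightarrow> 'b::euclidean_space"
  assumes F: "L2_tendsto M F f" and w: "w \<in> borel_measurable M" "\<And>x. norm (w x) \<le> K"
  shows "L2_tendsto M (\<lambda>n x. F n x *\<^sub>R w x) (\<lambda>x. f x *\<^sub>R w x)"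
  by (rule L2_tendsto_dominated[OF F, where K=K])
    (use F w in \<open>auto simp: L2_tendsto_def square_integrable_def mult.commute[of K] mult_left_mono intro!: borel_measurable_scaleR simp flip: scaleR_diff_left\<close>)

text \<open>Jensen's inequality for the square, read off from the nonnegative variance about the
  mean \<open>c\<close>. It is applied to mollification kernels and to averages over a
  segment.\<close>

lemma norm_weighted_mean_squared_le:
  fixes f :: "'a \<Rightarrow> 'b::euclidean_space"
  assumes "\<And>x. 0 \<le> k x" "integrable M k" "(\<integral>x. k x \<partial>M) = 1"
    "integrable M (\<lambda>x. k x *\<^sub>R f x)" "integrable M (\<lambda>x. k x * (norm (f x))\<^sup>2)"
  shows "(norm (\<integral>x. k x *\<^sub>R f x \<partial>M))\<^sup>2 \<le> (\<integral>x. k x * (norm (f x))\<^sup>2 \<partial>M)"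
proof -
  define c where "c = (\<integral>x. k x *\<^sub>R f x \<partial>M)"
  have "0 \<le> (\<integral>x. k x * (norm (f x - c))\<^sup>2 \<partial>M)"
    using assms(1) by simp
  also have "\<dots> = (\<integral>x. k x * (norm (f x))\<^sup>2 - 2 * (c \<bullet> (k x *\<^sub>R f x)) + (norm c)\<^sup>2 * k x \<partial>M)"
    by (rule Bochner_Integration.integral_cong)
      (auto simp: power2_norm_eq_inner algebra_simps inner_commute)
  also have "\<dots> = (\<integral>x. k x * (norm (f x))\<^sup>2 \<partial>M) - 2 * (c \<bullet> c) + (norm c)\<^sup>2"
    using assms by (simp add: c_def del: inner_scaleR_right)
  finally show ?thesis by (simp add: c_def power2_norm_eq_inner)
qed

text \<open>Derivatives of the bump, of the kernels and of the mollified functions all come from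
  explicit quadratic remainders. Such bounds can be integrated in a parameter, so differentiation
  under the integral sign becomes a plain estimate.\<close>

lemma has_derivative_quadraticI:
  fixes f :: "'a::real_normed_vector \<Rightarrow> 'b::real_normed_vector"
  assumes D: "bounded_linear D" and L: "0 \<le> L"
    and bd: "\<And>y. y \<in> S \<Longrightarrow> norm (y - x) \<le> 1 \<Longrightarrow> norm (f y - f x - D (y - x)) \<le> L * (norm (y - x))\<^sup>2"
  shows "(f has_derivative D) (at x within S)"
  unfolding has_derivative_within_alt
proof (intro conjI allI impI D)
  fix e :: real assume e: "0 < e"
  show "\<exists>d>0. \<forall>y\<in>S. norm (y - x) < d \<longrightarrow> norm (f y - f x - D (y - x)) \<le> e * norm (y - x)"
  proof (intro exI[of _ "min 1 (e / (L + 1))"] conjI ballI impI)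
    show "0 < min 1 (e / (L + 1))" using e L by simp
    fix y assume y: "y \<in> S" "norm (y - x) < min 1 (e / (L + 1))"
    then have "(L + 1) * norm (y - x) \<le> e"
      using L by (simp add: field_simps)
    moreover have "L * norm (y - x) \<le> (L + 1) * norm (y - x)" by (simp add: mult_right_mono)
    ultimately have "L * norm (y - x) \<le> e" by linarith
    then have "L * norm (y - x) * norm (y - x) \<le> e * norm (y - x)"
      by (rule mult_right_mono) simp
    then show "norm (f y - f x - D (y - x)) \<le> e * norm (y - x)"
      using bd[OF y(1)] y(2) by (simp add: power2_eq_square mult.assoc)
  qed
qed

section \<open>Affine substitution in Lebesgue integrals\<close>

lemma lborel_nn_integral_affine:
  fixes f :: "'a::euclidean_space \<Rightarrow> ennreal"
  assumes [measurable]: "f \<in> borel_measurable borel" and c: "c \<noteq> 0"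
  shows "(\<integral>\<^sup>+x. f x \<partial>lborel) = ennreal (\<bar>c\<bar> ^ DIM('a)) * (\<integral>\<^sup>+x. f (t + c *\<^sub>R x) \<partial>lborel)"
  by (subst lborel_affine[OF c, of t])
    (simp add: nn_integral_density nn_integral_distr nn_integral_cmult)

lemma lborel_integrable_affine:
  fixes f :: "'a::euclidean_space \<Rightarrow> 'b::{banach, second_countable_topology}"
  assumes f: "integrable lborel f" and c: "c \<noteq> 0"
  shows "integrable lborel (\<lambda>x. f (t + c *\<^sub>R x))"
  using f f[THEN borel_measurable_integrable] unfolding integrable_iff_bounded
  by (subst (asm) lborel_nn_integral_affine[where c=c and t=t])
    (auto simp: c ennreal_mult_less_top ennreal_top_mult less_top)

lemma lborel_integral_affine:
  fixes f :: "'a::euclidean_space \<Rightarrow> 'b::{banach, second_countable_topology}"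
  assumes [measurable]: "f \<in> borel_measurable borel" and c: "c \<noteq> 0"
  shows "(\<integral>x. f x \<partial>lborel) = (\<bar>c\<bar> ^ DIM('a)) *\<^sub>R (\<integral>x. f (t + c *\<^sub>R x) \<partial>lborel)"
  by (subst lborel_affine[OF c, of t])
    (simp add: integral_density integral_distr)

lemma integrable_indicator_cball:
  "integrable lborel (indicator (cball c r) :: 'a::euclidean_space \<Rightarrow> real)"
  using emeasure_lborel_cball_finite[of c r] by (intro integrable_real_indicator) auto

section \<open>Density of compactly supported continuous functions\<close>

text \<open>The radial retraction onto the ball of radius \<open>m\<close>. Writing it with
  \<open>max\<close> makes it continuous without a case distinction.\<close>

definition clip :: "real \<Rightarrow> 'b::real_normed_vector \<Rightarrow> 'b"
  where "clip m z = (m / max m (norm z)) *\<^sub>R z"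

lemma norm_clip_le: "0 < m \<Longrightarrow> norm (clip m z) \<le> m"
  by (auto simp: clip_def max_def field_simps mult_left_mono)

lemma clip_eq: "0 < m \<Longrightarrow> norm z \<le> m \<Longrightarrow> clip m z = z"
  by (simp add: clip_def max_def)

lemma norm_clip_le_norm:
  assumes "0 < m"
  shows "norm (clip m z) \<le> norm z"
proof -
  have "m / max m (norm z) \<le> 1" using assms by (simp add: field_simps)
  then have "m / max m (norm z) * norm z \<le> 1 * norm z" by (rule mult_right_mono) simp
  then show ?thesis using assms by (simp add: clip_def abs_of_pos)
qed

lemma continuous_clip: "0 < m \<Longrightarrow> continuous_on S (clip m)"
  unfolding clip_def by (intro continuous_intros) (auto simp: max_def)

text \<open>Two dominated convergences. First \<open>f\<close> is replaced by the bounded, compactly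
  supported truncation \<open>F m\<close>, dominated by \<open>f\<close> itself. Then
  \<open>F m\<close> is approximated by continuous functions truncated in the same way, dominated by
  a constant on a fixed ball.\<close>

lemma L2_dense_continuous:
  fixes f :: "'a::euclidean_space \<Rightarrow> 'b::euclidean_space"
  assumes f: "square_integrable lborel f" and e: "0 < e"
  obtains g r where "continuous_on UNIV g" "\<And>x. r < norm x \<Longrightarrow> g x = 0"
    "square_integrable lborel g" "(\<integral>x. (norm (f x - g x))\<^sup>2 \<partial>lborel) < e"
proof -
  have fm [measurable]: "f \<in> borel_measurable borel" using f by (simp add: square_integrable_def)
  define \<kappa> where "\<kappa> m x = max 0 (min 1 (real (Suc m) - norm (x::'a)))" for m x
  have \<kappa>c: "continuous_on UNIV (\<kappa> m)" for m
    unfolding \<kappa>_def by (intro continuous_intros)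
  have [measurable]: "\<kappa> m \<in> borel_measurable borel" for m
    using \<kappa>c by (rule borel_measurable_continuous_onI)
  have [measurable]: "clip (real (Suc m)) \<in> borel_measurable (borel :: 'b measure)" for m
    by (rule borel_measurable_continuous_onI) (rule continuous_clip, simp)
  have \<kappa>01: "0 \<le> \<kappa> m x" "\<kappa> m x \<le> 1" for m x by (auto simp: \<kappa>_def)
  define F where "F m x = \<kappa> m x *\<^sub>R clip (Suc m) (f x)" for m x
  have Fle: "norm (F m x) \<le> norm (f x)" for m x
  proof -
    have "\<kappa> m x * norm (clip (Suc m) (f x)) \<le> 1 * norm (f x)"
      using \<kappa>01[of m x] norm_clip_le_norm[of "Suc m" "f x"] by (intro mult_mono) auto
    then show ?thesis using \<kappa>01[of m x] by (simp add: F_def)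
  qed
  have Fm [measurable]: "F m \<in> borel_measurable borel" for m unfolding F_def by measurable
  have Fsq: "square_integrable lborel (F m)" for m
    by (rule square_integrable_bound[OF square_integrable_integrable[OF f]])
      (auto intro: power_mono Fle)
  have "(\<lambda>m. \<integral>x. (norm (f x - F m x))\<^sup>2 \<partial>lborel) \<longlonglongrightarrow> (\<integral>x. 0 \<partial>(lborel :: 'a measure))"
  proof (rule integral_dominated_convergence[where w="\<lambda>x. 4 * (norm (f x))\<^sup>2"])
    show "integrable lborel (\<lambda>x. 4 * (norm (f x))\<^sup>2)"
      using square_integrable_integrable[OF f] by simp
    show "AE x in lborel. norm ((norm (f x - F m x))\<^sup>2) \<le> 4 * (norm (f x))\<^sup>2" for m
    proof (rule AE_I2)
      fix x
      have "(norm (f x - F m x))\<^sup>2 \<le> 2 * (norm (f x))\<^sup>2 + 2 * (norm (F m x))\<^sup>2"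
        by (rule norm_diff_squared_le)
      also have "(norm (F m x))\<^sup>2 \<le> (norm (f x))\<^sup>2" by (intro power_mono Fle) simp
      finally show "norm ((norm (f x - F m x))\<^sup>2) \<le> 4 * (norm (f x))\<^sup>2" by simp
    qed
    show "AE x in lborel. (\<lambda>m. (norm (f x - F m x))\<^sup>2) \<longlonglongrightarrow> 0"
    proof (rule AE_I2)
      fix x
      obtain N :: nat where N: "norm x + norm (f x) \<le> real N" using real_arch_simple by blast
      have "F m x = f x" if "N \<le> m" for m
      proof -
        have "norm x + norm (f x) \<le> real m" using N that by linarith
        moreover have "0 \<le> norm x" "0 \<le> norm (f x)" by auto
        ultimately have "norm x \<le> real m" "norm (f x) \<le> real (Suc m)" by linarith+
        then have "\<kappa> m x = 1" "norm (f x) \<le> real (Suc m)"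
          by (auto simp: \<kappa>_def)
        then show ?thesis by (simp add: F_def clip_eq)
      qed
      then have "\<forall>\<^sub>F m in sequentially. (norm (f x - F m x))\<^sup>2 = 0"
        unfolding eventually_sequentially by (intro exI[of _ N]) simp
      then show "(\<lambda>m. (norm (f x - F m x))\<^sup>2) \<longlonglongrightarrow> 0"
        by (rule tendsto_eventually)
    qed
  qed simp_all
  then have "\<forall>\<^sub>F m in sequentially. (\<integral>x. (norm (f x - F m x))\<^sup>2 \<partial>lborel) < e / 4"
    using e by (intro order_tendstoD) auto
  then obtain m where m: "(\<integral>x. (norm (f x - F m x))\<^sup>2 \<partial>lborel) < e / 4"
    by (auto simp: eventually_sequentially)
  \<comment> \<open>This form of measurability supplies continuous functions converging to
    \<open>f\<close> almost everywhere. They need not be bounded or compactly supported, so the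
    cutoff and the clipping that produced \<open>F m\<close> are applied to them as well.\<close>
  have "f measurable_on UNIV"
    by (rule lebesgue_measurable_imp_measurable_on) (auto intro: measurable_completion)
  then obtain N g where N: "negligible N" and gc: "\<And>n. continuous_on UNIV (g n)"
    and glim: "\<And>x. x \<notin> N \<Longrightarrow> (\<lambda>n. g n x) \<longlonglongrightarrow> f x"
    unfolding measurable_on_def by auto
  have [measurable]: "g j \<in> borel_measurable borel" for j
    using gc by (rule borel_measurable_continuous_onI)
  define h where "h j x = \<kappa> m x *\<^sub>R clip (Suc m) (g j x)" for j x
  have hc: "continuous_on UNIV (h j)" for j
    unfolding h_def
    by (intro continuous_intros \<kappa>c continuous_on_compose2[OF continuous_clip[of _ UNIV] gc]) auto
  have h0: "h j x = 0" if "real (Suc m) < norm x" for j x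
    using that by (simp add: h_def \<kappa>_def)
  have F0: "F m x = 0" if "real (Suc m) < norm x" for x
    using that by (simp add: F_def \<kappa>_def)
  have [measurable]: "h j \<in> borel_measurable borel" for j
    using hc by (rule borel_measurable_continuous_onI)
  have hle: "norm (h j x) \<le> real (Suc m)" for j x
  proof -
    have "\<kappa> m x * norm (clip (Suc m) (g j x)) \<le> 1 * real (Suc m)"
      using \<kappa>01[of m x] norm_clip_le[of "Suc m" "g j x"] by (intro mult_mono) auto
    then show ?thesis using \<kappa>01[of m x] by (simp add: h_def)
  qed
  have Fle2: "norm (F m x) \<le> real (Suc m)" for x
  proof -
    have "\<kappa> m x * norm (clip (Suc m) (f x)) \<le> 1 * real (Suc m)"
      using \<kappa>01[of m x] norm_clip_le[of "Suc m" "f x"] by (intro mult_mono) auto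
    then show ?thesis using \<kappa>01[of m x] by (simp add: F_def)
  qed
  define w where "w x = indicator (cball 0 (real (Suc m))) (x::'a) * (4 * (real (Suc m))\<^sup>2)" for x
  have wi: "integrable lborel w"
    unfolding w_def by (intro integrable_mult_left integrable_indicator_cball)
  have hsq: "square_integrable lborel (h j)" for j
  proof (rule square_integrable_bound[OF wi])
    show "(norm (h j x))\<^sup>2 \<le> w x" for x
    proof (cases "real (Suc m) < norm x")
      case False
      have "(norm (h j x))\<^sup>2 \<le> (real (Suc m))\<^sup>2" by (intro power_mono hle) simp
      also have "\<dots> \<le> 4 * (real (Suc m))\<^sup>2" by simp
      finally show ?thesis using False by (simp add: w_def)
    qed (simp add: h0 w_def)
  qed simp
  have "(\<lambda>j. \<integral>x. (norm (F m x - h j x))\<^sup>2 \<partial>lborel) \<longlonglongrightarrow> (\<integral>x. 0 \<partial>(lborel :: 'a measure))"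
  proof (rule integral_dominated_convergence[OF _ _ wi])
    show "AE x in lborel. norm ((norm (F m x - h j x))\<^sup>2) \<le> w x" for j
    proof (rule AE_I2)
      fix x
      show "norm ((norm (F m x - h j x))\<^sup>2) \<le> w x"
      proof (cases "real (Suc m) < norm x")
        case False
        have "(norm (F m x - h j x))\<^sup>2 \<le> 2 * (norm (F m x))\<^sup>2 + 2 * (norm (h j x))\<^sup>2"
          by (rule norm_diff_squared_le)
        also have "\<dots> \<le> 2 * (real (Suc m))\<^sup>2 + 2 * (real (Suc m))\<^sup>2"
          by (intro add_mono mult_left_mono power_mono hle Fle2) auto
        finally show ?thesis using False by (simp add: w_def)
      qed (simp add: h0 F0 w_def)
    qed
    have "AE x in lebesgue. x \<notin> N"
      using N by (simp add: negligible_iff_null_sets AE_not_in)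
    then have "AE x in lborel. x \<notin> N" by (simp add: AE_completion_iff)
    then show "AE x in lborel. (\<lambda>j. (norm (F m x - h j x))\<^sup>2) \<longlonglongrightarrow> 0"
    proof (rule AE_mp, intro AE_I2 impI)
      fix x assume "x \<notin> N"
      then have "(\<lambda>j. g j x) \<longlonglongrightarrow> f x" by (rule glim)
      moreover have "isCont (clip (real (Suc m))) (f x)"
      proof -
        have "continuous_on UNIV (clip (real (Suc m)) :: 'b \<Rightarrow> 'b)" by (rule continuous_clip) simp
        then show ?thesis by (simp only: continuous_on_eq_continuous_at[OF open_UNIV]) blast
      qed
      ultimately have "(\<lambda>j. clip (Suc m) (g j x)) \<longlonglongrightarrow> clip (Suc m) (f x)"
        by (rule isCont_tendsto_compose[rotated])
      then have "(\<lambda>j. h j x) \<longlonglongrightarrow> F m x" unfolding h_def F_def by (intro tendsto_intros)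
      then show "(\<lambda>j. (norm (F m x - h j x))\<^sup>2) \<longlonglongrightarrow> 0"
        by (auto intro!: tendsto_eq_intros)
    qed
  qed simp_all
  then have "\<forall>\<^sub>F j in sequentially. (\<integral>x. (norm (F m x - h j x))\<^sup>2 \<partial>lborel) < e / 4"
    using e by (intro order_tendstoD) auto
  then obtain j where j: "(\<integral>x. (norm (F m x - h j x))\<^sup>2 \<partial>lborel) < e / 4"
    by (auto simp: eventually_sequentially)
  have i: "integrable lborel (\<lambda>x. (norm (f x - h j x))\<^sup>2)" "integrable lborel (\<lambda>x. (norm (f x - F m x))\<^sup>2)"
     "integrable lborel (\<lambda>x. (norm (F m x - h j x))\<^sup>2)"
    using f Fsq hsq by (auto intro!: square_integrable_integrable square_integrable_diff)
  have "(\<integral>x. (norm (f x - h j x))\<^sup>2 \<partial>lborel)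
     \<le> (\<integral>x. 2 * (norm (f x - F m x))\<^sup>2 + 2 * (norm (F m x - h j x))\<^sup>2 \<partial>lborel)"
  proof (rule integral_mono)
    show "(norm (f x - h j x))\<^sup>2 \<le> 2 * (norm (f x - F m x))\<^sup>2 + 2 * (norm (F m x - h j x))\<^sup>2" for x
      using norm_add_squared_le[of "f x - F m x" "F m x - h j x"] by simp
  qed (use i in auto)
  also have "\<dots> < e" using i m j by simp
  finally show ?thesis using that[of "h j" "real (Suc m)"] hc h0 hsq by blast
qed

section \<open>The bump function\<close>

text \<open>A polynomial profile instead of a smooth exponential one: \<open>C1c\<close> asks for a
  single continuous derivative, and here every Taylor constant is explicit.\<close>

definition bump :: "'a::euclidean_space \<Rightarrow> real"
  where "bump x = (max 0 (1 - (norm x)\<^sup>2))\<^sup>2"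

definition bump_grad :: "'a::euclidean_space \<Rightarrow> 'a"
  where "bump_grad x = (- 4 * max 0 (1 - (norm x)\<^sup>2)) *\<^sub>R x"

lemma bump_nonneg [simp]: "0 \<le> bump x"
  by (simp add: bump_def)

lemma bump_le_1: "bump x \<le> 1"
proof -
  have "(max 0 (1 - (norm x)\<^sup>2))\<^sup>2 \<le> 1\<^sup>2" by (intro power_mono) auto
  then show ?thesis by (simp add: bump_def)
qed

lemma bump_eq_0: "1 \<le> norm x \<Longrightarrow> bump x = 0"
  using power_mono[of 1 "norm x" 2] by (simp add: bump_def)

lemma bump_grad_eq_0: "1 \<le> norm x \<Longrightarrow> bump_grad x = 0"
  using power_mono[of 1 "norm x" 2] by (simp add: bump_grad_def)

lemma norm_bump_grad_le: "norm (bump_grad x) \<le> 4"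
proof (cases "1 \<le> norm x")
  case False
  then have "max 0 (1 - (norm x)\<^sup>2) * norm x \<le> 1 * 1" by (intro mult_mono) auto
  then show ?thesis by (simp add: bump_grad_def abs_mult)
qed (simp add: bump_grad_eq_0)

lemma continuous_bump: "continuous_on S bump"
  unfolding bump_def by (intro continuous_intros)

lemma continuous_bump_grad: "continuous_on S bump_grad"
  unfolding bump_grad_def by (intro continuous_intros)

lemma borel_measurable_bump [measurable]: "bump \<in> borel_measurable borel"
  by (rule borel_measurable_continuous_onI[OF continuous_bump])

lemma borel_measurable_bump_grad [measurable]: "bump_grad \<in> borel_measurable borel"
  by (rule borel_measurable_continuous_onI[OF continuous_bump_grad])

text \<open>The derivative \<open>2 * max 0 s\<close> has Lipschitz constant 2, hence a remainder of
  at most \<open>(t - s)^2\<close>. The argument goes through the signs of \<open>s\<close> and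
  \<open>t\<close>.\<close>

lemma square_pos_part_taylor: "\<bar>(max 0 t)\<^sup>2 - (max 0 s)\<^sup>2 - 2 * max 0 s * (t - s)\<bar> \<le> (t - s)\<^sup>2" for s t :: real
proof (cases "0 \<le> s"; cases "0 \<le> t")
  assume "0 \<le> s" "\<not> 0 \<le> t"
  then have "s * t \<le> 0" "0 \<le> s * s" "0 \<le> t * t" by (auto simp: mult_nonneg_nonpos)
  moreover have "(max 0 t)\<^sup>2 - (max 0 s)\<^sup>2 - 2 * max 0 s * (t - s) = s * s - 2 * (s * t)"
    "(t - s)\<^sup>2 = t * t - 2 * (s * t) + s * s"
    using \<open>0 \<le> s\<close> \<open>\<not> 0 \<le> t\<close> by (simp_all add: max_def power2_eq_square algebra_simps)
  ultimately show ?thesis by linarith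
next
  assume "\<not> 0 \<le> s" "0 \<le> t"
  then have "t * s \<le> 0" "0 \<le> s * s" "0 \<le> t * t" by (auto simp: mult_nonneg_nonpos)
  then show ?thesis using \<open>0 \<le> t\<close> \<open>\<not> 0 \<le> s\<close> by (simp add: max_def power2_eq_square algebra_simps abs_le_iff)
next
  assume "0 \<le> s" "0 \<le> t"
  then have "(max 0 t)\<^sup>2 - (max 0 s)\<^sup>2 - 2 * max 0 s * (t - s) = (t - s)\<^sup>2"
    by (simp add: power2_eq_square algebra_simps)
  then show ?thesis by simp
qed simp

lemma has_real_derivative_square_pos_part:
  "((\<lambda>t::real. (max 0 t)\<^sup>2) has_real_derivative 2 * max 0 s) (at s)"
  unfolding has_field_derivative_def
  by (rule has_derivative_quadraticI[where L=1])
    (use square_pos_part_taylor in \<open>auto intro: bounded_linear_mult_right\<close>)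

text \<open>For \<open>norm x \<le> 2\<close> and a step \<open>h\<close> of length at most 1, the
  quantity 1 - |x|^2 changes by at most 5 |h|, which contributes 25. Its second-order part |h|^2
  enters with the weight \<open>2 * max 0 s \<le> 2\<close>, giving 27 in total. For larger
  \<open>x\<close> both points lie outside the unit ball.\<close>

lemma bump_taylor:
  fixes x y :: "'a::euclidean_space"
  assumes "norm (y - x) \<le> 1"
  shows "\<bar>bump y - bump x - (y - x) \<bullet> bump_grad x\<bar> \<le> 27 * (norm (y - x))\<^sup>2"
proof (cases "norm x \<le> 2")
  case False
  then have "1 \<le> norm x" "1 \<le> norm y" using assms norm_triangle_ineq2[of x y] by (auto simp: norm_minus_commute)
  then show ?thesis by (simp add: bump_eq_0 bump_grad_eq_0)
next
  case True
  define h where "h = y - x"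
  define s where "s = 1 - (norm x)\<^sup>2"
  define t where "t = 1 - (norm y)\<^sup>2"
  have ts: "t - s = - 2 * (x \<bullet> h) - (norm h)\<^sup>2"
    unfolding t_def s_def h_def by (simp add: power2_norm_eq_inner algebra_simps inner_commute)
  have "\<bar>x \<bullet> h\<bar> \<le> 2 * norm h"
    using Cauchy_Schwarz_ineq2[of x h] mult_right_mono[OF True norm_ge_zero[of h]] by linarith
  moreover have "(norm h)\<^sup>2 \<le> norm h"
    using assms by (simp add: h_def power2_eq_square mult_left_le)
  ultimately have "\<bar>t - s\<bar> \<le> 5 * norm h"
    unfolding ts by (smt (verit) zero_le_power2)
  then have "(t - s)\<^sup>2 \<le> (5 * norm h)\<^sup>2" by (metis abs_ge_zero power2_abs power_mono)
  then have tssq: "(t - s)\<^sup>2 \<le> 25 * (norm h)\<^sup>2" by (simp add: power_mult_distrib)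
  have "bump y - bump x - h \<bullet> bump_grad x
    = ((max 0 t)\<^sup>2 - (max 0 s)\<^sup>2 - 2 * max 0 s * (t - s)) - 2 * max 0 s * (norm h)\<^sup>2"
    unfolding ts by (simp add: bump_def bump_grad_def s_def t_def algebra_simps inner_commute)
  moreover have "0 \<le> 2 * max 0 s * (norm h)\<^sup>2" by simp
  moreover have "2 * max 0 s * (norm h)\<^sup>2 \<le> 2 * 1 * (norm h)\<^sup>2"
    by (intro mult_right_mono mult_left_mono) (auto simp: s_def)
  ultimately show ?thesis
    using square_pos_part_taylor[of t s] tssq unfolding h_def[symmetric] by linarith
qed

text \<open>The restriction to short steps has to go because the mollifier evaluates the bump at
  arguments scaled by \<open>Suc n\<close>. For long steps the sizes 1 and 4 of the bump and its
  gradient are enough.\<close>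

lemma bump_taylor_global:
  fixes x y :: "'a::euclidean_space"
  shows "\<bar>bump y - bump x - (y - x) \<bullet> bump_grad x\<bar> \<le> 27 * (norm (y - x))\<^sup>2"
proof (cases "norm (y - x) \<le> 1")
  case False
  define t where "t = norm (y - x)"
  have t: "1 \<le> t" using False by (simp add: t_def)
  then have t2: "t \<le> t\<^sup>2" by (simp add: power2_eq_square)
  have "\<bar>bump y - bump x\<bar> \<le> 1"
    using bump_le_1[of x] bump_le_1[of y] bump_nonneg[of x] bump_nonneg[of y] by linarith
  moreover have "\<bar>(y - x) \<bullet> bump_grad x\<bar> \<le> t * 4"
    using Cauchy_Schwarz_ineq2[of "y - x" "bump_grad x"]
      mult_left_mono[OF norm_bump_grad_le[of x], of t] by (simp add: t_def)
  ultimately show ?thesis using t t2 unfolding t_def[symmetric] by linarith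
qed (rule bump_taylor)

lemma has_derivative_bump: "(bump has_derivative (\<lambda>h. h \<bullet> bump_grad x)) (at x within S)"
  by (rule has_derivative_quadraticI[where L=27])
    (use bump_taylor_global in \<open>auto intro: bounded_linear_inner_left\<close>)

lemma bump_Lipschitz: "\<bar>bump x - bump y\<bar> \<le> 4 * norm (x - y)" for x y :: "'a::euclidean_space"
proof -
  have "norm (bump x - bump y) \<le> 4 * norm (x - y)"
  proof (rule differentiable_bound[of UNIV])
    show "onorm (\<lambda>h. h \<bullet> bump_grad z) \<le> 4" for z :: 'a
    proof (rule onorm_le)
      fix h :: 'a
      have "norm h * norm (bump_grad z) \<le> norm h * 4"
        by (intro mult_left_mono norm_bump_grad_le) simp
      then show "norm (h \<bullet> bump_grad z) \<le> 4 * norm h"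
        using Cauchy_Schwarz_ineq2[of h "bump_grad z"] by simp
    qed
  qed (auto intro: has_derivative_bump)
  then show ?thesis by simp
qed

lemma integrable_bump: "integrable lborel (bump :: 'a::euclidean_space \<Rightarrow> real)"
proof (rule Bochner_Integration.integrable_bound[where f="indicator (cball 0 1) :: 'a \<Rightarrow> real"])
  show "integrable lborel (indicator (cball (0::'a) 1) :: 'a \<Rightarrow> real)"
    by (rule integrable_indicator_cball)
  show "AE x in lborel. norm (bump x) \<le> norm (indicator (cball (0::'a) 1) x :: real)"
    by (intro AE_I2) (auto simp: indicator_def bump_le_1 bump_eq_0)
qed simp

lemma integral_bump_pos: "0 < (\<integral>x. bump (x::'a::euclidean_space) \<partial>lborel)"
proof -
  define B where "B = cball (0::'a) (1/2)"
  have "0 < measure lborel B"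
    unfolding B_def using content_cball_pos[of "1/2" "0::'a"] by simp
  then have "0 < (\<integral>x. (1/2) * indicator B x \<partial>lborel :: real)"
    by (simp add: B_def)
  also have "\<dots> \<le> (\<integral>x. bump (x::'a) \<partial>lborel)"
  proof (rule integral_mono)
    show "integrable lborel (\<lambda>x. (1/2) * indicator B x :: real)"
      unfolding B_def by (intro integrable_mult_right integrable_indicator_cball)
    show "(1/2) * indicator B x \<le> bump x" for x :: 'a
    proof (cases "x \<in> B")
      case True
      then have "(norm x)\<^sup>2 \<le> (1/2)\<^sup>2" by (intro power_mono) (auto simp: B_def)
      then have "(3/4)\<^sup>2 \<le> (max 0 (1 - (norm x)\<^sup>2))\<^sup>2"
        by (intro power_mono) (auto simp: power2_eq_square)
      moreover have "(1/2::real) \<le> (3/4)\<^sup>2" by (simp add: power2_eq_square)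
      ultimately have "1/2 \<le> bump x" unfolding bump_def by linarith
      then show ?thesis using True by simp
    qed simp
  qed (rule integrable_bump)
  finally show ?thesis .
qed

section \<open>One-sided mollification\<close>

text \<open>
  The kernel is centred at \<open>2 *\<^sub>R e / Suc n\<close>, so that the mean at a point of the boundary of the
  half-space with inner normal \<open>e\<close> only involves values in the interior.
\<close>

definition mollifier :: "'a::euclidean_space \<Rightarrow> nat \<Rightarrow> 'a \<Rightarrow> real"
  where "mollifier e n y = real (Suc n) ^ DIM('a) / (\<integral>x. bump (x::'a) \<partial>lborel)
    * bump (real (Suc n) *\<^sub>R y - 2 *\<^sub>R e)"

text \<open>The kernel is evaluated at \<open>y - x\<close>, not at \<open>x - y\<close>: the mean
  at \<open>x\<close> is taken over a ball displaced from \<open>x\<close> in the direction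
  \<open>+ e\<close>.\<close>

definition mollify :: "'a::euclidean_space \<Rightarrow> nat \<Rightarrow> ('a \<Rightarrow> 'b::euclidean_space) \<Rightarrow> 'a \<Rightarrow> 'b"
  where "mollify e n f x = (\<integral>y. mollifier e n (y - x) *\<^sub>R f y \<partial>lborel)"

lemma mollifier_nonneg [simp]: "0 \<le> mollifier e n y"
  using integral_bump_pos[where 'a='a] by (auto simp: mollifier_def)

lemma borel_measurable_mollifier [measurable]: "mollifier e n \<in> borel_measurable borel"
  unfolding mollifier_def by measurable

text \<open>The support is the ball of radius 1/N about 2e/N with N = \<open>Suc n\<close>, so
  distances to the origin stay below 3/N and the component along \<open>e\<close> exceeds 1/N. The
  bound 3 is the version uniform in \<open>n\<close>.\<close>

lemma mollifier_support:
  assumes "norm e = 1" "mollifier e n y \<noteq> 0"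
  shows "norm y < 3 / real (Suc n)" "norm y < 3" "0 < y \<bullet> e"
proof -
  let ?N = "real (Suc n)"
  have lt: "norm (?N *\<^sub>R y - 2 *\<^sub>R e) < 1"
    using assms(2) bump_eq_0[of "?N *\<^sub>R y - 2 *\<^sub>R e"] by (fastforce simp: mollifier_def)
  have "norm (?N *\<^sub>R y) < 3"
    using norm_triangle_sub[of "?N *\<^sub>R y" "2 *\<^sub>R e"] lt assms(1) by simp
  then show *: "norm y < 3 / ?N" by (simp add: field_simps del: of_nat_Suc)
  have "3 / ?N \<le> 3" by (simp add: field_simps)
  with * show "norm y < 3" by linarith
  have "\<bar>(?N *\<^sub>R y - 2 *\<^sub>R e) \<bullet> e\<bar> < 1"
    using Cauchy_Schwarz_ineq2[of "?N *\<^sub>R y - 2 *\<^sub>R e" e] lt assms(1) by simp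
  moreover have "(?N *\<^sub>R y - 2 *\<^sub>R e) \<bullet> e = ?N * (y \<bullet> e) - 2"
    using assms(1) by (simp add: inner_diff_left power2_norm_eq_inner[symmetric])
  ultimately have "0 < ?N * (y \<bullet> e)" by linarith
  then show "0 < y \<bullet> e" by (simp add: zero_less_mult_iff)
qed

text \<open>Unit mass is needed in each variable separately: in \<open>y\<close> to regard
  \<open>mollify\<close> as a weighted mean, in \<open>x\<close> for the exchange of integrals in
  the contraction property.\<close>

lemma mollifier_integral:
  fixes e :: "'a::euclidean_space"
  shows "integrable lborel (\<lambda>y. mollifier e n (y - x))" "(\<integral>y. mollifier e n (y - x) \<partial>lborel) = 1"
    "integrable lborel (\<lambda>x. mollifier e n (y - x))" "(\<integral>x. mollifier e n (y - x) \<partial>lborel) = 1"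
proof -
  let ?N = "real (Suc n)" and ?I = "\<integral>x. bump (x::'a) \<partial>lborel"
  have N: "?N \<noteq> 0" "- ?N \<noteq> 0" by auto
  have eq: "?N *\<^sub>R (y - x) - 2 *\<^sub>R e = (- 2 *\<^sub>R e - ?N *\<^sub>R x) + ?N *\<^sub>R y"
     "?N *\<^sub>R (y - x) - 2 *\<^sub>R e = (- 2 *\<^sub>R e + ?N *\<^sub>R y) + (- ?N) *\<^sub>R x" for x y
    by (simp_all add: algebra_simps)
  show "integrable lborel (\<lambda>y. mollifier e n (y - x))"
    unfolding mollifier_def eq(1)
    by (intro integrable_mult_right lborel_integrable_affine integrable_bump N)
  show "integrable lborel (\<lambda>x. mollifier e n (y - x))"
    unfolding mollifier_def eq(2)
    by (intro integrable_mult_right lborel_integrable_affine integrable_bump N)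
  have I: "?I \<noteq> 0" using integral_bump_pos[where 'a='a] by simp
  show "(\<integral>y. mollifier e n (y - x) \<partial>lborel) = 1"
    unfolding mollifier_def eq(1)
    using lborel_integral_affine[of "bump :: 'a \<Rightarrow> real" ?N "- 2 *\<^sub>R e - ?N *\<^sub>R x"] I N
    by (simp del: of_nat_Suc add: field_simps)
  show "(\<integral>x. mollifier e n (y - x) \<partial>lborel) = 1"
    unfolding mollifier_def eq(2)
    using lborel_integral_affine[of "bump :: 'a \<Rightarrow> real" "- ?N" "- 2 *\<^sub>R e + ?N *\<^sub>R y"] I N
    by (simp del: of_nat_Suc add: field_simps)
qed

lemma mollifier_bounded: "\<exists>K. \<forall>y. mollifier e n y \<le> K"
proof (intro exI allI)
  fix y :: 'a
  show "mollifier e n y \<le> real (Suc n) ^ DIM('a) / (\<integral>x. bump (x::'a) \<partial>lborel) * 1"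
    unfolding mollifier_def using integral_bump_pos[where 'a='a] by (intro mult_left_mono bump_le_1) auto
qed

lemma mollifier_scaleR_integrable:
  fixes f :: "'a::euclidean_space \<Rightarrow> 'b::euclidean_space"
  assumes f: "square_integrable lborel f"
  shows "integrable lborel (\<lambda>y. mollifier e n (y - x) * (norm (f y))\<^sup>2)" (is ?A)
    and "integrable lborel (\<lambda>y. mollifier e n (y - x) *\<^sub>R f y)" (is ?B)
proof -
  obtain K where K: "\<And>y. mollifier e n y \<le> K" using mollifier_bounded by blast
  have [measurable]: "f \<in> borel_measurable borel" using f by (simp add: square_integrable_def)
  show A: ?A
    by (rule Bochner_Integration.integrable_bound[where f="\<lambda>y. K * (norm (f y))\<^sup>2"])
      (use f K in \<open>auto simp: square_integrable_def abs_mult intro!: AE_I2 mult_right_mono order_trans[OF K abs_ge_self]\<close>)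
  show ?B
  proof (rule Bochner_Integration.integrable_bound)
    show "integrable lborel (\<lambda>y. mollifier e n (y - x) + mollifier e n (y - x) * (norm (f y))\<^sup>2)"
      using A mollifier_integral(1) by (rule Bochner_Integration.integrable_add[rotated])
    have "norm z \<le> 1 + (norm z)\<^sup>2" for z :: 'b
      using sum_squares_bound[of "norm z" 1] zero_le_power2[of "norm z"] norm_ge_zero[of z] by (simp; linarith)
    then have "k * norm z \<le> k * (1 + (norm z)\<^sup>2)" if "0 \<le> k" for z :: 'b and k
      using that by (rule mult_left_mono)
    then show "AE y in lborel. norm (mollifier e n (y - x) *\<^sub>R f y)
        \<le> norm (mollifier e n (y - x) + mollifier e n (y - x) * (norm (f y))\<^sup>2)"
      by (intro AE_I2) (simp add: distrib_left)
  qed simp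
qed

lemma mollify_diff:
  assumes "square_integrable lborel f" "square_integrable lborel g"
  shows "mollify e n (\<lambda>y. f y - g y) x = mollify e n f x - mollify e n g x"
  unfolding mollify_def scaleR_diff_right
  by (intro Bochner_Integration.integral_diff mollifier_scaleR_integrable assms)

text \<open>All kernels reach at most 3, whatever \<open>n\<close> is. Hence functions that are only
  locally square integrable can be truncated before the global L2 theory is applied.\<close>

lemma mollify_local:
  assumes "norm e = 1" "norm x + 3 \<le> R"
  shows "mollify e n f x = mollify e n (\<lambda>y. indicator (cball 0 R) y *\<^sub>R f y) x"
  unfolding mollify_def
proof (rule Bochner_Integration.integral_cong)
  fix y
  have "mollifier e n (y - x) = 0" if "y \<notin> cball 0 R"
  proof (rule ccontr)
    assume "mollifier e n (y - x) \<noteq> 0"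
    from mollifier_support(2)[OF assms(1) this] have "norm (y - x) < 3" .
    then show False using that assms(2) norm_triangle_sub[of y x] by simp
  qed
  then show "mollifier e n (y - x) *\<^sub>R f y = mollifier e n (y - x) *\<^sub>R indicator (cball 0 R) y *\<^sub>R f y"
    by (cases "y \<in> cball 0 R") auto
qed simp

lemma borel_measurable_mollify:
  fixes f :: "'a::euclidean_space \<Rightarrow> 'b::euclidean_space"
  assumes [measurable]: "f \<in> borel_measurable borel"
  shows "mollify e n f \<in> borel_measurable borel"
  unfolding mollify_def by measurable

lemma norm_mollify_le:
  fixes f :: "'a::euclidean_space \<Rightarrow> 'b::euclidean_space"
  assumes e: "norm e = 1" and B: "\<And>y. norm (y - x) < 3 / real (Suc n) \<Longrightarrow> norm (f y) \<le> B"
    and i: "integrable lborel (\<lambda>y. mollifier e n (y - x) *\<^sub>R f y)"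
  shows "norm (mollify e n f x) \<le> B"
proof -
  have "norm (mollify e n f x) \<le> (\<integral>y. mollifier e n (y - x) * B \<partial>lborel)"
    unfolding mollify_def
  proof (rule order_trans[OF integral_norm_bound], rule integral_mono)
    show "integrable lborel (\<lambda>y. norm (mollifier e n (y - x) *\<^sub>R f y))" using i by (rule integrable_norm)
    show "integrable lborel (\<lambda>y. mollifier e n (y - x) * B)"
      by (intro integrable_mult_left mollifier_integral)
    fix y
    show "norm (mollifier e n (y - x) *\<^sub>R f y) \<le> mollifier e n (y - x) * B"
    proof (cases "mollifier e n (y - x) = 0")
      case False
      then show ?thesis using B[of y] mollifier_support(1)[OF e False]
        by (simp add: mult_left_mono)
    qed simp
  qed
  then show ?thesis by (simp add: mollifier_integral)
qed

text \<open>Jensen's inequality at each point, then Tonelli and the unit mass of the kernel in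
  \<open>x\<close>.\<close>

lemma mollify_contraction:
  fixes f :: "'a::euclidean_space \<Rightarrow> 'b::euclidean_space"
  assumes f: "square_integrable lborel f"
  shows "square_integrable lborel (mollify e n f)" (is ?A)
    "(\<integral>x. (norm (mollify e n f x))\<^sup>2 \<partial>lborel) \<le> (\<integral>x. (norm (f x))\<^sup>2 \<partial>lborel)" (is ?B)
proof -
  have [measurable]: "f \<in> borel_measurable borel" using f by (simp add: square_integrable_def)
  note [measurable] = borel_measurable_mollify
  let ?k = "mollifier e n"
  note fi = square_integrable_integrable[OF f]
  have "(\<integral>\<^sup>+x. ennreal ((norm (mollify e n f x))\<^sup>2) \<partial>lborel)
      \<le> (\<integral>\<^sup>+x. \<integral>\<^sup>+y. ennreal (?k (y - x) * (norm (f y))\<^sup>2) \<partial>lborel \<partial>lborel)"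
  proof (rule nn_integral_mono)
    fix x
    have "(norm (mollify e n f x))\<^sup>2 \<le> (\<integral>y. ?k (y - x) * (norm (f y))\<^sup>2 \<partial>lborel)"
      unfolding mollify_def
      by (rule norm_weighted_mean_squared_le) (auto intro: mollifier_integral mollifier_scaleR_integrable[OF f])
    then show "ennreal ((norm (mollify e n f x))\<^sup>2) \<le> (\<integral>\<^sup>+y. ennreal (?k (y - x) * (norm (f y))\<^sup>2) \<partial>lborel)"
      by (subst nn_integral_eq_integral) (auto intro: mollifier_scaleR_integrable[OF f] ennreal_leI)
  qed
  also have "\<dots> = (\<integral>\<^sup>+y. \<integral>\<^sup>+x. ennreal (?k (y - x) * (norm (f y))\<^sup>2) \<partial>lborel \<partial>lborel)"
    by (rule lborel_pair.Fubini') simp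
  also have "\<dots> = (\<integral>\<^sup>+y. ennreal ((norm (f y))\<^sup>2) \<partial>lborel)"
  proof (rule nn_integral_cong)
    fix y
    have "(\<integral>\<^sup>+x. ennreal (?k (y - x) * (norm (f y))\<^sup>2) \<partial>lborel)
       = ennreal (\<integral>x. ?k (y - x) * (norm (f y))\<^sup>2 \<partial>lborel)"
      by (rule nn_integral_eq_integral) (auto intro: mollifier_integral)
    then show "(\<integral>\<^sup>+x. ennreal (?k (y - x) * (norm (f y))\<^sup>2) \<partial>lborel) = ennreal ((norm (f y))\<^sup>2)"
      by (simp add: mollifier_integral)
  qed
  also have "\<dots> = ennreal (\<integral>y. (norm (f y))\<^sup>2 \<partial>lborel)"
    by (rule nn_integral_eq_integral[OF fi]) simp
  finally have le: "(\<integral>\<^sup>+x. ennreal ((norm (mollify e n f x))\<^sup>2) \<partial>lborel) \<le> ennreal (\<integral>y. (norm (f y))\<^sup>2 \<partial>lborel)" .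
  have int: "integrable lborel (\<lambda>x. (norm (mollify e n f x))\<^sup>2)"
    unfolding integrable_iff_bounded using le by (auto intro: le_less_trans)
  then show ?A by (simp add: square_integrable_def)
  show ?B using le by (subst (asm) nn_integral_eq_integral[OF int]) (auto simp: ennreal_le_iff)
qed

lemma mollify_tendsto_continuous:
  fixes g :: "'a::euclidean_space \<Rightarrow> 'b::euclidean_space"
  assumes e: "norm e = 1" and gc: "continuous_on UNIV g" and g0: "\<And>x. r < norm x \<Longrightarrow> g x = 0"
    and g: "square_integrable lborel g"
  shows "(\<lambda>n. \<integral>x. (norm (mollify e n g x - g x))\<^sup>2 \<partial>lborel) \<longlonglongrightarrow> 0"
proof -
  have [measurable]: "g \<in> borel_measurable borel" using g by (simp add: square_integrable_def)
  note [measurable] = borel_measurable_mollify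
  have "bounded (g ` cball 0 r)"
    by (intro compact_imp_bounded compact_continuous_image continuous_on_subset[OF gc]) auto
  then obtain B where B: "0 < B" "\<And>x. x \<in> cball 0 r \<Longrightarrow> norm (g x) \<le> B"
    unfolding bounded_pos by auto
  have gB: "norm (g x) \<le> B" for x
    using B g0[of x] by (cases "r < norm x") auto
  define w where "w x = indicator (cball 0 (r + 3)) (x::'a) * (4 * B\<^sup>2)" for x
  have wi: "integrable lborel w"
    unfolding w_def by (intro integrable_mult_left integrable_indicator_cball)
  have "(\<lambda>n. \<integral>x. (norm (mollify e n g x - g x))\<^sup>2 \<partial>lborel) \<longlonglongrightarrow> (\<integral>x. 0 \<partial>(lborel :: 'a measure))"
  proof (rule integral_dominated_convergence[OF _ _ wi])
    show "AE x in lborel. norm ((norm (mollify e n g x - g x))\<^sup>2) \<le> w x" for n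
    proof (rule AE_I2)
      fix x
      have 1: "norm (mollify e n g x) \<le> B"
        by (rule norm_mollify_le[OF e gB mollifier_scaleR_integrable(2)[OF g]])
      have 2: "mollify e n g x = 0" if "r + 3 < norm x"
      proof -
        have "norm (mollify e n g x) \<le> 0"
        proof (rule norm_mollify_le[OF e _ mollifier_scaleR_integrable(2)[OF g]])
          fix y assume "norm (y - x) < 3 / real (Suc n)"
          moreover have "3 / real (Suc n) \<le> 3" by (simp add: field_simps)
          ultimately have "r < norm y" using norm_triangle_sub[of x y] that by (simp add: norm_minus_commute)
          then show "norm (g y) \<le> 0" by (simp add: g0)
        qed
        then show ?thesis by simp
      qed
      show "norm ((norm (mollify e n g x - g x))\<^sup>2) \<le> w x"
      proof (cases "r + 3 < norm x")
        case False
        have "(norm (mollify e n g x - g x))\<^sup>2 \<le> 2 * (norm (mollify e n g x))\<^sup>2 + 2 * (norm (g x))\<^sup>2"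
          by (rule norm_diff_squared_le)
        also have "\<dots> \<le> 2 * B\<^sup>2 + 2 * B\<^sup>2"
          by (intro add_mono mult_left_mono power_mono 1 gB) auto
        finally show ?thesis using False by (simp add: w_def)
      qed (simp add: 2 g0 w_def)
    qed
    show "AE x in lborel. (\<lambda>n. (norm (mollify e n g x - g x))\<^sup>2) \<longlonglongrightarrow> 0"
    proof (rule AE_I2)
      fix x
      have "(\<lambda>n. mollify e n g x) \<longlonglongrightarrow> g x"
      proof (rule LIMSEQ_I)
        fix \<epsilon> :: real assume \<epsilon>: "0 < \<epsilon>"
        then obtain d where d: "0 < d" "\<And>y. norm (y - x) < d \<Longrightarrow> norm (g y - g x) < \<epsilon> / 2"
          using gc[unfolded continuous_on_eq_continuous_at[OF open_UNIV], rule_format, of x]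
          unfolding continuous_at_eps_delta dist_norm by (meson UNIV_I half_gt_zero)
        obtain N where N: "3 / d < real N" using reals_Archimedean2 by blast
        have "norm (mollify e n g x - g x) < \<epsilon>" if n: "N \<le> n" for n
        proof -
          have nd: "3 / real (Suc n) < d"
            using N n d(1) by (simp add: field_simps) (smt (verit) mult_left_mono of_nat_mono)
          have ki: "integrable lborel (\<lambda>y. mollifier e n (y - x) *\<^sub>R g x)"
            by (intro integrable_scaleR_left mollifier_integral)
          have "mollify e n g x - g x = mollify e n (\<lambda>y. g y - g x) x"
            unfolding mollify_def scaleR_diff_right
            by (subst Bochner_Integration.integral_diff[OF mollifier_scaleR_integrable(2)[OF g] ki])
              (simp add: mollifier_integral)
          also have "norm \<dots> \<le> \<epsilon> / 2"
          proof (rule norm_mollify_le[OF e])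
            show "norm (g y - g x) \<le> \<epsilon> / 2" if "norm (y - x) < 3 / real (Suc n)" for y
              using d(2)[of y] that nd by simp
            show "integrable lborel (\<lambda>y. mollifier e n (y - x) *\<^sub>R (g y - g x))"
              unfolding scaleR_diff_right
              by (intro Bochner_Integration.integrable_diff mollifier_scaleR_integrable(2)[OF g] ki)
          qed
          finally show ?thesis using \<epsilon> by simp
        qed
        then show "\<exists>N. \<forall>n\<ge>N. norm (mollify e n g x - g x) < \<epsilon>" by blast
      qed
      then have "(\<lambda>n. mollify e n g x - g x) \<longlonglongrightarrow> 0" by (simp add: LIM_zero_iff)
      from tendsto_power[OF tendsto_norm_zero[OF this], of 2]
      show "(\<lambda>n. (norm (mollify e n g x - g x))\<^sup>2) \<longlonglongrightarrow> 0" by simp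
    qed
  qed simp_all
  then show ?thesis by simp
qed

text \<open>The mollifications are contractions uniformly in \<open>n\<close>, so convergence on the
  dense class of compactly supported continuous functions extends to all of L2.\<close>

lemma mollify_tendsto:
  fixes f :: "'a::euclidean_space \<Rightarrow> 'b::euclidean_space"
  assumes e: "norm e = 1" and f: "square_integrable lborel f"
  shows "L2_tendsto lborel (\<lambda>n. mollify e n f) f"
proof -
  have "(\<lambda>n. \<integral>x. (norm (mollify e n f x - f x))\<^sup>2 \<partial>lborel) \<longlonglongrightarrow> 0"
  proof (rule LIMSEQ_I)
    fix \<epsilon> :: real assume \<epsilon>: "0 < \<epsilon>"
    \<comment> \<open>Splitting the square of a sum of three terms costs the factors 4, 4 and 2, so
      three errors below \<epsilon>/16 add up to less than \<epsilon>.\<close>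
    obtain g r where g: "continuous_on UNIV g" "\<And>x. r < norm x \<Longrightarrow> g x = 0"
      "square_integrable lborel g" and fg: "(\<integral>x. (norm (f x - g x))\<^sup>2 \<partial>lborel) < \<epsilon> / 16"
      using L2_dense_continuous[OF f, of "\<epsilon> / 16"] \<epsilon> by auto
    have "(\<lambda>n. \<integral>x. (norm (mollify e n g x - g x))\<^sup>2 \<partial>lborel) \<longlonglongrightarrow> 0"
      by (rule mollify_tendsto_continuous[OF e g])
    from LIMSEQ_D[OF this, of "\<epsilon> / 16"] \<epsilon>
    obtain N where N: "\<And>n. N \<le> n \<Longrightarrow> (\<integral>x. (norm (mollify e n g x - g x))\<^sup>2 \<partial>lborel) < \<epsilon> / 16"
      by auto
    have "(\<integral>x. (norm (mollify e n f x - f x))\<^sup>2 \<partial>lborel) < \<epsilon>" if n: "N \<le> n" for n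
    proof -
      have fmg: "square_integrable lborel (\<lambda>x. f x - g x)" by (intro square_integrable_diff f g)
      note m = mollify_contraction[where e=e and n=n]
      have "(\<integral>x. (norm (mollify e n f x - f x))\<^sup>2 \<partial>lborel)
        \<le> (\<integral>x. 2 * (2 * (norm (mollify e n (\<lambda>x. f x - g x) x))\<^sup>2 + 2 * (norm (mollify e n g x - g x))\<^sup>2)
            + 2 * (norm (f x - g x))\<^sup>2 \<partial>lborel)"
      proof (rule integral_mono)
        fix x
        let ?a = "mollify e n (\<lambda>x. f x - g x) x" and ?b = "mollify e n g x - g x" and ?c = "f x - g x"
        have "mollify e n f x - f x = ?a + ?b - ?c"
          by (simp add: mollify_diff[OF f g(3)])
        then have "(norm (mollify e n f x - f x))\<^sup>2 \<le> 2 * (norm (?a + ?b))\<^sup>2 + 2 * (norm ?c)\<^sup>2"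
          by (metis norm_diff_squared_le)
        also have "\<dots> \<le> 2 * (2 * (norm ?a)\<^sup>2 + 2 * (norm ?b)\<^sup>2) + 2 * (norm ?c)\<^sup>2"
          by (intro add_mono mult_left_mono norm_add_squared_le) auto
        finally show "(norm (mollify e n f x - f x))\<^sup>2 \<le> \<dots>" .
      qed (intro Bochner_Integration.integrable_add integrable_mult_right square_integrable_integrable
            square_integrable_diff m(1) f g(3))+
      also have "\<dots> = 4 * (\<integral>x. (norm (mollify e n (\<lambda>x. f x - g x) x))\<^sup>2 \<partial>lborel)
          + 4 * (\<integral>x. (norm (mollify e n g x - g x))\<^sup>2 \<partial>lborel) + 2 * (\<integral>x. (norm (f x - g x))\<^sup>2 \<partial>lborel)"
        using square_integrable_integrable[OF m(1)[OF fmg]] square_integrable_integrable[OF fmg]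
          square_integrable_integrable[OF square_integrable_diff[OF m(1)[OF g(3)] g(3)]]
        by simp
      also have "\<dots> < \<epsilon>" using m(2)[OF fmg] fg N[OF n] \<epsilon> by linarith
      finally show ?thesis .
    qed
    then show "\<exists>N. \<forall>n\<ge>N. norm ((\<integral>x. (norm (mollify e n f x - f x))\<^sup>2 \<partial>lborel) - 0) < \<epsilon>"
      by auto
  qed
  then show ?thesis using f mollify_contraction(1)[OF f] by (simp add: L2_tendsto_def)
qed

section \<open>Smooth approximation up to the boundary\<close>

lemma grad_eqI: "(\<phi> has_derivative (\<lambda>h. h \<bullet> D)) (at x) \<Longrightarrow> grad \<phi> x = D"
  unfolding grad_def
proof (rule the_equality)
  assume D: "(\<phi> has_derivative (\<lambda>h. h \<bullet> D)) (at x)"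
  then show "GDERIV \<phi> x :> D" by (simp add: gderiv_def)
  fix E assume "GDERIV \<phi> x :> E"
  then have "(\<phi> has_derivative (\<lambda>h. h \<bullet> E)) (at x)" by (simp add: gderiv_def)
  from has_derivative_unique[OF D this] have "h \<bullet> D = h \<bullet> E" for h by metis
  then show "E = D" by (metis vector_eq_rdot inner_commute)
qed

lemma cball_sets_borel [measurable]: "cball (c::'a::real_normed_vector) r \<in> sets borel"
  by (simp add: borel_closed)

lemma open_halfspace [simp, intro]: "open halfspace"
  unfolding halfspace_def using open_halfspace_component_gt_cart[of 0 3] by simp

lemma closure_halfspace_eq: "closure halfspace = {x. 0 \<le> x $ 3}"
  unfolding halfspace_def using closure_halfspace_component_gt[of 3 0] by simp

lemma halfspace_sets [measurable]: "halfspace \<in> sets borel"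
  by (simp add: borel_open)

lemma halfspace_subset_closure: "x \<in> halfspace \<Longrightarrow> x \<in> closure halfspace"
  using closure_subset by blast

section \<open>Differentiability of the kernels\<close>

definition mollifier_grad :: "'a::euclidean_space \<Rightarrow> nat \<Rightarrow> 'a \<Rightarrow> 'a"
  where "mollifier_grad e n y = (real (Suc n) ^ DIM('a) / (\<integral>x. bump (x::'a) \<partial>lborel) * real (Suc n))
    *\<^sub>R bump_grad (real (Suc n) *\<^sub>R y - 2 *\<^sub>R e)"

lemma borel_measurable_mollifier_grad [measurable]: "mollifier_grad e n \<in> borel_measurable borel"
  unfolding mollifier_grad_def by measurable

lemma continuous_mollifier_grad: "continuous_on S (mollifier_grad e n)"
  unfolding mollifier_grad_def
  by (intro continuous_intros continuous_on_compose2[OF continuous_bump_grad[of UNIV]]) auto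

lemma mollifier_taylor:
  fixes e :: "'a::euclidean_space"
  obtains L where "0 \<le> L"
    "\<And>y z. \<bar>mollifier e n z - mollifier e n y - (z - y) \<bullet> mollifier_grad e n y\<bar> \<le> L * (norm (z - y))\<^sup>2"
    "\<And>y z. \<bar>mollifier e n z - mollifier e n y\<bar> \<le> L * norm (z - y)"
    "\<And>y. norm (mollifier_grad e n y) \<le> L"
proof -
  define N c where "N = real (Suc n)" and "c = N ^ DIM('a) / (\<integral>x. bump (x::'a) \<partial>lborel)"
  have N: "1 \<le> N" by (simp add: N_def)
  have c: "0 \<le> c" using integral_bump_pos[where 'a='a] by (simp add: c_def N_def)
  have m: "mollifier e n y = c * bump (N *\<^sub>R y - 2 *\<^sub>R e)" for y
    by (simp add: mollifier_def c_def N_def)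
  have mg: "mollifier_grad e n y = (c * N) *\<^sub>R bump_grad (N *\<^sub>R y - 2 *\<^sub>R e)" for y
    by (simp add: mollifier_grad_def c_def N_def)
  have NN: "N \<le> N\<^sup>2" using N by (simp add: power2_eq_square)
  show ?thesis
  \<comment> \<open>One constant for all three bounds: the Taylor remainder of the bump at arguments
    scaled by \<open>N\<close> gives 27 N^2, and since \<open>1 \<le> N\<close> this dominates 4 N,
    which bounds both the Lipschitz constant and the gradient.\<close>
  proof (rule that[of "c * 27 * N\<^sup>2"])
    show "0 \<le> c * 27 * N\<^sup>2" using c by simp
    fix y z :: 'a
    have d: "(N *\<^sub>R z - 2 *\<^sub>R e) - (N *\<^sub>R y - 2 *\<^sub>R e) = N *\<^sub>R (z - y)" by (simp add: algebra_simps)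
    have "mollifier e n z - mollifier e n y - (z - y) \<bullet> mollifier_grad e n y
      = c * (bump (N *\<^sub>R z - 2 *\<^sub>R e) - bump (N *\<^sub>R y - 2 *\<^sub>R e)
          - ((N *\<^sub>R z - 2 *\<^sub>R e) - (N *\<^sub>R y - 2 *\<^sub>R e)) \<bullet> bump_grad (N *\<^sub>R y - 2 *\<^sub>R e))"
      unfolding d m mg by (simp add: algebra_simps)
    also have "\<bar>\<dots>\<bar> \<le> c * (27 * (norm ((N *\<^sub>R z - 2 *\<^sub>R e) - (N *\<^sub>R y - 2 *\<^sub>R e)))\<^sup>2)"
      unfolding abs_mult abs_of_nonneg[OF c] by (intro mult_left_mono bump_taylor_global c)
    finally show "\<bar>mollifier e n z - mollifier e n y - (z - y) \<bullet> mollifier_grad e n y\<bar>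
        \<le> c * 27 * N\<^sup>2 * (norm (z - y))\<^sup>2"
      unfolding d by (simp add: power_mult_distrib)
    have "\<bar>mollifier e n z - mollifier e n y\<bar> = c * \<bar>bump (N *\<^sub>R z - 2 *\<^sub>R e) - bump (N *\<^sub>R y - 2 *\<^sub>R e)\<bar>"
      using c by (simp add: m abs_mult flip: right_diff_distrib)
    also have "\<dots> \<le> c * (4 * norm ((N *\<^sub>R z - 2 *\<^sub>R e) - (N *\<^sub>R y - 2 *\<^sub>R e)))"
      by (intro mult_left_mono bump_Lipschitz c)
    also have "\<dots> = c * 4 * N * norm (z - y)" unfolding d using N by simp
    also have "\<dots> \<le> c * 27 * N\<^sup>2 * norm (z - y)"
      using c NN N by (intro mult_right_mono mult_mono) auto
    finally show "\<bar>mollifier e n z - mollifier e n y\<bar> \<le> c * 27 * N\<^sup>2 * norm (z - y)" .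
    have "norm (mollifier_grad e n y) = c * N * norm (bump_grad (N *\<^sub>R y - 2 *\<^sub>R e))"
      using c N by (simp add: mg abs_mult)
    also have "\<dots> \<le> c * N * 4" using c N by (intro mult_left_mono norm_bump_grad_le) auto
    also have "\<dots> = c * 4 * N" by simp
    also have "\<dots> \<le> c * 27 * N\<^sup>2" using c N NN by (intro mult_mono) auto
    finally show "norm (mollifier_grad e n y) \<le> c * 27 * N\<^sup>2" .
  qed
qed

lemma has_derivative_mollifier:
  "((\<lambda>y. mollifier e n (y - x)) has_derivative (\<lambda>h. h \<bullet> mollifier_grad e n (y - x))) (at y within S)"
proof -
  obtain L where L: "0 \<le> L"
    "\<And>y z. \<bar>mollifier e n z - mollifier e n y - (z - y) \<bullet> mollifier_grad e n y\<bar> \<le> L * (norm (z - y))\<^sup>2"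
    using mollifier_taylor[of e n] by metis
  show ?thesis
  proof (rule has_derivative_quadraticI[OF bounded_linear_inner_left L(1)])
    show "norm (mollifier e n (z - x) - mollifier e n (y - x) - (z - y) \<bullet> mollifier_grad e n (y - x))
        \<le> L * (norm (z - y))\<^sup>2" for z
      using L(2)[of "z - x" "y - x"] by simp
  qed
qed

lemma mollifier_grad_support:
  assumes "norm e = 1" "mollifier_grad e n y \<noteq> 0"
  shows "norm y < 3"
proof -
  let ?N = "real (Suc n)"
  have lt: "norm (?N *\<^sub>R y - 2 *\<^sub>R e) < 1"
    using assms(2) bump_grad_eq_0[of "?N *\<^sub>R y - 2 *\<^sub>R e"] by (fastforce simp: mollifier_grad_def)
  have "norm (?N *\<^sub>R y) < 3"
    using norm_triangle_sub[of "?N *\<^sub>R y" "2 *\<^sub>R e"] lt assms(1) by simp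
  moreover have "1 * norm y \<le> ?N * norm y" by (intro mult_right_mono) auto
  ultimately show ?thesis by (simp del: of_nat_Suc)
qed

text \<open>The purpose of the inward shift. Even for \<open>x\<close> on the boundary the kernel is
  supported in a ball of height at least 1/N above the boundary plane, so it is admissible in
  \<open>weak_gradient\<close>, which only tests in the open half-space.\<close>

lemma mollifier_C1c:
  assumes x: "x \<in> closure halfspace"
  shows "(\<lambda>y. mollifier (axis 3 1) n (y - x)) \<in> C1c halfspace"
proof -
  let ?e = "axis 3 1 :: real^3" and ?N = "real (Suc n)"
  define K where "K = cball (x + (2 / ?N) *\<^sub>R ?e) (1 / ?N)"
  have "K \<subseteq> halfspace"
  proof
    fix y assume "y \<in> K"
    then have "norm (y - (x + (2 / ?N) *\<^sub>R ?e)) \<le> 1 / ?N" by (simp add: K_def dist_norm norm_minus_commute)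
    then have "\<bar>(y - (x + (2 / ?N) *\<^sub>R ?e)) $ 3\<bar> \<le> 1 / ?N" by (rule order_trans[OF component_le_norm_cart])
    moreover have "(y - (x + (2 / ?N) *\<^sub>R ?e)) $ 3 = y $ 3 - x $ 3 - 2 / ?N" by (simp add: axis_def)
    moreover have "1 / ?N < 2 / ?N" by (simp add: field_simps)
    moreover have "0 \<le> x $ 3" using x by (simp add: closure_halfspace_eq)
    ultimately show "y \<in> halfspace" unfolding halfspace_def by (simp del: of_nat_Suc)
  qed
  moreover have "mollifier ?e n (y - x) = 0" if "y \<notin> K" for y
  proof -
    have "y - (x + (2 / ?N) *\<^sub>R ?e) = (1 / ?N) *\<^sub>R (?N *\<^sub>R (y - x) - 2 *\<^sub>R ?e)"
      by (simp add: scaleR_diff_right algebra_simps del: of_nat_Suc)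
    then have "norm (y - (x + (2 / ?N) *\<^sub>R ?e)) = norm (?N *\<^sub>R (y - x) - 2 *\<^sub>R ?e) / ?N" by simp
    moreover have "1 / ?N < norm (y - (x + (2 / ?N) *\<^sub>R ?e))"
      using that by (simp add: K_def dist_norm norm_minus_commute)
    ultimately have "1 \<le> norm (?N *\<^sub>R (y - x) - 2 *\<^sub>R ?e)" by (simp add: field_simps del: of_nat_Suc)
    then show ?thesis by (simp add: mollifier_def bump_eq_0 del: of_nat_Suc)
  qed
  moreover have "compact K" by (simp add: K_def)
  moreover have "continuous_on halfspace (\<lambda>y. mollifier_grad ?e n (y - x))"
    by (intro continuous_on_compose2[OF continuous_mollifier_grad[of UNIV]] continuous_intros) auto
  ultimately show ?thesis
    unfolding C1c_def using has_derivative_mollifier by blast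
qed

text \<open>
  Encodes a bounded \<open>H\<^sup>1\<close> function on the half-space by Borel representatives of \<open>f\<close> and of its
  gradient \<open>g\<close> that vanish outside, so that all integrals are over the whole space.
\<close>

definition C1_approx :: "real \<Rightarrow> (real^3 \<Rightarrow> real) \<Rightarrow> (real^3 \<Rightarrow> real^3) \<Rightarrow>
    (nat \<Rightarrow> real^3 \<Rightarrow> real) \<Rightarrow> (nat \<Rightarrow> real^3 \<Rightarrow> real^3) \<Rightarrow> bool"
  where "C1_approx C f g F G \<longleftrightarrow>
    f \<in> borel_measurable borel \<and> g \<in> borel_measurable borel \<and>
    (\<forall>x. \<bar>f x\<bar> \<le> C) \<and> (\<forall>x. x \<notin> halfspace \<longrightarrow> f x = 0 \<and> g x = 0) \<and>
    (\<forall>n x. x \<in> closure halfspace \<longrightarrow>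
      (F n has_derivative (\<lambda>h. h \<bullet> G n x)) (at x within closure halfspace) \<and> \<bar>F n x\<bar> \<le> C) \<and>
    (\<forall>n. continuous_on (closure halfspace) (G n)) \<and>
    (\<forall>R. L2_tendsto lborel (\<lambda>n x. indicator (halfspace \<inter> cball 0 R) x *\<^sub>R F n x)
            (\<lambda>x. indicator (halfspace \<inter> cball 0 R) x *\<^sub>R f x)) \<and>
    (\<forall>R. L2_tendsto lborel (\<lambda>n x. indicator (halfspace \<inter> cball 0 R) x *\<^sub>R G n x)
            (\<lambda>x. indicator (halfspace \<inter> cball 0 R) x *\<^sub>R g x))"

lemma mollify_L2_tendsto_local:
  fixes f :: "real^3 \<Rightarrow> 'b::euclidean_space"
  assumes e: "norm e = 1" and f: "\<And>R. square_integrable lborel (\<lambda>x. indicator (cball 0 R) x *\<^sub>R f x)"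
  shows "L2_tendsto lborel (\<lambda>n x. indicator (halfspace \<inter> cball 0 R) x *\<^sub>R mollify e n f x)
            (\<lambda>x. indicator (halfspace \<inter> cball 0 R) x *\<^sub>R f x)"
proof -
  \<comment> \<open>The radius is enlarged by the common reach 3 of the kernels, so the truncation
    is invisible to the means at points of \<open>cball 0 R\<close>.\<close>
  let ?f = "\<lambda>x. indicator (cball 0 (R + 3)) x *\<^sub>R f x"
  have "L2_tendsto lborel (\<lambda>n x. indicator (halfspace \<inter> cball 0 R) x *\<^sub>R mollify e n ?f x)
            (\<lambda>x. indicator (halfspace \<inter> cball 0 R) x *\<^sub>R ?f x)"
    by (rule L2_tendsto_bounded_scaleR[where K=1, OF mollify_tendsto[OF e f]]) (auto simp: indicator_def)
  moreover have mol: "indicator (halfspace \<inter> cball 0 R) x *\<^sub>R mollify e n ?f x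
      = indicator (halfspace \<inter> cball 0 R) x *\<^sub>R mollify e n f x" for n x
    using mollify_local[OF e, of x "R + 3" n f] by (cases "x \<in> cball 0 R") (auto simp: indicator_def)
  moreover have "indicator (halfspace \<inter> cball 0 R) x *\<^sub>R ?f x
      = indicator (halfspace \<inter> cball 0 R) x *\<^sub>R f x" for x
    by (auto simp: indicator_def)
  ultimately show ?thesis by (simp only:)
qed

text \<open>The means of \<open>f\<close> have the means of \<open>g\<close> as their classical
  gradient, up to the boundary. Moving \<open>x\<close> moves the kernel by minus its gradient in
  \<open>y\<close>, and the weak identity with the kernel as test function carries that derivative
  from the kernel over to \<open>f\<close>.\<close>

lemma C1_approx_mollify:
  fixes f :: "real^3 \<Rightarrow> real" and g :: "real^3 \<Rightarrow> real^3"
  assumes [measurable]: "f \<in> borel_measurable borel" "g \<in> borel_measurable borel"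
    and fC: "\<And>x. \<bar>f x\<bar> \<le> C" and zero: "\<And>x. x \<notin> halfspace \<Longrightarrow> f x = 0" "\<And>x. x \<notin> halfspace \<Longrightarrow> g x = 0"
    and gsq: "\<And>R. square_integrable lborel (\<lambda>x. indicator (cball 0 R) x *\<^sub>R g x)"
    and weak: "\<And>\<phi>. \<phi> \<in> C1c halfspace \<Longrightarrow>
      (\<integral>x. f x *\<^sub>R grad \<phi> x \<partial>lborel) = - (\<integral>x. \<phi> x *\<^sub>R g x \<partial>lborel)"
  shows "C1_approx C f g (\<lambda>n. mollify (axis 3 1) n f) (\<lambda>n. mollify (axis 3 1) n g)"
proof -
  let ?e = "axis 3 1 :: real^3"
  let ?F = "\<lambda>n. mollify ?e n f" and ?G = "\<lambda>n. mollify ?e n g"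
  have e: "norm ?e = 1" by simp
  have C: "0 \<le> C" using fC[of 0] by linarith
  have fsq: "square_integrable lborel (\<lambda>x. indicator (cball 0 R) x *\<^sub>R f x)" for R
  proof (rule square_integrable_bound[where h="\<lambda>x. indicator (cball 0 R) x * C\<^sup>2"])
    show "integrable lborel (\<lambda>x. indicator (cball (0::real^3) R) x * C\<^sup>2)"
      by (intro integrable_mult_left integrable_indicator_cball)
    show "(norm (indicator (cball 0 R) x *\<^sub>R f x))\<^sup>2 \<le> indicator (cball 0 R) x * C\<^sup>2" for x
      using power_mono[OF fC[of x], of 2] by (auto simp: indicator_def)
  qed (intro borel_measurable_scaleR borel_measurable_indicator; use assms(1) in simp)
  have ki: "integrable lborel (\<lambda>y. mollifier ?e n (y - x) *\<^sub>R f y)" for n x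
  proof (rule Bochner_Integration.integrable_bound[where f="\<lambda>y. mollifier ?e n (y - x) * C"])
    show "integrable lborel (\<lambda>y. mollifier ?e n (y - x) * C)"
      by (intro integrable_mult_left mollifier_integral)
    show "AE y in lborel. norm (mollifier ?e n (y - x) *\<^sub>R f y) \<le> norm (mollifier ?e n (y - x) * C)"
      using fC C by (auto simp: abs_mult intro!: AE_I2 mult_left_mono)
  qed simp
  have FC: "\<bar>?F n x\<bar> \<le> C" for n x
    using norm_mollify_le[OF e _ ki, of x n C] fC by simp
  have deriv: "(?F n has_derivative (\<lambda>h. h \<bullet> ?G n x)) (at x within closure halfspace)"
    if x: "x \<in> closure halfspace" for n x
  proof -
    obtain L where L: "0 \<le> L"
      "\<And>y z. \<bar>mollifier ?e n z - mollifier ?e n y - (z - y) \<bullet> mollifier_grad ?e n y\<bar> \<le> L * (norm (z - y))\<^sup>2"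
      "\<And>y. norm (mollifier_grad ?e n y) \<le> L"
      using mollifier_taylor[of ?e n] by metis
    have gi: "integrable lborel (\<lambda>y. f y *\<^sub>R mollifier_grad ?e n (y - x))"
    proof (rule Bochner_Integration.integrable_bound[where f="\<lambda>y. indicator (cball x 3) y * (C * L)"])
      show "integrable lborel (\<lambda>y. indicator (cball x 3) y * (C * L))"
        by (intro integrable_mult_left integrable_indicator_cball)
      show "AE y in lborel. norm (f y *\<^sub>R mollifier_grad ?e n (y - x)) \<le> norm (indicator (cball x 3) y * (C * L))"
      proof (rule AE_I2)
        fix y
        show "norm (f y *\<^sub>R mollifier_grad ?e n (y - x)) \<le> norm (indicator (cball x 3) y * (C * L))"
        proof (cases "mollifier_grad ?e n (y - x) = 0")
          case False
          from mollifier_grad_support[OF e this] have "y \<in> cball x 3" by (simp add: dist_norm norm_minus_commute)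
          moreover have "\<bar>f y\<bar> * norm (mollifier_grad ?e n (y - x)) \<le> C * L"
            using fC L C by (intro mult_mono) auto
          ultimately show ?thesis using C L(1) by (simp add: abs_mult)
        qed simp
      qed
    qed simp
    \<comment> \<open>The weak gradient identity is applied with the kernel centred for
      \<open>x\<close> as the test function; the two minus signs, from the weak derivative and from
      differentiating in \<open>x\<close>, will cancel.\<close>
    have "(\<integral>y. f y *\<^sub>R grad (\<lambda>y. mollifier ?e n (y - x)) y \<partial>lborel) = - ?G n x"
      using weak[OF mollifier_C1c[OF x]] by (simp add: mollify_def)
    then have Gx: "(\<integral>y. f y *\<^sub>R mollifier_grad ?e n (y - x) \<partial>lborel) = - ?G n x"
      by (simp add: grad_eqI[OF has_derivative_mollifier])
    \<comment> \<open>The remainder is nonzero only where a kernel for \<open>x\<close> or for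
      \<open>z\<close> is, that is within 3 of one of them, hence within 4 of \<open>x\<close>
      because \<open>norm (z - x) \<le> 1\<close>.\<close>
    define V where "V = (\<integral>y. indicator (cball x 4) y * C \<partial>(lborel :: (real^3) measure))"
    have V: "0 \<le> V" unfolding V_def using C by (intro integral_nonneg_AE) auto
    show ?thesis
    proof (rule has_derivative_quadraticI[where L="L * V"])
      show "bounded_linear (\<lambda>h. h \<bullet> ?G n x)" by (rule bounded_linear_inner_left)
      show "0 \<le> L * V" using L V by simp
      fix z assume z: "norm (z - x) \<le> 1"
      let ?r = "\<lambda>y. (mollifier ?e n (y - z) - mollifier ?e n (y - x) - (x - z) \<bullet> mollifier_grad ?e n (y - x)) * f y"
      have inn: "integrable lborel (\<lambda>y. (x - z) \<bullet> (f y *\<^sub>R mollifier_grad ?e n (y - x)))"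
        using gi by (rule integrable_inner_right)
      have kir: "integrable lborel (\<lambda>y. mollifier ?e n (y - w) * f y)" for w
        using ki[of n w] by simp
      have "(\<integral>y. ?r y \<partial>lborel) = (\<integral>y. mollifier ?e n (y - z) * f y - mollifier ?e n (y - x) * f y
          - (x - z) \<bullet> (f y *\<^sub>R mollifier_grad ?e n (y - x)) \<partial>lborel)"
        by (rule Bochner_Integration.integral_cong) (auto simp: algebra_simps)
      also have "\<dots> = ?F n z - ?F n x - (x - z) \<bullet> (- ?G n x)"
      proof -
        have "(\<integral>y. mollifier ?e n (y - w) * f y \<partial>lborel) = ?F n w" for w
          by (simp add: mollify_def)
        moreover have "(\<integral>y. (x - z) \<bullet> (f y *\<^sub>R mollifier_grad ?e n (y - x)) \<partial>lborel) = (x - z) \<bullet> (- ?G n x)"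
          unfolding Gx[symmetric] using gi by (intro integral_inner_right) auto
        ultimately show ?thesis
          using inn kir by (simp del: inner_scaleR_right inner_minus_right)
      qed
      also have "\<dots> = ?F n z - ?F n x - (z - x) \<bullet> ?G n x" by (simp add: inner_diff_left)
      finally have r: "?F n z - ?F n x - (z - x) \<bullet> ?G n x = (\<integral>y. ?r y \<partial>lborel)" ..
      have ri: "integrable lborel ?r"
      proof -
        have "integrable lborel (\<lambda>y. mollifier ?e n (y - z) * f y - mollifier ?e n (y - x) * f y
          - (x - z) \<bullet> (f y *\<^sub>R mollifier_grad ?e n (y - x)))"
          by (intro Bochner_Integration.integrable_diff inn kir)
        then show ?thesis by (rule back_subst[where P="integrable lborel"]) (auto simp: algebra_simps)
      qed
      have "norm (\<integral>y. ?r y \<partial>lborel) \<le> (\<integral>y. (L * (norm (z - x))\<^sup>2) * (indicator (cball x 4) y * C) \<partial>lborel)"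
      proof (rule order_trans[OF integral_norm_bound], rule integral_mono)
        show "integrable lborel (\<lambda>y. norm (?r y))" using ri by (rule integrable_norm)
        show "integrable lborel (\<lambda>y. (L * (norm (z - x))\<^sup>2) * (indicator (cball x 4) y * C))"
          by (intro integrable_mult_right integrable_mult_left integrable_indicator_cball)
        fix y
        show "norm (?r y) \<le> (L * (norm (z - x))\<^sup>2) * (indicator (cball x 4) y * C)"
        proof (cases "y \<in> cball x 4")
          case True
          have "\<bar>mollifier ?e n (y - z) - mollifier ?e n (y - x) - (x - z) \<bullet> mollifier_grad ?e n (y - x)\<bar> * \<bar>f y\<bar>
              \<le> (L * (norm (z - x))\<^sup>2) * C"
            using L(2)[of "y - z" "y - x"] fC[of y] L(1) by (intro mult_mono) (auto simp: norm_minus_commute)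
          then show ?thesis using True by (simp add: abs_mult)
        next
          case False
          then have far: "4 < norm (y - x)" by (simp add: dist_norm norm_minus_commute)
          then have "3 < norm (y - z)" using z norm_triangle_ineq[of "y - z" "z - x"] by simp
          then have "mollifier ?e n (y - z) = 0" "mollifier ?e n (y - x) = 0" "mollifier_grad ?e n (y - x) = 0"
            using far mollifier_support(2)[OF e] mollifier_grad_support[OF e] by fastforce+
          then show ?thesis using False by simp
        qed
      qed
      also have "\<dots> = L * V * (norm (z - x))\<^sup>2" by (simp add: V_def)
      finally show "norm (?F n z - ?F n x - (z - x) \<bullet> ?G n x) \<le> L * V * (norm (z - x))\<^sup>2"
        unfolding r .
    qed
  qed
  \<comment> \<open>Here \<open>g\<close> is merely locally square integrable, so continuity is
    obtained from the Lipschitz bound of the kernel against the local L1 norm of \<open>g\<close>.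
    The radius \<open>norm x + 4\<close> covers the reach of the kernels for all \<open>z\<close>
    within 1 of \<open>x\<close>.\<close>
  have cont: "continuous_on S (?G n)" for n S
  proof (rule continuous_at_imp_continuous_on, rule ballI)
    fix x :: "real^3"
    obtain L where L: "0 \<le> L" "\<And>y z. \<bar>mollifier ?e n z - mollifier ?e n y\<bar> \<le> L * norm (z - y)"
      using mollifier_taylor[of ?e n] by metis
    define R where "R = norm x + 4"
    let ?g = "\<lambda>y. indicator (cball 0 R) y *\<^sub>R g y"
    have Gi: "integrable lborel (\<lambda>y. norm (?g y))"
    proof (rule Bochner_Integration.integrable_bound)
      show "integrable lborel (\<lambda>y. indicator (cball 0 R) y + (norm (?g y))\<^sup>2)"
        by (intro Bochner_Integration.integrable_add integrable_indicator_cball square_integrable_integrable gsq)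
      show "AE y in lborel. norm (norm (?g y)) \<le> norm (indicator (cball 0 R) y + (norm (?g y))\<^sup>2)"
      proof (rule AE_I2)
        fix y
        have "norm (g y) \<le> 1 + (norm (g y))\<^sup>2"
          using sum_squares_bound[of "norm (g y)" 1] zero_le_power2[of "norm (g y)"] norm_ge_zero[of "g y"] by (simp; linarith)
        then show "norm (norm (?g y)) \<le> norm (indicator (cball 0 R) y + (norm (?g y))\<^sup>2)"
          by (auto simp: indicator_def)
      qed
    qed simp
    define V where "V = (\<integral>y. norm (?g y) \<partial>lborel)"
    have bd: "norm (?G n z - ?G n x) \<le> L * V * norm (z - x)" if z: "dist z x < 1" for z
    proof -
      have zx: "norm (z - x) < 1" using z by (simp add: dist_norm)
      have "norm z \<le> norm x + 1" using zx norm_triangle_sub[of z x] by simp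
      then have eq: "?G n z = mollify ?e n ?g z" "?G n x = mollify ?e n ?g x"
        by (auto intro!: mollify_local[OF e] simp: R_def)
      have "?G n z - ?G n x = (\<integral>y. (mollifier ?e n (y - z) - mollifier ?e n (y - x)) *\<^sub>R ?g y \<partial>lborel)"
        unfolding eq unfolding mollify_def scaleR_diff_left
        by (rule Bochner_Integration.integral_diff[symmetric]; rule mollifier_scaleR_integrable(2)[OF gsq])
      also have "norm \<dots> \<le> (\<integral>y. (L * norm (z - x)) * norm (?g y) \<partial>lborel)"
      proof (rule order_trans[OF integral_norm_bound], rule integral_mono)
        show "integrable lborel (\<lambda>y. norm ((mollifier ?e n (y - z) - mollifier ?e n (y - x)) *\<^sub>R ?g y))"
          unfolding scaleR_diff_left
          by (intro integrable_norm Bochner_Integration.integrable_diff mollifier_scaleR_integrable(2)[OF gsq])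
        show "integrable lborel (\<lambda>y. (L * norm (z - x)) * norm (?g y))"
          by (intro integrable_mult_right Gi)
        show "norm ((mollifier ?e n (y - z) - mollifier ?e n (y - x)) *\<^sub>R ?g y) \<le> (L * norm (z - x)) * norm (?g y)" for y
          using L(2)[of "y - z" "y - x"] unfolding norm_scaleR
          by (intro mult_right_mono) (auto simp: norm_minus_commute)
      qed
      also have "\<dots> = L * V * norm (z - x)" by (simp add: V_def)
      finally show ?thesis .
    qed
    have "((\<lambda>z. ?G n z - ?G n x) \<longlongrightarrow> 0) (at x)"
    proof (rule Lim_null_comparison)
      show "\<forall>\<^sub>F z in at x. norm (?G n z - ?G n x) \<le> L * V * norm (z - x)"
        unfolding eventually_at using bd by (intro exI[of _ 1]) auto
      show "((\<lambda>z. L * V * norm (z - x)) \<longlongrightarrow> 0) (at x)"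
        by (auto intro!: tendsto_eq_intros)
    qed
    then show "isCont (?G n) x" unfolding isCont_def by (simp add: LIM_zero_iff)
  qed
  show ?thesis
    unfolding C1_approx_def
    using fC zero FC deriv cont mollify_L2_tendsto_local[OF e fsq] mollify_L2_tendsto_local[OF e gsq]
    by simp
qed

section \<open>Cutoff functions\<close>

text \<open>The gradient is carried along as an argument, so that products and squares of cutoffs
  come with explicit gradients on which size bounds can be read off.\<close>

definition cutoff :: "real \<Rightarrow> (real^3 \<Rightarrow> real) \<Rightarrow> (real^3 \<Rightarrow> real^3) \<Rightarrow> bool"
  where "cutoff R \<eta> \<eta>' \<longleftrightarrow> (\<forall>x. (\<eta> has_derivative (\<lambda>h. h \<bullet> \<eta>' x)) (at x)) \<and>
    continuous_on UNIV \<eta>' \<and> (\<forall>x. R \<le> norm x \<longrightarrow> \<eta> x = 0 \<and> \<eta>' x = 0)"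

lemma cutoff_continuous:
  assumes "cutoff R \<eta> \<eta>'"
  shows "continuous_on UNIV \<eta>" "continuous_on UNIV \<eta>'"
  using assms unfolding cutoff_def
  by (auto intro!: continuous_at_imp_continuous_on has_derivative_continuous)

lemma cutoff_measurable:
  assumes "cutoff R \<eta> \<eta>'"
  shows "\<eta> \<in> borel_measurable borel" "\<eta>' \<in> borel_measurable borel"
  using cutoff_continuous[OF assms] by (auto intro: borel_measurable_continuous_onI)

lemma cutoff_bounded:
  assumes c: "cutoff R \<eta> \<eta>'"
  obtains K where "0 < K" "\<And>x. \<bar>\<eta> x\<bar> \<le> K" "\<And>x. norm (\<eta>' x) \<le> K"
proof -
  have "bounded (\<eta> ` cball 0 R)" "bounded (\<eta>' ` cball 0 R)"
    using cutoff_continuous[OF c]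
    by (auto intro!: compact_imp_bounded compact_continuous_image intro: continuous_on_subset)
  then obtain A B where A: "0 < A" "\<And>x. x \<in> cball 0 R \<Longrightarrow> norm (\<eta> x) \<le> A"
    and B: "0 < B" "\<And>x. x \<in> cball 0 R \<Longrightarrow> norm (\<eta>' x) \<le> B"
    unfolding bounded_pos by auto
  show ?thesis
  proof (rule that[of "A + B"])
    show "\<bar>\<eta> x\<bar> \<le> A + B" for x
      using A(1) B(1) A(2)[of x] c unfolding cutoff_def by (cases "R \<le> norm x") auto
    show "norm (\<eta>' x) \<le> A + B" for x
      using A(1) B(1) B(2)[of x] c unfolding cutoff_def by (cases "R \<le> norm x") auto
  qed (use A B in auto)
qed

lemma cutoff_mult:
  assumes c: "cutoff R \<eta> \<eta>'" and d: "\<And>x. (\<theta> has_derivative (\<lambda>h. h \<bullet> \<theta>' x)) (at x)" "continuous_on UNIV \<theta>'"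
  shows "cutoff R (\<lambda>x. \<eta> x * \<theta> x) (\<lambda>x. \<theta> x *\<^sub>R \<eta>' x + \<eta> x *\<^sub>R \<theta>' x)"
  unfolding cutoff_def
proof (intro conjI allI impI)
  fix x
  have "((\<lambda>x. \<eta> x * \<theta> x) has_derivative (\<lambda>h. \<eta> x * (h \<bullet> \<theta>' x) + (h \<bullet> \<eta>' x) * \<theta> x)) (at x)"
    using c d unfolding cutoff_def by (intro has_derivative_mult) auto
  then show "((\<lambda>x. \<eta> x * \<theta> x) has_derivative (\<lambda>h. h \<bullet> (\<theta> x *\<^sub>R \<eta>' x + \<eta> x *\<^sub>R \<theta>' x))) (at x)"
    by (rule has_derivative_eq_rhs) (auto simp: inner_add_right algebra_simps)
next
  have "continuous_on UNIV \<theta>"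
    by (intro continuous_at_imp_continuous_on ballI has_derivative_continuous[OF d(1)])
  then show "continuous_on UNIV (\<lambda>x. \<theta> x *\<^sub>R \<eta>' x + \<eta> x *\<^sub>R \<theta>' x)"
    by (intro continuous_intros cutoff_continuous[OF c] d(2))
qed (use c in \<open>auto simp: cutoff_def\<close>)

lemma cutoff_square:
  assumes "cutoff R \<eta> \<eta>'"
  shows "cutoff R (\<lambda>x. (\<eta> x)\<^sup>2) (\<lambda>x. (2 * \<eta> x) *\<^sub>R \<eta>' x)"
  using cutoff_mult[OF assms, of \<eta> \<eta>'] assms
  by (simp add: cutoff_def power2_eq_square scaleR_add_left[symmetric])

lemma has_derivative_bump_scaled:
  "((\<lambda>x. bump (c *\<^sub>R x)) has_derivative (\<lambda>h. h \<bullet> (c *\<^sub>R bump_grad (c *\<^sub>R x)))) (at x)"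
proof -
  have "((\<lambda>x. bump (c *\<^sub>R x)) has_derivative (\<lambda>h. (c *\<^sub>R h) \<bullet> bump_grad (c *\<^sub>R x))) (at x)"
    by (rule has_derivative_compose[OF _ has_derivative_bump]) (auto intro!: derivative_eq_intros)
  then show ?thesis by simp
qed

lemma cutoff_bump:
  assumes R: "0 < R"
  shows "cutoff R (\<lambda>x. bump ((1 / R) *\<^sub>R x)) (\<lambda>x. (1 / R) *\<^sub>R bump_grad ((1 / R) *\<^sub>R x))"
  unfolding cutoff_def
proof (intro conjI allI impI has_derivative_bump_scaled)
  show "continuous_on UNIV (\<lambda>x. (1 / R) *\<^sub>R bump_grad ((1 / R) *\<^sub>R x))"
    by (intro continuous_intros continuous_on_compose2[OF continuous_bump_grad[of UNIV]]) auto
  fix x :: "real^3" assume "R \<le> norm x"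
  then have "1 \<le> norm ((1 / R) *\<^sub>R x)" using R by simp
  then show "bump ((1 / R) *\<^sub>R x) = 0" "(1 / R) *\<^sub>R bump_grad ((1 / R) *\<^sub>R x) = 0"
    by (simp_all only: bump_eq_0 bump_grad_eq_0 scaleR_zero_right)
qed

section \<open>Test functions obtained from cutoffs\<close>

lemma C1_approxD:
  assumes "C1_approx C f g F G"
  shows "f \<in> borel_measurable borel" "g \<in> borel_measurable borel" "\<bar>f x\<bar> \<le> C"
    "x \<notin> halfspace \<Longrightarrow> f x = 0" "x \<notin> halfspace \<Longrightarrow> g x = 0"
    "x \<in> closure halfspace \<Longrightarrow> (F n has_derivative (\<lambda>h. h \<bullet> G n x)) (at x within closure halfspace)"
    "x \<in> closure halfspace \<Longrightarrow> \<bar>F n x\<bar> \<le> C"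
    "continuous_on (closure halfspace) (G n)"
    "L2_tendsto lborel (\<lambda>n x. indicator (halfspace \<inter> cball 0 R) x *\<^sub>R F n x)
            (\<lambda>x. indicator (halfspace \<inter> cball 0 R) x *\<^sub>R f x)"
    "L2_tendsto lborel (\<lambda>n x. indicator (halfspace \<inter> cball 0 R) x *\<^sub>R G n x)
            (\<lambda>x. indicator (halfspace \<inter> cball 0 R) x *\<^sub>R g x)"
  using assms unfolding C1_approx_def by auto

lemma C1_approx_square_integrable:
  assumes "C1_approx C f g F G"
  shows "square_integrable lborel (\<lambda>x. indicator (cball 0 R) x *\<^sub>R f x)"
    "square_integrable lborel (\<lambda>x. indicator (cball 0 R) x *\<^sub>R g x)"
proof -
  have "indicator (halfspace \<inter> cball 0 R) x *\<^sub>R f x = indicator (cball 0 R) x *\<^sub>R f x"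
    "indicator (halfspace \<inter> cball 0 R) x *\<^sub>R g x = indicator (cball 0 R) x *\<^sub>R g x" for x
    using C1_approxD(4,5)[OF assms, of x] by (auto simp: indicator_def)
  then show "square_integrable lborel (\<lambda>x. indicator (cball 0 R) x *\<^sub>R f x)"
    "square_integrable lborel (\<lambda>x. indicator (cball 0 R) x *\<^sub>R g x)"
    using C1_approxD(9,10)[OF assms, of R] by (simp_all only: L2_tendsto_def)
qed

text \<open>The indicator provides the extension by zero that \<open>C1c\<close> of the closed
  half-space prescribes. A jump across the boundary does no harm, since derivatives are taken within
  the closed half-space.\<close>

definition cutoff_approx :: "(real^3 \<Rightarrow> real) \<Rightarrow> (real^3 \<Rightarrow> real) \<Rightarrow> real^3 \<Rightarrow> real"
  where "cutoff_approx \<eta> F x = indicator (closure halfspace) x * (\<eta> x * F x)"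

lemma cutoff_approx_C1c:
  assumes c: "cutoff R \<eta> \<eta>'" and F: "C1_approx C f g F G"
  shows "cutoff_approx \<eta> (F n) \<in> C1c (closure halfspace)"
    and "x \<in> halfspace \<Longrightarrow> grad (cutoff_approx \<eta> (F n)) x = \<eta> x *\<^sub>R G n x + F n x *\<^sub>R \<eta>' x"
proof -
  let ?S = "closure halfspace" and ?\<phi> = "cutoff_approx \<eta> (F n)"
  let ?D = "\<lambda>x. \<eta> x *\<^sub>R G n x + F n x *\<^sub>R \<eta>' x"
  have d: "(?\<phi> has_derivative (\<lambda>h. h \<bullet> ?D x)) (at x within ?S)" if x: "x \<in> ?S" for x
  proof -
    have "((\<lambda>x. \<eta> x * F n x) has_derivative (\<lambda>h. \<eta> x * (h \<bullet> G n x) + (h \<bullet> \<eta>' x) * F n x)) (at x within ?S)"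
      using c C1_approxD(6)[OF F x] unfolding cutoff_def
      by (intro has_derivative_mult) (auto intro: has_derivative_at_withinI)
    then have "((\<lambda>x. \<eta> x * F n x) has_derivative (\<lambda>h. h \<bullet> ?D x)) (at x within ?S)"
      by (rule has_derivative_eq_rhs) (auto simp: inner_add_right algebra_simps)
    then show ?thesis
      by (rule has_derivative_transform[OF x, rotated]) (simp add: cutoff_approx_def)
  qed
  have Fc: "continuous_on ?S (F n)"
    unfolding continuous_on_eq_continuous_within
    using C1_approxD(6)[OF F] by (auto intro: has_derivative_continuous)
  have "continuous_on ?S ?D"
    by (intro continuous_intros Fc C1_approxD(8)[OF F] continuous_on_subset[OF cutoff_continuous(1)[OF c]]
        continuous_on_subset[OF cutoff_continuous(2)[OF c]]) auto
  moreover have "compact (?S \<inter> cball 0 R)" by (intro closed_Int_compact) auto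
  moreover have "?\<phi> x = 0" if "x \<notin> ?S \<inter> cball 0 R" for x
    using that c by (auto simp: cutoff_approx_def cutoff_def)
  ultimately show "?\<phi> \<in> C1c ?S"
    unfolding C1c_def using d by blast
  assume x: "x \<in> halfspace"
  have "(?\<phi> has_derivative (\<lambda>h. h \<bullet> ?D x)) (at x within halfspace)"
    using d[OF halfspace_subset_closure[OF x]] by (rule has_derivative_subset) (rule closure_subset)
  then have "(?\<phi> has_derivative (\<lambda>h. h \<bullet> ?D x)) (at x)"
    using x by (simp add: at_within_open[OF x])
  then show "grad ?\<phi> x = ?D x" by (rule grad_eqI)
qed

lemma cutoff_approx_L2:
  assumes c: "cutoff R \<eta> \<eta>'" and F: "C1_approx C f g F G"
  shows "L2_tendsto lborel (\<lambda>n x. indicator halfspace x *\<^sub>R cutoff_approx \<eta> (F n) x) (\<lambda>x. \<eta> x * f x)"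
    and "L2_tendsto lborel (\<lambda>n x. indicator halfspace x *\<^sub>R grad (cutoff_approx \<eta> (F n)) x)
      (\<lambda>x. \<eta> x *\<^sub>R g x + f x *\<^sub>R \<eta>' x)"
proof -
  obtain K where K: "0 < K" "\<And>x. \<bar>\<eta> x\<bar> \<le> K" "\<And>x. norm (\<eta>' x) \<le> K" using cutoff_bounded[OF c] by metis
  note m [measurable] = cutoff_measurable[OF c]
  have z: "\<eta> x = 0" "\<eta>' x = 0" if "x \<notin> cball 0 R" for x
    using c that by (auto simp: cutoff_def)
  have "L2_tendsto lborel (\<lambda>n x. \<eta> x *\<^sub>R indicator (halfspace \<inter> cball 0 R) x *\<^sub>R F n x)
      (\<lambda>x. \<eta> x *\<^sub>R indicator (halfspace \<inter> cball 0 R) x *\<^sub>R f x)"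
    by (rule L2_tendsto_bounded_scaleR[OF C1_approxD(9)[OF F]]) (use K in auto)
  moreover have "(\<lambda>n x. \<eta> x *\<^sub>R indicator (halfspace \<inter> cball 0 R) x *\<^sub>R F n x)
     = (\<lambda>n x. indicator halfspace x *\<^sub>R cutoff_approx \<eta> (F n) x)"
    using z halfspace_subset_closure by (auto simp: fun_eq_iff indicator_def cutoff_approx_def)
  moreover have "(\<lambda>x. \<eta> x *\<^sub>R indicator (halfspace \<inter> cball 0 R) x *\<^sub>R f x) = (\<lambda>x. \<eta> x * f x)"
    using z C1_approxD(4)[OF F] by (auto simp: fun_eq_iff indicator_def)
  ultimately show "L2_tendsto lborel (\<lambda>n x. indicator halfspace x *\<^sub>R cutoff_approx \<eta> (F n) x) (\<lambda>x. \<eta> x * f x)"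
    by (simp only:)
  have 1: "L2_tendsto lborel (\<lambda>n x. \<eta> x *\<^sub>R indicator (halfspace \<inter> cball 0 R) x *\<^sub>R G n x)
      (\<lambda>x. \<eta> x *\<^sub>R indicator (halfspace \<inter> cball 0 R) x *\<^sub>R g x)"
    by (rule L2_tendsto_bounded_scaleR[OF C1_approxD(10)[OF F]]) (use K in auto)
  have 2: "L2_tendsto lborel (\<lambda>n x. (indicator (halfspace \<inter> cball 0 R) x *\<^sub>R F n x) *\<^sub>R \<eta>' x)
      (\<lambda>x. (indicator (halfspace \<inter> cball 0 R) x *\<^sub>R f x) *\<^sub>R \<eta>' x)"
    by (rule L2_tendsto_scaleR_bounded[OF C1_approxD(9)[OF F], where K=K]) (use K in auto)
  have "(\<lambda>n x. \<eta> x *\<^sub>R indicator (halfspace \<inter> cball 0 R) x *\<^sub>R G n x +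
       (indicator (halfspace \<inter> cball 0 R) x *\<^sub>R F n x) *\<^sub>R \<eta>' x)
     = (\<lambda>n x. indicator halfspace x *\<^sub>R grad (cutoff_approx \<eta> (F n)) x)"
    using z cutoff_approx_C1c(2)[OF c F] by (auto simp: fun_eq_iff indicator_def)
  moreover have "(\<lambda>x. \<eta> x *\<^sub>R indicator (halfspace \<inter> cball 0 R) x *\<^sub>R g x +
       (indicator (halfspace \<inter> cball 0 R) x *\<^sub>R f x) *\<^sub>R \<eta>' x) = (\<lambda>x. \<eta> x *\<^sub>R g x + f x *\<^sub>R \<eta>' x)"
    using z C1_approxD(4,5)[OF F] by (auto simp: fun_eq_iff indicator_def)
  ultimately show "L2_tendsto lborel (\<lambda>n x. indicator halfspace x *\<^sub>R grad (cutoff_approx \<eta> (F n)) x)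
      (\<lambda>x. \<eta> x *\<^sub>R g x + f x *\<^sub>R \<eta>' x)"
    using L2_tendsto_add[OF 1 2] by (simp only:)
qed

text \<open>The product of a cutoff with an H^1 function is not itself C^1. It becomes admissible
  because the C^1 products \<open>cutoff_approx \<eta> (F n)\<close> and their gradients converge in
  L2, while the coefficients \<open>A\<close> and \<open>b\<close> are locally in L2.\<close>

lemma weak_form_cutoff:
  assumes c: "cutoff R \<eta> \<eta>'" and F: "C1_approx C f g F G"
    and A: "\<And>R. square_integrable lborel (\<lambda>x. indicator (cball 0 R) x *\<^sub>R A x)" "\<And>x. x \<notin> halfspace \<Longrightarrow> A x = 0"
    and b: "\<And>R. square_integrable lborel (\<lambda>x. indicator (cball 0 R) x *\<^sub>R b x)" "\<And>x. x \<notin> halfspace \<Longrightarrow> b x = 0"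
    and weak: "\<And>\<phi>. \<phi> \<in> C1c (closure halfspace) \<Longrightarrow>
      (\<integral>x. A x \<bullet> grad \<phi> x \<partial>lborel) = (\<integral>x. b x * \<phi> x \<partial>lborel)"
  shows "(\<integral>x. A x \<bullet> (\<eta> x *\<^sub>R g x + f x *\<^sub>R \<eta>' x) \<partial>lborel) = (\<integral>x. b x * (\<eta> x * f x) \<partial>lborel)"
proof -
  let ?\<phi> = "\<lambda>n. cutoff_approx \<eta> (F n)"
  have z: "\<eta> x = 0" "\<eta>' x = 0" if "x \<notin> cball 0 R" for x
    using c that by (auto simp: cutoff_def)
  \<comment> \<open>Inserting the indicator of \<open>cball 0 R\<close> makes the coefficient
    globally square integrable and changes nothing, as \<eta> and its gradient vanish outside that
    ball.\<close>
  have "(\<lambda>n. \<integral>x. (indicator (cball 0 R) x *\<^sub>R A x) \<bullet> (indicator halfspace x *\<^sub>R grad (?\<phi> n) x) \<partial>lborel)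
     \<longlonglongrightarrow> (\<integral>x. (indicator (cball 0 R) x *\<^sub>R A x) \<bullet> (\<eta> x *\<^sub>R g x + f x *\<^sub>R \<eta>' x) \<partial>lborel)"
    by (rule L2_tendsto_inner[OF L2_tendsto_const cutoff_approx_L2(2)[OF c F]]) (rule A)
  moreover have "(\<integral>x. (indicator (cball 0 R) x *\<^sub>R A x) \<bullet> (indicator halfspace x *\<^sub>R grad (?\<phi> n) x) \<partial>lborel)
      = (\<integral>x. A x \<bullet> grad (?\<phi> n) x \<partial>lborel)" for n
  proof (rule Bochner_Integration.integral_cong)
    fix x
    show "(indicator (cball 0 R) x *\<^sub>R A x) \<bullet> (indicator halfspace x *\<^sub>R grad (?\<phi> n) x) = A x \<bullet> grad (?\<phi> n) x"
    proof (cases "x \<in> halfspace")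
      case True
      then show ?thesis
        using z[of x] by (cases "x \<in> cball 0 R") (simp_all add: cutoff_approx_C1c(2)[OF c F])
    qed (simp add: A(2))
  qed simp
  moreover have "(\<integral>x. (indicator (cball 0 R) x *\<^sub>R A x) \<bullet> (\<eta> x *\<^sub>R g x + f x *\<^sub>R \<eta>' x) \<partial>lborel)
      = (\<integral>x. A x \<bullet> (\<eta> x *\<^sub>R g x + f x *\<^sub>R \<eta>' x) \<partial>lborel)"
    by (rule Bochner_Integration.integral_cong) (use z in \<open>auto simp: indicator_def\<close>)
  ultimately have 1: "(\<lambda>n. \<integral>x. A x \<bullet> grad (?\<phi> n) x \<partial>lborel)
      \<longlonglongrightarrow> (\<integral>x. A x \<bullet> (\<eta> x *\<^sub>R g x + f x *\<^sub>R \<eta>' x) \<partial>lborel)" by (simp only:)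
  have "(\<lambda>n. \<integral>x. (indicator (cball 0 R) x *\<^sub>R b x) \<bullet> (indicator halfspace x *\<^sub>R ?\<phi> n x) \<partial>lborel)
     \<longlonglongrightarrow> (\<integral>x. (indicator (cball 0 R) x *\<^sub>R b x) \<bullet> (\<eta> x * f x) \<partial>lborel)"
    by (rule L2_tendsto_inner[OF L2_tendsto_const cutoff_approx_L2(1)[OF c F]]) (rule b)
  moreover have "(\<integral>x. (indicator (cball 0 R) x *\<^sub>R b x) \<bullet> (indicator halfspace x *\<^sub>R ?\<phi> n x) \<partial>lborel)
      = (\<integral>x. b x * ?\<phi> n x \<partial>lborel)" for n
    by (rule Bochner_Integration.integral_cong) (use z b(2) in \<open>auto simp: indicator_def cutoff_approx_def\<close>)
  moreover have "(\<integral>x. (indicator (cball 0 R) x *\<^sub>R b x) \<bullet> (\<eta> x * f x) \<partial>lborel)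
      = (\<integral>x. b x * (\<eta> x * f x) \<partial>lborel)"
    by (rule Bochner_Integration.integral_cong) (use z in \<open>auto simp: indicator_def\<close>)
  ultimately have "(\<lambda>n. \<integral>x. b x * ?\<phi> n x \<partial>lborel) \<longlonglongrightarrow> (\<integral>x. b x * (\<eta> x * f x) \<partial>lborel)"
    by (simp only:)
  with 1 show ?thesis
    using weak[OF cutoff_approx_C1c(1)[OF c F]] by (simp add: LIMSEQ_unique)
qed

section \<open>Dilations\<close>

lemma square_integrable_dilation:
  fixes f :: "'a::euclidean_space \<Rightarrow> 'b::euclidean_space"
  assumes f: "square_integrable lborel f" and c: "c \<noteq> 0"
  shows "square_integrable lborel (\<lambda>x. f (c *\<^sub>R x))"
proof -
  have [measurable]: "f \<in> borel_measurable borel" using f by (simp add: square_integrable_def)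
  show ?thesis
    using lborel_integrable_affine[OF square_integrable_integrable[OF f] c, of 0]
    by (simp add: square_integrable_def)
qed

lemma L2_tendsto_dilation:
  fixes f :: "'a::euclidean_space \<Rightarrow> 'b::euclidean_space"
  assumes F: "L2_tendsto lborel F f" and c: "c \<noteq> 0"
  shows "L2_tendsto lborel (\<lambda>n x. F n (c *\<^sub>R x)) (\<lambda>x. f (c *\<^sub>R x))"
proof -
  note A = F[unfolded L2_tendsto_def]
  have [measurable]: "f \<in> borel_measurable borel" "F n \<in> borel_measurable borel" for n
    using A by (simp_all add: square_integrable_def)
  have "(\<integral>x. (norm (F n (c *\<^sub>R x) - f (c *\<^sub>R x)))\<^sup>2 \<partial>lborel)
      = (1 / \<bar>c\<bar> ^ DIM('a)) * (\<integral>x. (norm (F n x - f x))\<^sup>2 \<partial>lborel)" for n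
    using lborel_integral_affine[of "\<lambda>x. (norm (F n x - f x))\<^sup>2" c 0] c by simp
  moreover have "(\<lambda>n. (1 / \<bar>c\<bar> ^ DIM('a)) * (\<integral>x. (norm (F n x - f x))\<^sup>2 \<partial>lborel)) \<longlonglongrightarrow> 0"
    by (intro tendsto_mult_right_zero) (use A in auto)
  ultimately have "(\<lambda>n. \<integral>x. (norm (F n (c *\<^sub>R x) - f (c *\<^sub>R x)))\<^sup>2 \<partial>lborel) \<longlonglongrightarrow> 0"
    by (simp only:)
  then show ?thesis using A square_integrable_dilation[OF _ c] by (auto simp: L2_tendsto_def)
qed

lemma halfspace_scaleR: "0 < c \<Longrightarrow> c *\<^sub>R x \<in> halfspace \<longleftrightarrow> x \<in> halfspace"
  by (simp add: halfspace_def zero_less_mult_iff)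

lemma closure_halfspace_scaleR: "0 < c \<Longrightarrow> c *\<^sub>R x \<in> closure halfspace \<longleftrightarrow> x \<in> closure halfspace"
  by (simp add: closure_halfspace_eq zero_le_mult_iff)

text \<open>The half-space is a cone, so dilation maps it, its closure and the approximating
  sequences onto objects of the same kind. No condition on the boundary is disturbed.\<close>

lemma C1_approx_dilation:
  assumes F: "C1_approx C f g F G" and c: "0 < c"
  shows "C1_approx C (\<lambda>x. f (c *\<^sub>R x)) (\<lambda>x. c *\<^sub>R g (c *\<^sub>R x))
    (\<lambda>n x. F n (c *\<^sub>R x)) (\<lambda>n x. c *\<^sub>R G n (c *\<^sub>R x))"
proof -
  note D = C1_approxD[OF F]
  note [measurable] = D(1,2)
  have ind: "indicator (halfspace \<inter> cball 0 (c * R)) (c *\<^sub>R x) = (indicator (halfspace \<inter> cball 0 R) x :: real)"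
    for x R using c by (simp add: indicator_def halfspace_scaleR)
  have der: "((\<lambda>x. F n (c *\<^sub>R x)) has_derivative (\<lambda>h. h \<bullet> (c *\<^sub>R G n (c *\<^sub>R x)))) (at x within closure halfspace)"
    if x: "x \<in> closure halfspace" for n x
  proof -
    have "((\<lambda>x. c *\<^sub>R x) has_derivative (\<lambda>h. c *\<^sub>R h)) (at x within closure halfspace)"
      by (auto intro!: derivative_eq_intros)
    moreover have "(F n has_derivative (\<lambda>h. h \<bullet> G n (c *\<^sub>R x)))
        (at (c *\<^sub>R x) within ((\<lambda>x. c *\<^sub>R x) ` closure halfspace))"
      using D(6)[of "c *\<^sub>R x" n] x c by (auto simp: closure_halfspace_scaleR intro: has_derivative_subset)
    ultimately have "((\<lambda>x. F n (c *\<^sub>R x)) has_derivative (\<lambda>h. (c *\<^sub>R h) \<bullet> G n (c *\<^sub>R x))) (at x within closure halfspace)"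
      by (rule has_derivative_in_compose)
    then show ?thesis by simp
  qed
  have cont: "continuous_on (closure halfspace) (\<lambda>x. c *\<^sub>R G n (c *\<^sub>R x))" for n
    by (intro continuous_intros continuous_on_compose2[OF D(8)]) (use c in \<open>auto simp: closure_halfspace_scaleR\<close>)
  have 1: "L2_tendsto lborel (\<lambda>n x. indicator (halfspace \<inter> cball 0 R) x *\<^sub>R F n (c *\<^sub>R x))
      (\<lambda>x. indicator (halfspace \<inter> cball 0 R) x *\<^sub>R f (c *\<^sub>R x))" for R
    using L2_tendsto_dilation[OF D(9)[of "c * R"], of c] c by (simp add: ind)
  have 2: "L2_tendsto lborel (\<lambda>n x. c *\<^sub>R (indicator (halfspace \<inter> cball 0 R) x *\<^sub>R G n (c *\<^sub>R x)))
      (\<lambda>x. c *\<^sub>R (indicator (halfspace \<inter> cball 0 R) x *\<^sub>R g (c *\<^sub>R x)))" for R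
  proof (rule L2_tendsto_bounded_scaleR[where K=c])
    show "L2_tendsto lborel (\<lambda>n x. indicator (halfspace \<inter> cball 0 R) x *\<^sub>R G n (c *\<^sub>R x))
      (\<lambda>x. indicator (halfspace \<inter> cball 0 R) x *\<^sub>R g (c *\<^sub>R x))"
      using L2_tendsto_dilation[OF D(10)[of "c * R"], of c] c by (simp add: ind)
  qed (use c in simp_all)
  have 3: "L2_tendsto lborel (\<lambda>n x. indicator (halfspace \<inter> cball 0 R) x *\<^sub>R (c *\<^sub>R G n (c *\<^sub>R x)))
      (\<lambda>x. indicator (halfspace \<inter> cball 0 R) x *\<^sub>R (c *\<^sub>R g (c *\<^sub>R x)))" for R
    using 2[of R] by (simp add: mult.commute)
  show ?thesis
    unfolding C1_approx_def
    using D(3,4,5,7) der cont 1 3 c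
    by (simp add: halfspace_scaleR closure_halfspace_scaleR)
qed

text \<open>Along the segment from x to c x, which stays in the half-space, the increment of
  \<open>F n\<close> is the mean over \<open>s\<close> of (c-1) times x paired with the gradient at
  \<kappa>(s) x. Jensen, Tonelli and the substitution by \<kappa>(s) turn this into the L2 norm of
  the gradient, and \<open>n\<close> tends to infinity. With \<kappa> between 1/2 and 2, the
  Jacobian costs at most 2^3 = 8 and the ball at most doubles.\<close>

lemma C1_approx_dilation_estimate:
  assumes F: "C1_approx C f g F G" and c: "1/2 \<le> c" "c \<le> 2" and r: "0 \<le> r"
  shows "(\<integral>x. (indicator (cball 0 r) x * (f (c *\<^sub>R x) - f x))\<^sup>2 \<partial>lborel)
    \<le> 8 * r\<^sup>2 * (c - 1)\<^sup>2 * (\<integral>x. (norm (indicator (cball 0 (2 * r)) x *\<^sub>R g x))\<^sup>2 \<partial>lborel)"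
proof -
  note D = C1_approxD[OF F]
  let ?S = "closure halfspace"
  define J where "J n = (\<lambda>x. indicator (halfspace \<inter> cball 0 (2 * r)) x *\<^sub>R G n x)" for n
  let ?d = "\<lambda>n x. indicator (halfspace \<inter> cball 0 r) x *\<^sub>R (F n (c *\<^sub>R x) - F n x)"
  have c0: "0 < c" using c by simp
  have Jsq: "square_integrable lborel (J n)" for n
    using D(10)[of "2 * r"] by (simp add: L2_tendsto_def J_def)
  then have [measurable]: "J n \<in> borel_measurable borel" for n by (simp add: square_integrable_def)
  have Ld: "L2_tendsto lborel ?d (\<lambda>x. indicator (halfspace \<inter> cball 0 r) x *\<^sub>R (f (c *\<^sub>R x) - f x))"
    using L2_tendsto_add[OF C1_approxD(9)[OF C1_approx_dilation[OF F c0], of r]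
        L2_tendsto_bounded_scaleR[OF D(9)[of r], of "\<lambda>_. -1" 1]]
    by (simp add: algebra_simps)
  have bound: "(\<integral>x. (norm (?d n x))\<^sup>2 \<partial>lborel) \<le> 8 * r\<^sup>2 * (c - 1)\<^sup>2 * (\<integral>x. (norm (J n x))\<^sup>2 \<partial>lborel)" for n
  proof -
    define \<kappa> where "\<kappa> s = 1 + s * (c - 1)" for s
    have \<kappa>: "1/2 \<le> \<kappa> s" "\<kappa> s \<le> 2" if "s \<in> {0..1}" for s
    proof -
      have "\<bar>s * (c - 1)\<bar> \<le> 1 * \<bar>c - 1\<bar>" using that unfolding abs_mult by (intro mult_right_mono) auto
      moreover have "s * (1 - c) \<le> 1/2" if "c \<le> 1"
      proof -
        have "s * (1 - c) \<le> 1 * (1/2)" using that \<open>s \<in> {0..1}\<close> c by (intro mult_mono) auto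
        then show ?thesis by simp
      qed
      moreover have "0 \<le> s * (c - 1)" if "1 \<le> c" using that \<open>s \<in> {0..1}\<close> by simp
      ultimately show "1/2 \<le> \<kappa> s" "\<kappa> s \<le> 2"
        using c unfolding \<kappa>_def by (cases "c \<le> 1"; simp add: algebra_simps)+
    qed
    let ?k = "indicator {0..1} :: real \<Rightarrow> real"
    let ?q = "\<lambda>s x. ennreal (?k s * (norm (J n (\<kappa> s *\<^sub>R x)))\<^sup>2)"
    have [measurable]: "\<kappa> \<in> borel_measurable borel" unfolding \<kappa>_def by measurable
    have point: "ennreal ((norm (?d n x))\<^sup>2) \<le> ennreal (r\<^sup>2 * (c - 1)\<^sup>2) * (\<integral>\<^sup>+s. ?q s x \<partial>lborel)" for x
    proof (cases "x \<in> halfspace \<inter> cball 0 r")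
      case True
      then have xS: "x \<in> ?S" and xH: "x \<in> halfspace" and xr: "norm x \<le> r" by (auto intro: halfspace_subset_closure)
      let ?p = "\<lambda>s. (c - 1) * (x \<bullet> G n (\<kappa> s *\<^sub>R x))"
      have \<kappa>S: "\<kappa> s *\<^sub>R x \<in> ?S" if "s \<in> {0..1}" for s
        using \<kappa>[OF that] xS by (subst closure_halfspace_scaleR) auto
      have vd: "((\<lambda>s. F n (\<kappa> s *\<^sub>R x)) has_vector_derivative ?p s) (at s within {0..1})"
        if s: "0 \<le> s" "s \<le> 1" for s
      proof -
        have 1: "((\<lambda>s. \<kappa> s *\<^sub>R x) has_derivative (\<lambda>h. (h * (c - 1)) *\<^sub>R x)) (at s within {0..1})"
          unfolding \<kappa>_def by (auto intro!: derivative_eq_intros)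
        have 2: "(F n has_derivative (\<lambda>h. h \<bullet> G n (\<kappa> s *\<^sub>R x))) (at (\<kappa> s *\<^sub>R x) within ((\<lambda>s. \<kappa> s *\<^sub>R x) ` {0..1}))"
          using D(6)[OF \<kappa>S, of s n] s \<kappa>S by (auto intro: has_derivative_subset)
        have "((\<lambda>s. F n (\<kappa> s *\<^sub>R x)) has_derivative (\<lambda>h. ((h * (c - 1)) *\<^sub>R x) \<bullet> G n (\<kappa> s *\<^sub>R x))) (at s within {0..1})"
          by (rule has_derivative_in_compose[OF 1 2])
        then show ?thesis unfolding has_vector_derivative_def
          by (rule has_derivative_eq_rhs) (auto simp: algebra_simps)
      qed
      have pc: "continuous_on {0..1} ?p"
      proof (intro continuous_intros continuous_on_compose2[OF D(8)[of n]])
        show "continuous_on {0..1} \<kappa>" unfolding \<kappa>_def by (intro continuous_intros)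
        show "(\<lambda>s. \<kappa> s *\<^sub>R x) ` {0..1} \<subseteq> ?S" using \<kappa>S by auto
      qed
      have "F n (c *\<^sub>R x) - F n x = (\<integral>s. ?k s *\<^sub>R ?p s \<partial>lborel)"
        using integral_FTC_atLeastAtMost[OF _ vd pc] by (simp add: \<kappa>_def)
      then have "(norm (F n (c *\<^sub>R x) - F n x))\<^sup>2 = (norm (\<integral>s. ?k s *\<^sub>R ?p s \<partial>lborel))\<^sup>2" by simp
      also have "\<dots> \<le> (\<integral>s. ?k s * (norm (?p s))\<^sup>2 \<partial>lborel)"
      proof (rule norm_weighted_mean_squared_le)
        show "integrable lborel ?k" "(\<integral>s. ?k s \<partial>lborel) = 1" by simp_all
        show "integrable lborel (\<lambda>s. ?k s *\<^sub>R ?p s)"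
          using borel_integrable_atLeastAtMost'[OF pc] by (simp add: set_integrable_def)
        have "continuous_on {0..1} (\<lambda>s. (norm (?p s))\<^sup>2)" by (intro continuous_intros pc)
        from borel_integrable_atLeastAtMost'[OF this]
        show "integrable lborel (\<lambda>s. ?k s * (norm (?p s))\<^sup>2)" by (simp add: set_integrable_def)
      qed simp
      finally have "ennreal ((norm (F n (c *\<^sub>R x) - F n x))\<^sup>2) \<le> ennreal (\<integral>s. ?k s * (norm (?p s))\<^sup>2 \<partial>lborel)"
        by (rule ennreal_leI)
      also have "\<dots> = (\<integral>\<^sup>+s. ennreal (?k s * (norm (?p s))\<^sup>2) \<partial>lborel)"
      proof (rule nn_integral_eq_integral[symmetric])
        have "continuous_on {0..1} (\<lambda>s. (norm (?p s))\<^sup>2)" by (intro continuous_intros pc)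
        from borel_integrable_atLeastAtMost'[OF this]
        show "integrable lborel (\<lambda>s. ?k s * (norm (?p s))\<^sup>2)" by (simp add: set_integrable_def)
      qed simp
      also have "\<dots> \<le> (\<integral>\<^sup>+s. ennreal (r\<^sup>2 * (c - 1)\<^sup>2) * ?q s x \<partial>lborel)"
      proof (rule nn_integral_mono)
        fix s
        show "ennreal (?k s * (norm (?p s))\<^sup>2) \<le> ennreal (r\<^sup>2 * (c - 1)\<^sup>2) * ?q s x"
        proof (cases "s \<in> {0..1}")
          case True
          have "norm (\<kappa> s *\<^sub>R x) \<le> 2 * r"
            using \<kappa>[OF True] xr by (auto intro!: mult_mono)
          then have "\<kappa> s *\<^sub>R x \<in> halfspace \<inter> cball 0 (2 * r)"
            using \<kappa>[OF True] xH by (auto simp: halfspace_scaleR)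
          then have J: "J n (\<kappa> s *\<^sub>R x) = G n (\<kappa> s *\<^sub>R x)" by (simp add: J_def)
          have "\<bar>x \<bullet> G n (\<kappa> s *\<^sub>R x)\<bar> \<le> r * norm (G n (\<kappa> s *\<^sub>R x))"
            using Cauchy_Schwarz_ineq2[of x "G n (\<kappa> s *\<^sub>R x)"] mult_right_mono[OF xr norm_ge_zero]
            by (rule order_trans)
          then have "\<bar>?p s\<bar> \<le> \<bar>c - 1\<bar> * (r * norm (G n (\<kappa> s *\<^sub>R x)))"
            unfolding abs_mult by (intro mult_left_mono) auto
          then have "(norm (?p s))\<^sup>2 \<le> (\<bar>c - 1\<bar> * (r * norm (G n (\<kappa> s *\<^sub>R x))))\<^sup>2"
            by (intro power_mono) auto
          then have "(norm (?p s))\<^sup>2 \<le> r\<^sup>2 * (c - 1)\<^sup>2 * (norm (G n (\<kappa> s *\<^sub>R x)))\<^sup>2"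
            by (simp add: power_mult_distrib ac_simps)
          then show ?thesis using True by (simp add: J ennreal_mult''[symmetric] ennreal_leI)
        qed simp
      qed
      also have "\<dots> = ennreal (r\<^sup>2 * (c - 1)\<^sup>2) * (\<integral>\<^sup>+s. ?q s x \<partial>lborel)"
        by (rule nn_integral_cmult) simp
      finally show ?thesis using True by simp
    next
      case False
      then have "?d n x = 0" by simp
      then show ?thesis by (simp only: norm_zero) simp
    qed
    have "(\<integral>\<^sup>+x. ennreal ((norm (?d n x))\<^sup>2) \<partial>lborel)
        \<le> (\<integral>\<^sup>+x. ennreal (r\<^sup>2 * (c - 1)\<^sup>2) * (\<integral>\<^sup>+s. ?q s x \<partial>lborel) \<partial>lborel)"
      by (rule nn_integral_mono) (rule point)
    also have "\<dots> = ennreal (r\<^sup>2 * (c - 1)\<^sup>2) * (\<integral>\<^sup>+x. \<integral>\<^sup>+s. ?q s x \<partial>lborel \<partial>lborel)"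
      by (rule nn_integral_cmult) measurable
    also have "(\<integral>\<^sup>+x. \<integral>\<^sup>+s. ?q s x \<partial>lborel \<partial>lborel) = (\<integral>\<^sup>+s. \<integral>\<^sup>+x. ?q s x \<partial>lborel \<partial>lborel)"
      by (rule lborel_pair.Fubini') measurable
    also have "\<dots> \<le> (\<integral>\<^sup>+s. ennreal (8 * (\<integral>x. (norm (J n x))\<^sup>2 \<partial>lborel)) * indicator {0..1} s \<partial>(lborel :: real measure))"
    proof (rule nn_integral_mono)
      fix s
      show "(\<integral>\<^sup>+x. ?q s x \<partial>lborel) \<le> ennreal (8 * (\<integral>x. (norm (J n x))\<^sup>2 \<partial>lborel)) * indicator {0..1} s"
      proof (cases "s \<in> {0..1}")
        case True
        note k = \<kappa>[OF True]
        let ?I = "\<integral>\<^sup>+x. ennreal ((norm (J n (\<kappa> s *\<^sub>R x)))\<^sup>2) \<partial>lborel"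
        \<comment> \<open>The substitution produces the factor \<kappa>^3 on the other side; as
          \<kappa> is at least 1/2, dividing by it costs at most 8.\<close>
        have eq: "ennreal (\<integral>x. (norm (J n x))\<^sup>2 \<partial>lborel) = ennreal ((\<kappa> s) ^ 3) * ?I"
          using lborel_nn_integral_affine[of "\<lambda>x. ennreal ((norm (J n x))\<^sup>2)" "\<kappa> s" 0] k
            nn_integral_eq_integral[OF square_integrable_integrable[OF Jsq[of n]]]
          by simp
        have "(1/2) ^ 3 \<le> (\<kappa> s) ^ 3" using k by (intro power_mono) auto
        then have k8: "1 \<le> 8 * (\<kappa> s) ^ 3" by (simp add: power3_eq_cube)
        have "?I = 1 * ?I" by simp
        also have "\<dots> \<le> ennreal (8 * (\<kappa> s) ^ 3) * ?I"
          using k8 by (intro mult_right_mono) (auto simp flip: ennreal_1 intro: ennreal_leI)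
        also have "\<dots> = ennreal 8 * (ennreal ((\<kappa> s) ^ 3) * ?I)"
          using k by (simp add: ennreal_mult' mult.assoc)
        also have "\<dots> = ennreal (8 * (\<integral>x. (norm (J n x))\<^sup>2 \<partial>lborel))"
          unfolding eq[symmetric] by (simp add: ennreal_mult')
        finally show ?thesis using True by simp
      qed simp
    qed
    also have "\<dots> = ennreal (8 * (\<integral>x. (norm (J n x))\<^sup>2 \<partial>lborel))"
      by (subst nn_integral_cmult_indicator) auto
    finally have le: "(\<integral>\<^sup>+x. ennreal ((norm (?d n x))\<^sup>2) \<partial>lborel)
      \<le> ennreal (r\<^sup>2 * (c - 1)\<^sup>2) * ennreal (8 * (\<integral>x. (norm (J n x))\<^sup>2 \<partial>lborel))"
      by (simp add: mult_left_mono)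
    have "integrable lborel (\<lambda>x. (norm (?d n x))\<^sup>2)"
      by (rule square_integrable_integrable) (use Ld in \<open>simp add: L2_tendsto_def\<close>)
    from le[unfolded nn_integral_eq_integral[OF this zero_le_power2[THEN AE_I2]]]
    show ?thesis
      by (subst (asm) ennreal_mult[symmetric]) (auto simp: ennreal_le_iff mult.assoc mult.left_commute)
  qed
  have "(\<integral>x. (norm (indicator (halfspace \<inter> cball 0 r) x *\<^sub>R (f (c *\<^sub>R x) - f x)))\<^sup>2 \<partial>lborel)
      \<le> 8 * r\<^sup>2 * (c - 1)\<^sup>2 * (\<integral>x. (norm (indicator (halfspace \<inter> cball 0 (2 * r)) x *\<^sub>R g x))\<^sup>2 \<partial>lborel)"
    by (rule LIMSEQ_le[OF L2_tendsto_norm[OF Ld] tendsto_mult_left[OF L2_tendsto_norm[OF D(10)]]])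
      (use bound in \<open>auto simp: J_def\<close>)
  moreover have "indicator (halfspace \<inter> cball 0 r) x *\<^sub>R (f (c *\<^sub>R x) - f x)
      = indicator (cball 0 r) x * (f (c *\<^sub>R x) - f x)"
    "indicator (halfspace \<inter> cball 0 (2 * r)) x *\<^sub>R g x = indicator (cball 0 (2 * r)) x *\<^sub>R g x" for x
    using D(4)[of x] D(4)[of "c *\<^sub>R x"] D(5)[of x] c0 by (auto simp: indicator_def halfspace_scaleR)
  ultimately show ?thesis by (simp only: real_norm_def power2_abs)
qed

section \<open>Stability outside a ball\<close>

lemma grad_zero_local:
  assumes "open U" "x \<in> U" "\<And>y. y \<in> U \<Longrightarrow> \<phi> y = 0"
  shows "grad \<phi> x = 0"
proof (rule grad_eqI)
  show "(\<phi> has_derivative (\<lambda>h. h \<bullet> 0)) (at x)"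
    by (rule has_derivative_transform_within_open[where f="\<lambda>_. 0" and s=U]) (use assms in auto)
qed

text \<open>\<open>grad\<close> refers to derivatives in the whole space, \<open>C1c\<close> to
  derivatives within \<open>S\<close>. The two agree on an open \<open>U\<close> contained in
  \<open>S\<close>, in practice the open half-space, and this is the reason for \<open>U\<close>
  here and below.\<close>

lemma C1c_has_grad:
  assumes "\<phi> \<in> C1c S" "U \<subseteq> S" "open U" "x \<in> U"
  shows "(\<phi> has_derivative (\<lambda>h. h \<bullet> grad \<phi> x)) (at x)"
proof -
  from assms(1) obtain G where G: "\<And>x. x \<in> S \<Longrightarrow> (\<phi> has_derivative (\<lambda>h. h \<bullet> G x)) (at x within S)"
    unfolding C1c_def by auto
  have "(\<phi> has_derivative (\<lambda>h. h \<bullet> G x)) (at x within U)"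
    by (rule has_derivative_subset[OF G[OF subsetD[OF assms(2,4)]] assms(2)])
  then have D: "(\<phi> has_derivative (\<lambda>h. h \<bullet> G x)) (at x)"
    by (simp only: at_within_open[OF assms(4,3)])
  then show ?thesis using grad_eqI[OF D] by simp
qed

lemma C1c_grad_continuous:
  assumes "\<phi> \<in> C1c S" "U \<subseteq> S" "open U"
  shows "continuous_on U (grad \<phi>)"
proof -
  from assms(1) obtain G where G: "continuous_on S G" "\<And>x. x \<in> S \<Longrightarrow> (\<phi> has_derivative (\<lambda>h. h \<bullet> G x)) (at x within S)"
    unfolding C1c_def by auto
  have "grad \<phi> x = G x" if x: "x \<in> U" for x
  proof (rule grad_eqI)
    have "(\<phi> has_derivative (\<lambda>h. h \<bullet> G x)) (at x within U)"
      by (rule has_derivative_subset[OF G(2)[OF subsetD[OF assms(2) x]] assms(2)])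
    then show "(\<phi> has_derivative (\<lambda>h. h \<bullet> G x)) (at x)" by (simp only: at_within_open[OF x assms(3)])
  qed
  then show ?thesis using continuous_on_subset[OF G(1) assms(2)] by (simp cong: continuous_on_cong)
qed

lemma C1c_bounded_support:
  assumes "\<phi> \<in> C1c S"
  obtains R where "0 < R" "\<And>x. R \<le> norm x \<Longrightarrow> \<phi> x = 0"
proof -
  from assms obtain K where K: "compact K" "\<And>x. x \<notin> K \<Longrightarrow> \<phi> x = 0" unfolding C1c_def by auto
  from compact_imp_bounded[OF K(1)] obtain B where B: "0 < B" "\<And>x. x \<in> K \<Longrightarrow> norm x \<le> B"
    unfolding bounded_pos by auto
  show ?thesis
  proof (rule that[of "B + 1"])
    show "\<phi> x = 0" if "B + 1 \<le> norm x" for x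
      using K(2)[of x] B(2)[of x] that by fastforce
  qed (use B in simp)
qed

lemma C1c_bounded:
  assumes "\<phi> \<in> C1c S" "U \<subseteq> S" "open U"
  obtains K where "0 < K" "\<And>x. \<bar>\<phi> x\<bar> \<le> K" "\<And>x. x \<in> U \<Longrightarrow> norm (grad \<phi> x) \<le> K"
proof -
  from assms(1) obtain K G where K: "compact K" "K \<subseteq> S" "\<And>x. x \<notin> K \<Longrightarrow> \<phi> x = 0"
    and G: "continuous_on S G" "\<And>x. x \<in> S \<Longrightarrow> (\<phi> has_derivative (\<lambda>h. h \<bullet> G x)) (at x within S)"
    unfolding C1c_def by auto
  have "continuous_on S \<phi>"
    unfolding continuous_on_eq_continuous_within using G(2) by (auto intro: has_derivative_continuous)
  then have "bounded (\<phi> ` K)" "bounded (G ` K)"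
    using K G by (auto intro!: compact_imp_bounded compact_continuous_image intro: continuous_on_subset)
  then obtain A B where A: "0 < A" "\<And>x. x \<in> K \<Longrightarrow> norm (\<phi> x) \<le> A"
    and B: "0 < B" "\<And>x. x \<in> K \<Longrightarrow> norm (G x) \<le> B"
    unfolding bounded_pos by auto
  show ?thesis
  proof (rule that[of "A + B"])
    show "\<bar>\<phi> x\<bar> \<le> A + B" for x
      using A(1) B(1) A(2)[of x] K(3)[of x] by (cases "x \<in> K") auto
    show "norm (grad \<phi> x) \<le> A + B" if x: "x \<in> U" for x
    proof (cases "x \<in> K")
      case True
      have "(\<phi> has_derivative (\<lambda>h. h \<bullet> G x)) (at x within U)"
        by (rule has_derivative_subset[OF G(2)[OF subsetD[OF assms(2) x]] assms(2)])
      then have "grad \<phi> x = G x" by (intro grad_eqI) (simp only: at_within_open[OF x assms(3)])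
      then show ?thesis using A(1) B(2)[OF True] by simp
    next
      case False
      have "grad \<phi> x = 0"
        by (rule grad_zero_local[where U="- K"]) (use K False in \<open>auto simp: compact_imp_closed open_Compl\<close>)
      then show ?thesis using A B by simp
    qed
  qed (use A B in auto)
qed

lemma C1c_subspace: "subspace (C1c S)"
  unfolding subspace_def
proof (intro conjI ballI allI)
  show "0 \<in> C1c S"
    unfolding C1c_def by (auto intro!: exI[of _ "{}"] exI[of _ "\<lambda>_. 0"] simp: zero_fun_def)
next
  fix \<phi> \<psi> assume "\<phi> \<in> C1c S" "\<psi> \<in> C1c S"
  then obtain K G L E where K: "compact K" "K \<subseteq> S" "\<And>x. x \<notin> K \<Longrightarrow> \<phi> x = 0"
    "continuous_on S G" "\<And>x. x \<in> S \<Longrightarrow> (\<phi> has_derivative (\<lambda>h. h \<bullet> G x)) (at x within S)"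
    and L: "compact L" "L \<subseteq> S" "\<And>x. x \<notin> L \<Longrightarrow> \<psi> x = 0"
    "continuous_on S E" "\<And>x. x \<in> S \<Longrightarrow> (\<psi> has_derivative (\<lambda>h. h \<bullet> E x)) (at x within S)"
    unfolding C1c_def by auto
  have "((\<phi> + \<psi>) has_derivative (\<lambda>h. h \<bullet> (G x + E x))) (at x within S)" if "x \<in> S" for x
    using has_derivative_add[OF K(5)[OF that] L(5)[OF that]] by (simp add: inner_add_right plus_fun_def)
  moreover have "continuous_on S (\<lambda>x. G x + E x)" by (intro continuous_intros K L)
  moreover have "compact (K \<union> L)" "K \<union> L \<subseteq> S" "\<And>x. x \<notin> K \<union> L \<Longrightarrow> (\<phi> + \<psi>) x = 0"
    using K L by auto
  ultimately show "\<phi> + \<psi> \<in> C1c S" unfolding C1c_def by blast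
next
  fix c :: real and \<phi> assume "\<phi> \<in> C1c S"
  then obtain K G where K: "compact K" "K \<subseteq> S" "\<And>x. x \<notin> K \<Longrightarrow> \<phi> x = 0"
    "continuous_on S G" "\<And>x. x \<in> S \<Longrightarrow> (\<phi> has_derivative (\<lambda>h. h \<bullet> G x)) (at x within S)"
    unfolding C1c_def by auto
  have "((c *\<^sub>R \<phi>) has_derivative (\<lambda>h. h \<bullet> (c *\<^sub>R G x))) (at x within S)" if "x \<in> S" for x
    using has_derivative_mult_right[OF K(5)[OF that], of c] by (simp add: scaleR_fun_def)
  moreover have "continuous_on S (\<lambda>x. c *\<^sub>R G x)" by (intro continuous_intros K)
  moreover have "\<And>x. x \<notin> K \<Longrightarrow> (c *\<^sub>R \<phi>) x = 0" using K by (simp add: scaleR_fun_def)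
  ultimately show "c *\<^sub>R \<phi> \<in> C1c S" unfolding C1c_def using K(1,2) by blast
qed

lemma grad_add_scaleR:
  assumes "\<phi> \<in> C1c S" "\<psi> \<in> C1c S" "U \<subseteq> S" "open U" "x \<in> U"
  shows "grad (\<phi> + c *\<^sub>R \<psi>) x = grad \<phi> x + c *\<^sub>R grad \<psi> x"
proof (rule grad_eqI)
  show "((\<phi> + c *\<^sub>R \<psi>) has_derivative (\<lambda>h. h \<bullet> (grad \<phi> x + c *\<^sub>R grad \<psi> x))) (at x)"
    using has_derivative_add[OF C1c_has_grad[OF assms(1,3-5)] has_derivative_mult_right[OF C1c_has_grad[OF assms(2-5)], of c]]
    by (simp add: plus_fun_def scaleR_fun_def inner_add_right)
qed

section \<open>The quadratic form of the second variation\<close>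

lemma integrable_halfspace_bounded_support:
  fixes f :: "real^3 \<Rightarrow> real"
  assumes "f \<in> borel_measurable (lebesgue_on halfspace)"
    "AE x in lebesgue_on halfspace. \<bar>f x\<bar> \<le> K * indicator (cball 0 R) x"
  shows "integrable (lebesgue_on halfspace) f"
proof (rule Bochner_Integration.integrable_bound[OF _ assms(1)])
  have "integrable lebesgue (\<lambda>x. indicator halfspace x *\<^sub>R (K * indicator (cball 0 R) x :: real))"
    by (intro integrable_mult_indicator integrable_mult_right integrable_completion[THEN iffD2] integrable_indicator_cball)
      auto
  then show "integrable (lebesgue_on halfspace) (\<lambda>x. K * indicator (cball 0 R) x :: real)"
    by (subst integrable_restrict_space) auto
  show "AE x in lebesgue_on halfspace. norm (f x) \<le> norm (K * indicator (cball 0 R) x :: real)"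
    using assms(2) by (auto simp: elim!: eventually_mono)
qed

lemma continuous_on_halfspace_measurable:
  "continuous_on halfspace f \<Longrightarrow> f \<in> borel_measurable (lebesgue_on halfspace)"
  by (rule continuous_imp_measurable_on_sets_lebesgue) auto

lemma C1c_halfspace_borel:
  assumes \<phi>: "\<phi> \<in> C1c S" and S: "halfspace \<subseteq> S"
  shows "\<phi> \<in> borel_measurable (lebesgue_on halfspace)" "grad \<phi> \<in> borel_measurable (lebesgue_on halfspace)"
    "(\<lambda>x. indicator halfspace x *\<^sub>R \<phi> x) \<in> borel_measurable borel"
    "(\<lambda>x. indicator halfspace x *\<^sub>R grad \<phi> x) \<in> borel_measurable borel"
proof -
  have g: "continuous_on halfspace (grad \<phi>)"
    by (rule C1c_grad_continuous[OF \<phi> S open_halfspace])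
  have p: "continuous_on halfspace \<phi>"
    by (intro continuous_at_imp_continuous_on ballI has_derivative_continuous[OF C1c_has_grad[OF \<phi> S open_halfspace]])
  show "\<phi> \<in> borel_measurable (lebesgue_on halfspace)" "grad \<phi> \<in> borel_measurable (lebesgue_on halfspace)"
    by (rule continuous_on_halfspace_measurable[OF p], rule continuous_on_halfspace_measurable[OF g])
  show "(\<lambda>x. indicator halfspace x *\<^sub>R \<phi> x) \<in> borel_measurable borel"
    "(\<lambda>x. indicator halfspace x *\<^sub>R grad \<phi> x) \<in> borel_measurable borel"
    by (rule borel_measurable_continuous_on_indicator[OF _ p], simp,
        rule borel_measurable_continuous_on_indicator[OF _ g], simp)
qed

text \<open>Without integrability the two Bochner integrals in \<open>Qform\<close> could not be
  split additively.\<close>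

lemma Qform_integrable:
  assumes \<phi>: "\<phi> \<in> C1c (closure halfspace)" and \<psi>: "\<psi> \<in> C1c (closure halfspace)"
    and u: "ess_bounded u" and v: "ess_bounded v"
  shows "integrable (lebesgue_on halfspace) (\<lambda>x. (norm (grad \<phi> x))\<^sup>2 + (norm (grad \<psi> x))\<^sup>2)"
    and "integrable (lebesgue_on halfspace) (\<lambda>x. (v x)\<^sup>2 * (\<phi> x)\<^sup>2 + (u x)\<^sup>2 * (\<psi> x)\<^sup>2 + 4 * u x * v x * \<phi> x * \<psi> x)"
proof -
  let ?M = "lebesgue_on halfspace"
  note [measurable] = C1c_halfspace_borel(1,2)[OF \<phi> closure_subset] C1c_halfspace_borel(1,2)[OF \<psi> closure_subset]
  have [measurable]: "u \<in> borel_measurable ?M" "v \<in> borel_measurable ?M"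
    using u v by (auto simp: ess_bounded_def)
  obtain A where A: "0 < A" "\<And>x. \<bar>\<phi> x\<bar> \<le> A" "\<And>x. x \<in> halfspace \<Longrightarrow> norm (grad \<phi> x) \<le> A"
    using C1c_bounded[OF \<phi> closure_subset] by auto
  obtain B where B: "0 < B" "\<And>x. \<bar>\<psi> x\<bar> \<le> B" "\<And>x. x \<in> halfspace \<Longrightarrow> norm (grad \<psi> x) \<le> B"
    using C1c_bounded[OF \<psi> closure_subset] by auto
  obtain R1 where R1: "0 < R1" "\<And>x. R1 \<le> norm x \<Longrightarrow> \<phi> x = 0" using C1c_bounded_support[OF \<phi>] by auto
  obtain R2 where R2: "0 < R2" "\<And>x. R2 \<le> norm x \<Longrightarrow> \<psi> x = 0" using C1c_bounded_support[OF \<psi>] by auto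
  define R where "R = R1 + R2"
  have far: "\<phi> x = 0" "\<psi> x = 0" "grad \<phi> x = 0" "grad \<psi> x = 0" if "x \<notin> cball 0 R" for x
  proof -
    show "grad \<phi> x = 0" "grad \<psi> x = 0"
      by (rule grad_zero_local[where U="- cball 0 R"]; use R1 R2 that in \<open>auto simp: R_def\<close>)+
  qed (use R1 R2 that in \<open>auto simp: R_def\<close>)
  show "integrable ?M (\<lambda>x. (norm (grad \<phi> x))\<^sup>2 + (norm (grad \<psi> x))\<^sup>2)"
  proof (rule integrable_halfspace_bounded_support[where K="A\<^sup>2 + B\<^sup>2" and R=R])
    show "AE x in ?M. \<bar>(norm (grad \<phi> x))\<^sup>2 + (norm (grad \<psi> x))\<^sup>2\<bar> \<le> (A\<^sup>2 + B\<^sup>2) * indicator (cball 0 R) x"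
    proof (rule AE_I2)
      fix x assume "x \<in> space ?M"
      then have "x \<in> halfspace" by simp
      then have "(norm (grad \<phi> x))\<^sup>2 \<le> A\<^sup>2" "(norm (grad \<psi> x))\<^sup>2 \<le> B\<^sup>2"
        using A B by (auto intro: power_mono)
      then show "\<bar>(norm (grad \<phi> x))\<^sup>2 + (norm (grad \<psi> x))\<^sup>2\<bar> \<le> (A\<^sup>2 + B\<^sup>2) * indicator (cball 0 R) x"
        using far[of x] by (cases "x \<in> cball 0 R") auto
    qed
  qed measurable
  obtain a b where "AE x in ?M. \<bar>u x\<bar> \<le> a" "AE x in ?M. \<bar>v x\<bar> \<le> b"
    using u v by (auto simp: ess_bounded_def)
  then have ab: "AE x in ?M. \<bar>u x\<bar> \<le> a \<and> \<bar>v x\<bar> \<le> b" by (rule AE_conjI)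
  show "integrable ?M (\<lambda>x. (v x)\<^sup>2 * (\<phi> x)\<^sup>2 + (u x)\<^sup>2 * (\<psi> x)\<^sup>2 + 4 * u x * v x * \<phi> x * \<psi> x)"
  proof (rule integrable_halfspace_bounded_support[where K="b\<^sup>2 * A\<^sup>2 + a\<^sup>2 * B\<^sup>2 + 4 * a * b * A * B" and R=R])
    show "AE x in ?M. \<bar>(v x)\<^sup>2 * (\<phi> x)\<^sup>2 + (u x)\<^sup>2 * (\<psi> x)\<^sup>2 + 4 * u x * v x * \<phi> x * \<psi> x\<bar>
        \<le> (b\<^sup>2 * A\<^sup>2 + a\<^sup>2 * B\<^sup>2 + 4 * a * b * A * B) * indicator (cball 0 R) x"
      using ab
    proof (rule AE_mp, intro AE_I2 impI)
      fix x assume x: "\<bar>u x\<bar> \<le> a \<and> \<bar>v x\<bar> \<le> b"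
      show "\<bar>(v x)\<^sup>2 * (\<phi> x)\<^sup>2 + (u x)\<^sup>2 * (\<psi> x)\<^sup>2 + 4 * u x * v x * \<phi> x * \<psi> x\<bar>
        \<le> (b\<^sup>2 * A\<^sup>2 + a\<^sup>2 * B\<^sup>2 + 4 * a * b * A * B) * indicator (cball 0 R) x"
      proof (cases "x \<in> cball 0 R")
        case True
        have sq: "(u x)\<^sup>2 \<le> a\<^sup>2" "(v x)\<^sup>2 \<le> b\<^sup>2" "(\<phi> x)\<^sup>2 \<le> A\<^sup>2" "(\<psi> x)\<^sup>2 \<le> B\<^sup>2"
          using x A B by (auto intro: abs_le_square_iff[THEN iffD1])
        have "\<bar>4 * u x * v x * \<phi> x * \<psi> x\<bar> \<le> 4 * a * b * A * B"
          unfolding abs_mult using x A B by (intro mult_mono mult_nonneg_nonneg) auto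
        moreover have "\<bar>(v x)\<^sup>2 * (\<phi> x)\<^sup>2\<bar> \<le> b\<^sup>2 * A\<^sup>2" "\<bar>(u x)\<^sup>2 * (\<psi> x)\<^sup>2\<bar> \<le> a\<^sup>2 * B\<^sup>2"
          using sq by (auto intro!: mult_mono)
        ultimately have "\<bar>(v x)\<^sup>2 * (\<phi> x)\<^sup>2 + (u x)\<^sup>2 * (\<psi> x)\<^sup>2 + 4 * u x * v x * \<phi> x * \<psi> x\<bar>
            \<le> b\<^sup>2 * A\<^sup>2 + a\<^sup>2 * B\<^sup>2 + 4 * a * b * A * B"
          by linarith
        then show ?thesis using True by simp
      qed (simp add: far)
    qed
  qed measurable
qed

text \<open>Thanks to the gap between \<open>R\<close> and \<open>R + 1\<close>, each point has an
  open neighbourhood on which one of the two pairs vanishes, and there its gradients vanish too. All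
  cross terms therefore drop out.\<close>

lemma Qform_disjoint_supports:
  assumes C1: "\<phi> \<in> C1c (closure halfspace)" "\<psi> \<in> C1c (closure halfspace)"
      "\<phi>' \<in> C1c (closure halfspace)" "\<psi>' \<in> C1c (closure halfspace)"
    and u: "ess_bounded u" and v: "ess_bounded v"
    and far: "\<And>x. R \<le> norm x \<Longrightarrow> \<phi> x = 0 \<and> \<psi> x = 0"
    and near: "\<And>x. norm x < R + 1 \<Longrightarrow> \<phi>' x = 0 \<and> \<psi>' x = 0"
  shows "Qform u v (\<phi> + k *\<^sub>R \<phi>') (\<psi> + k *\<^sub>R \<psi>') = Qform u v \<phi> \<psi> + k\<^sup>2 * Qform u v \<phi>' \<psi>'"
proof -
  let ?M = "lebesgue_on halfspace"
  note Q1 = Qform_integrable[OF C1(1,2) u v] and Q2 = Qform_integrable[OF C1(3,4) u v]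
  have split: "(\<phi>' x = 0 \<and> \<psi>' x = 0 \<and> grad \<phi>' x = 0 \<and> grad \<psi>' x = 0) \<or>
      (\<phi> x = 0 \<and> \<psi> x = 0 \<and> grad \<phi> x = 0 \<and> grad \<psi> x = 0)" for x
  proof (cases "norm x < R + 1")
    case True
    then have "x \<in> ball 0 (R + 1)" by simp
    then have "grad \<phi>' x = 0" "grad \<psi>' x = 0"
      by (rule grad_zero_local[OF open_ball]; use near in simp)+
    then show ?thesis using near[OF True] by simp
  next
    case False
    then have "x \<in> - cball 0 R" by simp
    then have "grad \<phi> x = 0" "grad \<psi> x = 0"
      by (rule grad_zero_local[rotated]; use far in auto)+
    then show ?thesis using far[of x] False by simp
  qed
  have g: "grad (\<phi> + k *\<^sub>R \<phi>') x = grad \<phi> x + k *\<^sub>R grad \<phi>' x" "grad (\<psi> + k *\<^sub>R \<psi>') x = grad \<psi> x + k *\<^sub>R grad \<psi>' x"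
    if "x \<in> halfspace" for x
    using grad_add_scaleR[OF C1(1,3) closure_subset open_halfspace that] grad_add_scaleR[OF C1(2,4) closure_subset open_halfspace that]
    by auto
  have "(\<integral>x. (norm (grad (\<phi> + k *\<^sub>R \<phi>') x))\<^sup>2 + (norm (grad (\<psi> + k *\<^sub>R \<psi>') x))\<^sup>2 \<partial>?M)
     = (\<integral>x. ((norm (grad \<phi> x))\<^sup>2 + (norm (grad \<psi> x))\<^sup>2)
        + k\<^sup>2 * ((norm (grad \<phi>' x))\<^sup>2 + (norm (grad \<psi>' x))\<^sup>2) \<partial>?M)"
  proof (rule Bochner_Integration.integral_cong)
    fix x assume "x \<in> space ?M"
    then have "x \<in> halfspace" by simp
    from g[OF this] split[of x]
    show "(norm (grad (\<phi> + k *\<^sub>R \<phi>') x))\<^sup>2 + (norm (grad (\<psi> + k *\<^sub>R \<psi>') x))\<^sup>2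
        = ((norm (grad \<phi> x))\<^sup>2 + (norm (grad \<psi> x))\<^sup>2) + k\<^sup>2 * ((norm (grad \<phi>' x))\<^sup>2 + (norm (grad \<psi>' x))\<^sup>2)"
      by (elim disjE) (auto simp: power_mult_distrib distrib_left)
  qed simp
  moreover have "(\<integral>x. (v x)\<^sup>2 * ((\<phi> + k *\<^sub>R \<phi>') x)\<^sup>2 + (u x)\<^sup>2 * ((\<psi> + k *\<^sub>R \<psi>') x)\<^sup>2
        + 4 * u x * v x * (\<phi> + k *\<^sub>R \<phi>') x * (\<psi> + k *\<^sub>R \<psi>') x \<partial>?M)
     = (\<integral>x. ((v x)\<^sup>2 * (\<phi> x)\<^sup>2 + (u x)\<^sup>2 * (\<psi> x)\<^sup>2 + 4 * u x * v x * \<phi> x * \<psi> x)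
        + k\<^sup>2 * ((v x)\<^sup>2 * (\<phi>' x)\<^sup>2 + (u x)\<^sup>2 * (\<psi>' x)\<^sup>2 + 4 * u x * v x * \<phi>' x * \<psi>' x) \<partial>?M)"
  proof (rule Bochner_Integration.integral_cong)
    fix x
    from split[of x]
    show "(v x)\<^sup>2 * ((\<phi> + k *\<^sub>R \<phi>') x)\<^sup>2 + (u x)\<^sup>2 * ((\<psi> + k *\<^sub>R \<psi>') x)\<^sup>2
        + 4 * u x * v x * (\<phi> + k *\<^sub>R \<phi>') x * (\<psi> + k *\<^sub>R \<psi>') x
      = ((v x)\<^sup>2 * (\<phi> x)\<^sup>2 + (u x)\<^sup>2 * (\<psi> x)\<^sup>2 + 4 * u x * v x * \<phi> x * \<psi> x)
        + k\<^sup>2 * ((v x)\<^sup>2 * (\<phi>' x)\<^sup>2 + (u x)\<^sup>2 * (\<psi>' x)\<^sup>2 + 4 * u x * v x * \<phi>' x * \<psi>' x)"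
      by (elim disjE) (auto simp: scaleR_fun_def power2_eq_square algebra_simps)
  qed simp
  ultimately show ?thesis
    unfolding Qform_def using Q1 Q2 by (simp add: right_diff_distrib)
qed

text \<open>A negative subspace \<open>W\<close> of maximal dimension is finite dimensional, so its
  elements share a supporting ball. A pair supported beyond that ball with negative
  \<open>Qform\<close> could be adjoined to \<open>W\<close>: by disjointness of supports the form
  stays negative on the larger span, against maximality.\<close>

lemma finite_morse_index_stable_outside:
  assumes u: "ess_bounded u" and v: "ess_bounded v" and morse: "morse_index u v < \<infinity>"
  obtains R where "0 < R"
    "\<And>\<phi> \<psi>. \<phi> \<in> C1c (closure halfspace) \<Longrightarrow> \<psi> \<in> C1c (closure halfspace) \<Longrightarrow>
      (\<And>x. norm x < R \<Longrightarrow> \<phi> x = 0 \<and> \<psi> x = 0) \<Longrightarrow> 0 \<le> Qform u v \<phi> \<psi>"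
proof -
  let ?C = "C1c (closure halfspace)"
  define neg where "neg W \<longleftrightarrow> subspace W \<and> W \<subseteq> ?C \<times> ?C \<and>
    (\<forall>(\<phi>, \<psi>)\<in>W. (\<phi>, \<psi>) \<noteq> 0 \<longrightarrow> Qform u v \<phi> \<psi> < 0)" for W
  define E where "E = {edim W | W. neg W}"
  have SE: "Sup E < \<infinity>" using morse unfolding morse_index_def E_def neg_def .
  \<comment> \<open>This makes \<open>E\<close> nonempty. A nonempty set of extended naturals with
    finite supremum is finite and contains its supremum, so a maximal \<open>W\<close>
    exists.\<close>
  have "neg {0}" unfolding neg_def using subspace_0[OF C1c_subspace]
    by (auto simp: zero_prod_def subspace_def)
  then have "E \<noteq> {}" unfolding E_def by blast
  moreover then have "finite E" using SE by (auto simp: Sup_enat_def split: if_splits)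
  ultimately have "Sup E \<in> E" by (auto simp: Sup_enat_def)
  then obtain W where W: "neg W" "edim W = Sup E" unfolding E_def by auto
  have Wsub: "subspace W" "W \<subseteq> ?C \<times> ?C" using W(1) by (auto simp: neg_def)
  obtain B0 where B0: "finite B0" "W \<subseteq> span B0" and dW: "enat (dim W) = Sup E"
    using W(2) SE unfolding edim_def by (auto split: if_splits)
  obtain B where B: "B \<subseteq> W" "independent B" "W \<subseteq> span B" "card B = dim W"
    using basis_exists by blast
  have finB: "finite B"
    using independent_span_bound[OF B0(1) B(2)] B(1) B0(2) by auto
  have WB: "W = span B" using B(1,3) Wsub(1) span_minimal by blast
  have "\<exists>R. 0 < R \<and> (\<forall>x. R \<le> norm x \<longrightarrow> fst w x = 0 \<and> snd w x = 0)" if "w \<in> B" for w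
  proof -
    have "fst w \<in> ?C" "snd w \<in> ?C" using that B(1) Wsub(2) by auto
    from C1c_bounded_support[OF this(1)] C1c_bounded_support[OF this(2)]
    obtain R1 R2 where "0 < R1" "\<And>x. R1 \<le> norm x \<Longrightarrow> fst w x = 0" "0 < R2" "\<And>x. R2 \<le> norm x \<Longrightarrow> snd w x = 0"
      by metis
    then show ?thesis by (intro exI[of _ "R1 + R2"]) auto
  qed
  then obtain \<rho> where \<rho>: "\<And>w. w \<in> B \<Longrightarrow> 0 < \<rho> w \<and> (\<forall>x. \<rho> w \<le> norm x \<longrightarrow> fst w x = 0 \<and> snd w x = 0)"
    by metis
  \<comment> \<open>The sum bounds every radius and, unlike a maximum, needs no separate treatment
    of an empty basis.\<close>
  define R where "R = (\<Sum>w\<in>B. \<rho> w)"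
  have R0: "0 \<le> R" unfolding R_def using \<rho> by (intro sum_nonneg) force
  have \<rho>R: "\<rho> w \<le> R" if "w \<in> B" for w
    unfolding R_def using member_le_sum[OF that _ finB, of \<rho>] \<rho> by force
  define V where "V = {w :: (real^3 \<Rightarrow> real) \<times> (real^3 \<Rightarrow> real). \<forall>x. R \<le> norm x \<longrightarrow> fst w x = 0 \<and> snd w x = 0}"
  have "subspace V" unfolding subspace_def V_def by (auto simp: scaleR_fun_def)
  moreover have "B \<subseteq> V" using \<rho> \<rho>R order_trans unfolding V_def by blast
  ultimately have WV: "W \<subseteq> V" using WB span_minimal by blast
  show ?thesis
  proof (rule that[of "R + 1"])
    show "0 < R + 1" using R0 by simp
    fix \<phi> \<psi> assume C: "\<phi> \<in> ?C" "\<psi> \<in> ?C" and near: "\<And>x. norm x < R + 1 \<Longrightarrow> \<phi> x = 0 \<and> \<psi> x = 0"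
    show "0 \<le> Qform u v \<phi> \<psi>"
    proof (rule ccontr)
      assume "\<not> 0 \<le> Qform u v \<phi> \<psi>"
      then have Q: "Qform u v \<phi> \<psi> < 0" by simp
      let ?p = "(\<phi>, \<psi>)"
      have g0: "grad (\<lambda>x. 0) y = 0" for y :: "real^3" by (rule grad_eqI) simp
      \<comment> \<open>An element of \<open>W\<close> vanishes outside the radius \<open>R\<close>,
        and the pair vanishes inside \<open>R + 1\<close>. A common element would be zero,
        contradicting its negative form.\<close>
      have p0: "?p \<notin> W"
      proof
        assume "?p \<in> W"
        then have far: "\<And>x. R \<le> norm x \<Longrightarrow> \<phi> x = 0 \<and> \<psi> x = 0" using WV by (auto simp: V_def)
        have "\<phi> x = 0 \<and> \<psi> x = 0" for x using far[of x] near[of x] by (cases "R \<le> norm x") auto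
        then have "\<phi> = (\<lambda>x. 0)" "\<psi> = (\<lambda>x. 0)" by auto
        then have "Qform u v \<phi> \<psi> = 0" by (simp add: Qform_def g0)
        then show False using Q by simp
      qed
      define W' where "W' = span (insert ?p B)"
      have pB: "?p \<notin> span B" using p0 WB by simp
      then have ind: "independent (insert ?p B)" using B(2) by (simp add: independent_insert)
      have "?p \<notin> B" using pB span_base by blast
      then have "dim W' = Suc (dim W)"
        unfolding W'_def using dim_span_eq_card_independent[OF ind] finB B(4) by simp
      moreover have "\<exists>B. finite B \<and> W' \<subseteq> span B" unfolding W'_def using finB by blast
      ultimately have edim': "edim W' = enat (Suc (dim W))" by (simp add: edim_def)
      have "neg W'"
        unfolding neg_def
      proof (intro conjI)
        show "subspace W'" unfolding W'_def by simp
        have "insert ?p B \<subseteq> ?C \<times> ?C" using C B(1) Wsub(2) by auto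
        then show "W' \<subseteq> ?C \<times> ?C"
          unfolding W'_def by (rule span_minimal) (intro subspace_Times C1c_subspace)
        show "\<forall>(\<alpha>, \<beta>)\<in>W'. (\<alpha>, \<beta>) \<noteq> 0 \<longrightarrow> Qform u v \<alpha> \<beta> < 0"
        proof (clarify)
          fix \<alpha> \<beta> assume w: "(\<alpha>, \<beta>) \<in> W'" "(\<alpha>, \<beta>) \<noteq> 0"
          then obtain k where k: "(\<alpha>, \<beta>) - k *\<^sub>R ?p \<in> W"
            unfolding W'_def span_breakdown_eq WB by blast
          define \<gamma> \<delta> where "\<gamma> = \<alpha> - k *\<^sub>R \<phi>" and "\<delta> = \<beta> - k *\<^sub>R \<psi>"
          have gd: "(\<gamma>, \<delta>) \<in> W" using k by (simp add: \<gamma>_def \<delta>_def)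
          have ab: "\<alpha> = \<gamma> + k *\<^sub>R \<phi>" "\<beta> = \<delta> + k *\<^sub>R \<psi>" by (simp_all add: \<gamma>_def \<delta>_def)
          have far: "\<And>x. R \<le> norm x \<Longrightarrow> \<gamma> x = 0 \<and> \<delta> x = 0" using gd WV by (auto simp: V_def)
          have eq: "Qform u v \<alpha> \<beta> = Qform u v \<gamma> \<delta> + k\<^sup>2 * Qform u v \<phi> \<psi>"
            unfolding ab using gd Wsub(2) by (intro Qform_disjoint_supports[where R=R] C u v far near) auto
          show "Qform u v \<alpha> \<beta> < 0"
          proof (cases "(\<gamma>, \<delta>) = 0")
            case True
            then have "\<gamma> = 0" "\<delta> = 0" by (auto simp: zero_prod_def)
            then have "k \<noteq> 0" using w(2) ab by (auto simp: zero_prod_def)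
            moreover have "Qform u v \<gamma> \<delta> = 0"
              using \<open>\<gamma> = 0\<close> \<open>\<delta> = 0\<close> by (simp add: Qform_def zero_fun_def g0)
            ultimately show ?thesis using Q eq by (simp add: mult_pos_neg)
          next
            case False
            then have "Qform u v \<gamma> \<delta> < 0" using W(1) gd unfolding neg_def by blast
            moreover have "k\<^sup>2 * Qform u v \<phi> \<psi> \<le> 0" using Q by (simp add: mult_nonneg_nonpos)
            ultimately show ?thesis using eq by linarith
          qed
        qed
      qed
      then have "edim W' \<in> E" unfolding E_def by blast
      then have "edim W' \<le> Sup E" by (rule Sup_upper)
      then show False unfolding edim' dW[symmetric] by simp
    qed
  qed
qed

section \<open>Bounded functions and passage to the limit\<close>

text \<open>A class closed under the algebra needed for all potentials and cutoffs. Integrability of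
  a product then reduces to the vanishing of one factor outside a ball.\<close>

definition bounded_borel :: "('a::euclidean_space \<Rightarrow> real) \<Rightarrow> bool"
  where "bounded_borel f \<longleftrightarrow> f \<in> borel_measurable borel \<and> (\<exists>K. \<forall>x. \<bar>f x\<bar> \<le> K)"

named_theorems bounded_borel_intros

lemma bounded_borelI: "f \<in> borel_measurable borel \<Longrightarrow> (\<And>x. \<bar>f x\<bar> \<le> K) \<Longrightarrow> bounded_borel f"
  by (auto simp: bounded_borel_def)

lemma bounded_borel_measurable: "bounded_borel f \<Longrightarrow> f \<in> borel_measurable borel"
  by (simp add: bounded_borel_def)

lemma bounded_borel_const [bounded_borel_intros]: "bounded_borel (\<lambda>x. c)"
  by (auto simp: bounded_borel_def)

lemma bounded_borel_add [bounded_borel_intros]: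
  assumes "bounded_borel f" "bounded_borel g"
  shows "bounded_borel (\<lambda>x. f x + g x)"
proof -
  from assms obtain K L where "\<And>x. \<bar>f x\<bar> \<le> K" "\<And>x. \<bar>g x\<bar> \<le> L" by (auto simp: bounded_borel_def)
  then have "\<bar>f x + g x\<bar> \<le> K + L" for x using abs_triangle_ineq[of "f x" "g x"] by (smt (verit))
  then show ?thesis using assms by (auto simp: bounded_borel_def)
qed

lemma bounded_borel_mult [bounded_borel_intros]:
  assumes "bounded_borel f" "bounded_borel g"
  shows "bounded_borel (\<lambda>x. f x * g x)"
proof -
  from assms obtain K L where K: "\<And>x. \<bar>f x\<bar> \<le> K" and L: "\<And>x. \<bar>g x\<bar> \<le> L" by (auto simp: bounded_borel_def)
  have "0 \<le> K" using K[of undefined] by linarith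
  then have "\<bar>f x * g x\<bar> \<le> K * L" for x unfolding abs_mult using K L by (intro mult_mono) auto
  then show ?thesis using assms by (auto simp: bounded_borel_def)
qed

lemma bounded_borel_diff [bounded_borel_intros]:
  assumes "bounded_borel f" "bounded_borel g"
  shows "bounded_borel (\<lambda>x. f x - g x)"
  using bounded_borel_add[OF assms(1) bounded_borel_mult[OF bounded_borel_const[of "-1"] assms(2)]] by simp

lemma bounded_borel_power [bounded_borel_intros]: "bounded_borel f \<Longrightarrow> bounded_borel (\<lambda>x. f x ^ n)"
  by (induction n) (auto intro: bounded_borel_intros)

lemma bounded_borel_indicator [bounded_borel_intros]: "A \<in> sets borel \<Longrightarrow> bounded_borel (indicator A)"
  by (rule bounded_borelI[where K=1]) (auto simp: indicator_def)

lemma bounded_borel_scaled [bounded_borel_intros]: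
  assumes "bounded_borel f"
  shows "bounded_borel (\<lambda>x. f (c *\<^sub>R x))"
proof -
  have [measurable]: "f \<in> borel_measurable borel" using assms by (simp add: bounded_borel_def)
  show ?thesis using assms by (auto simp: bounded_borel_def)
qed

lemma bounded_borel_integrable:
  assumes "bounded_borel f" "\<And>x. R < norm x \<Longrightarrow> f x = 0"
  shows "integrable lborel f"
proof -
  obtain K where K: "\<And>x. \<bar>f x\<bar> \<le> K" using assms by (auto simp: bounded_borel_def)
  show ?thesis
  proof (rule Bochner_Integration.integrable_bound[where f="\<lambda>x. indicator (cball 0 R) x * K"])
    show "integrable lborel (\<lambda>x::'a. indicator (cball 0 R) x * K)"
      by (intro integrable_mult_left integrable_indicator_cball)
    have "norm (f x) \<le> norm (indicator (cball 0 R) x * K)" for x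
      using K[of x] assms(2)[of x] by (cases "R < norm x") auto
    then show "AE x in lborel. norm (f x) \<le> norm (indicator (cball 0 R) x * K)" by simp
  qed (use assms in \<open>simp add: bounded_borel_def\<close>)
qed

lemma bounded_borel_local_L2:
  assumes "bounded_borel f"
  shows "square_integrable lborel (\<lambda>x. indicator (cball 0 R) x *\<^sub>R f x)"
  unfolding square_integrable_def
proof
  have b: "bounded_borel (\<lambda>x. indicator (cball 0 R) x * f x)"
    by (intro bounded_borel_intros assms) auto
  then show "(\<lambda>x. indicator (cball 0 R) x *\<^sub>R f x) \<in> borel_measurable lborel" by (simp add: bounded_borel_def)
  show "integrable lborel (\<lambda>x. (norm (indicator (cball 0 R) x *\<^sub>R f x))\<^sup>2)"
    using bounded_borel_power[OF b, of 2]
    by (intro bounded_borel_integrable[where R=R]) (auto simp: power_mult_distrib)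
qed

lemma bounded_borel_cutoff:
  assumes "cutoff R \<eta> \<eta>'"
  shows "bounded_borel \<eta>" "bounded_borel (\<lambda>x. norm (\<eta>' x))"
proof -
  obtain K where K: "\<And>x. \<bar>\<eta> x\<bar> \<le> K" "\<And>x. norm (\<eta>' x) \<le> K" using cutoff_bounded[OF assms] by metis
  note [measurable] = cutoff_measurable[OF assms]
  show "bounded_borel \<eta>" "bounded_borel (\<lambda>x. norm (\<eta>' x))"
    using K by (auto intro!: bounded_borelI[where K=K])
qed

text \<open>Fatou's lemma for truncations. The bounds may vary with \<open>n\<close>, because both
  the Dirichlet estimate and the Pohozaev estimate close only as the radius tends to
  infinity.\<close>

lemma integral_Fatou_bound:
  fixes F :: "nat \<Rightarrow> 'a \<Rightarrow> real"
  assumes F: "\<And>n. integrable M (F n)" "\<And>n x. 0 \<le> F n x" and f: "f \<in> borel_measurable M"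
    and lim: "\<And>x. (\<lambda>n. F n x) \<longlonglongrightarrow> f x" and le: "\<And>n. (\<integral>x. F n x \<partial>M) \<le> K n" and K: "K \<longlonglongrightarrow> k"
  shows "integrable M f" "(\<integral>x. f x \<partial>M) \<le> k"
proof -
  have [measurable]: "F n \<in> borel_measurable M" for n using F(1) by (rule borel_measurable_integrable)
  have f0: "0 \<le> f x" for x by (rule LIMSEQ_le_const[OF lim]) (use F in auto)
  have K0: "0 \<le> K n" for n by (rule order_trans[OF integral_nonneg_AE le]) (use F(2) in auto)
  have "(\<integral>\<^sup>+x. ennreal (f x) \<partial>M) = (\<integral>\<^sup>+x. liminf (\<lambda>n. ennreal (F n x)) \<partial>M)"
  proof (rule nn_integral_cong)
    fix x
    have "(\<lambda>n. ennreal (F n x)) \<longlonglongrightarrow> ennreal (f x)" by (intro tendsto_ennrealI lim)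
    then show "ennreal (f x) = liminf (\<lambda>n. ennreal (F n x))"
      by (simp add: lim_imp_Liminf)
  qed
  also have "\<dots> \<le> liminf (\<lambda>n. \<integral>\<^sup>+x. ennreal (F n x) \<partial>M)" by (rule nn_integral_liminf) simp
  also have "\<dots> \<le> liminf (\<lambda>n. ennreal (K n))"
  proof (rule Liminf_mono, rule always_eventually, rule allI)
    fix n
    have "(\<integral>\<^sup>+x. ennreal (F n x) \<partial>M) = ennreal (\<integral>x. F n x \<partial>M)"
      by (rule nn_integral_eq_integral) (use F in auto)
    then show "(\<integral>\<^sup>+x. ennreal (F n x) \<partial>M) \<le> ennreal (K n)" using le by (simp add: ennreal_leI)
  qed
  also have "\<dots> = ennreal k"
    by (rule lim_imp_Liminf) (auto intro: tendsto_ennrealI K)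
  finally have nn: "(\<integral>\<^sup>+x. ennreal (f x) \<partial>M) \<le> ennreal k" .
  show i: "integrable M f"
    unfolding integrable_iff_bounded using f f0 nn by (auto intro: le_less_trans)
  have "0 \<le> k" by (rule LIMSEQ_le_const[OF K]) (use K0 in auto)
  then show "(\<integral>x. f x \<partial>M) \<le> k"
    using nn f0 by (subst (asm) nn_integral_eq_integral[OF i]) auto
qed

section \<open>The energy identity\<close>

text \<open>The right-hand side \<open>b\<close> is an arbitrary function, so that the two equations
  of the system become instances of one notion.\<close>

definition neumann_weak :: "real \<Rightarrow> (real^3 \<Rightarrow> real) \<Rightarrow> (real^3 \<Rightarrow> real^3) \<Rightarrow>
    (nat \<Rightarrow> real^3 \<Rightarrow> real) \<Rightarrow> (nat \<Rightarrow> real^3 \<Rightarrow> real^3) \<Rightarrow> (real^3 \<Rightarrow> real) \<Rightarrow> bool"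
  where "neumann_weak C u g F G b \<longleftrightarrow> C1_approx C u g F G \<and> bounded_borel b \<and> (\<forall>x. x \<notin> halfspace \<longrightarrow> b x = 0) \<and>
    (\<forall>\<phi>\<in>C1c (closure halfspace). (\<integral>x. g x \<bullet> grad \<phi> x \<partial>lborel) = (\<integral>x. b x * \<phi> x \<partial>lborel))"

lemma neumann_weak_test:
  assumes "neumann_weak C u g F G b" "cutoff R \<eta> \<eta>'" "C1_approx C' f h F' G'"
  shows "(\<integral>x. g x \<bullet> (\<eta> x *\<^sub>R h x + f x *\<^sub>R \<eta>' x) \<partial>lborel) = (\<integral>x. b x * (\<eta> x * f x) \<partial>lborel)"
  using assms(1) unfolding neumann_weak_def
  by (intro weak_form_cutoff[OF assms(2,3)] C1_approx_square_integrable(2) bounded_borel_local_L2)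
    (auto intro: C1_approxD(5))

lemma bounded_borel_C1_approx:
  assumes "C1_approx C f g F G"
  shows "bounded_borel f"
  using C1_approxD(1,3)[OF assms] by (intro bounded_borelI)

lemma cutoff_scaleR_square_integrable:
  assumes \<eta>: "cutoff R \<eta> \<eta>'" and F: "C1_approx C f g F G"
  shows "square_integrable lborel (\<lambda>x. \<eta> x *\<^sub>R g x)" "square_integrable lborel (\<lambda>x. f x *\<^sub>R \<eta>' x)"
    "square_integrable lborel (\<lambda>x. \<eta> x * f x)"
proof -
  obtain K where K: "0 < K" "\<And>x. \<bar>\<eta> x\<bar> \<le> K" "\<And>x. norm (\<eta>' x) \<le> K" using cutoff_bounded[OF \<eta>] by metis
  note [measurable] = cutoff_measurable[OF \<eta>] C1_approxD(1,2)[OF F]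
  have z: "\<eta> x = 0" "\<eta>' x = 0" if "x \<notin> cball 0 R" for x
    using \<eta> that by (auto simp: cutoff_def)
  have "square_integrable lborel (\<lambda>x. \<eta> x *\<^sub>R (indicator (cball 0 R) x *\<^sub>R g x))"
    by (rule square_integrable_bounded_scaleR[OF C1_approx_square_integrable(2)[OF F]]) (use K in auto)
  moreover have "\<eta> x *\<^sub>R (indicator (cball 0 R) x *\<^sub>R g x) = \<eta> x *\<^sub>R g x" for x
    using z[of x] by (cases "x \<in> cball 0 R") auto
  ultimately show "square_integrable lborel (\<lambda>x. \<eta> x *\<^sub>R g x)" by (simp only:)
  have "bounded_borel (\<lambda>x. (f x)\<^sup>2 * (norm (\<eta>' x))\<^sup>2)"
    by (intro bounded_borel_intros bounded_borel_C1_approx[OF F] bounded_borel_cutoff[OF \<eta>])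
  then have "integrable lborel (\<lambda>x. (f x)\<^sup>2 * (norm (\<eta>' x))\<^sup>2)"
    by (rule bounded_borel_integrable[where R=R]) (use z in auto)
  then show "square_integrable lborel (\<lambda>x. f x *\<^sub>R \<eta>' x)"
    by (simp add: square_integrable_def power_mult_distrib)
  have "bounded_borel (\<lambda>x. (\<eta> x)\<^sup>2 * (f x)\<^sup>2)"
    by (intro bounded_borel_intros bounded_borel_C1_approx[OF F] bounded_borel_cutoff[OF \<eta>])
  then have "integrable lborel (\<lambda>x. (\<eta> x)\<^sup>2 * (f x)\<^sup>2)"
    by (rule bounded_borel_integrable[where R=R]) (use z in auto)
  then show "square_integrable lborel (\<lambda>x. \<eta> x * f x)"
    by (simp add: square_integrable_def power_mult_distrib)
qed

text \<open>The left side is the Dirichlet integral of \<open>\<eta> * u\<close>, exactly the term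
  that the stability form contains. Testing with \<open>\<eta>^2 * u\<close> yields all of it except
  the square of the part where the derivative hits the cutoff.\<close>

lemma neumann_weak_energy:
  assumes w: "neumann_weak C u g F G b" and \<eta>: "cutoff R \<eta> \<eta>'"
  shows "(\<integral>x. (norm (\<eta> x *\<^sub>R g x + u x *\<^sub>R \<eta>' x))\<^sup>2 \<partial>lborel)
    = (\<integral>x. b x * u x * (\<eta> x)\<^sup>2 \<partial>lborel) + (\<integral>x. (u x)\<^sup>2 * (norm (\<eta>' x))\<^sup>2 \<partial>lborel)"
proof -
  have F: "C1_approx C u g F G" using w by (simp add: neumann_weak_def)
  note sq = cutoff_scaleR_square_integrable[OF \<eta> F]
  let ?\<eta>2 = "\<lambda>x. (\<eta> x)\<^sup>2" and ?\<eta>2' = "\<lambda>x. (2 * \<eta> x) *\<^sub>R \<eta>' x"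
  have i2: "integrable lborel (\<lambda>x. (u x)\<^sup>2 * (norm (\<eta>' x))\<^sup>2)"
    using square_integrable_integrable[OF sq(2)] by (simp add: power_mult_distrib)
  have i1: "integrable lborel (\<lambda>x. g x \<bullet> (?\<eta>2 x *\<^sub>R g x + u x *\<^sub>R ?\<eta>2' x))"
  proof -
    have "integrable lborel (\<lambda>x. (\<eta> x *\<^sub>R g x) \<bullet> (\<eta> x *\<^sub>R g x) + 2 * ((\<eta> x *\<^sub>R g x) \<bullet> (u x *\<^sub>R \<eta>' x)))"
      by (intro Bochner_Integration.integrable_add integrable_mult_right square_integrable_inner sq)
    then show ?thesis
      by (rule back_subst[where P="integrable lborel"])
        (auto simp: fun_eq_iff inner_add_right power2_eq_square algebra_simps)
  qed
  have "(\<integral>x. (norm (\<eta> x *\<^sub>R g x + u x *\<^sub>R \<eta>' x))\<^sup>2 \<partial>lborel)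
    = (\<integral>x. g x \<bullet> (?\<eta>2 x *\<^sub>R g x + u x *\<^sub>R ?\<eta>2' x) + (u x)\<^sup>2 * (norm (\<eta>' x))\<^sup>2 \<partial>lborel)"
    unfolding power2_norm_eq_inner
    by (rule Bochner_Integration.integral_cong)
      (auto simp: inner_add_right inner_add_left power2_eq_square inner_commute algebra_simps)
  also have "\<dots> = (\<integral>x. g x \<bullet> (?\<eta>2 x *\<^sub>R g x + u x *\<^sub>R ?\<eta>2' x) \<partial>lborel) + (\<integral>x. (u x)\<^sup>2 * (norm (\<eta>' x))\<^sup>2 \<partial>lborel)"
    by (rule Bochner_Integration.integral_add[OF i1 i2])
  also have "(\<integral>x. g x \<bullet> (?\<eta>2 x *\<^sub>R g x + u x *\<^sub>R ?\<eta>2' x) \<partial>lborel) = (\<integral>x. b x * (?\<eta>2 x * u x) \<partial>lborel)"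
    by (rule neumann_weak_test[OF w cutoff_square[OF \<eta>] F])
  finally show ?thesis by (simp add: ac_simps)
qed

section \<open>The stability inequality\<close>

text \<open>Nonnegativity of \<open>Qform\<close> for test pairs vanishing near the origin,
  rewritten over the whole space. Only the gradient part carries the indicator; in the potential
  part its role is taken by representatives of \<open>u\<close> and \<open>v\<close> that vanish off
  the half-space.\<close>

definition stable_outside :: "real \<Rightarrow> (real^3 \<Rightarrow> real) \<Rightarrow> (real^3 \<Rightarrow> real) \<Rightarrow> bool"
  where "stable_outside R0 u v \<longleftrightarrow> (\<forall>\<phi>\<in>C1c (closure halfspace). \<forall>\<psi>\<in>C1c (closure halfspace).
    (\<forall>x. norm x < R0 \<longrightarrow> \<phi> x = 0 \<and> \<psi> x = 0) \<longrightarrow>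
    (\<integral>x. (v x)\<^sup>2 * (\<phi> x)\<^sup>2 + (u x)\<^sup>2 * (\<psi> x)\<^sup>2 + 4 * u x * v x * \<phi> x * \<psi> x \<partial>lborel)
      \<le> (\<integral>x. indicator halfspace x * ((norm (grad \<phi> x))\<^sup>2 + (norm (grad \<psi> x))\<^sup>2) \<partial>lborel))"

text \<open>
  The stability form is tested with \<open>(\<eta> v, \<eta> u)\<close> rather than \<open>(\<eta> u, \<eta> v)\<close>: this is what produces the
  full quartic \<open>(u\<^sup>2 + v\<^sup>2)\<^sup>2\<close> on the left and so also controls the semitrivial solutions.
\<close>

lemma stable_outside_inequality:
  assumes U: "neumann_weak C u gu Fu Gu (\<lambda>x. u x * (v x)\<^sup>2)"
    and V: "neumann_weak C v gv Fv Gv (\<lambda>x. (u x)\<^sup>2 * v x)"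
    and stab: "stable_outside R0 u v"
    and \<eta>: "cutoff R \<eta> \<eta>'" and \<eta>0: "\<And>x. norm x < R0 \<Longrightarrow> \<eta> x = 0"
  shows "(\<integral>x. ((u x)\<^sup>2 + (v x)\<^sup>2)\<^sup>2 * (\<eta> x)\<^sup>2 \<partial>lborel)
    \<le> (\<integral>x. ((u x)\<^sup>2 + (v x)\<^sup>2) * (norm (\<eta>' x))\<^sup>2 \<partial>lborel)"
proof -
  have Fu: "C1_approx C u gu Fu Gu" and Fv: "C1_approx C v gv Fv Gv"
    using U V by (auto simp: neumann_weak_def)
  note bu = bounded_borel_C1_approx[OF Fu] and bv = bounded_borel_C1_approx[OF Fv]
  note [measurable] = bounded_borel_measurable[OF bu] bounded_borel_measurable[OF bv]
  note b\<eta> = bounded_borel_cutoff[OF \<eta>]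
  note bb = bounded_borel_intros bu bv b\<eta>
  have z: "\<eta> x = 0" "\<eta>' x = 0" if "R < norm x" for x using \<eta> that by (auto simp: cutoff_def)
  let ?\<phi> = "\<lambda>n. cutoff_approx \<eta> (Fv n)" and ?\<psi> = "\<lambda>n. cutoff_approx \<eta> (Fu n)"
  let ?\<phi>H = "\<lambda>n x. indicator halfspace x *\<^sub>R ?\<phi> n x" and ?\<psi>H = "\<lambda>n x. indicator halfspace x *\<^sub>R ?\<psi> n x"
  let ?d\<phi> = "\<lambda>n x. indicator halfspace x *\<^sub>R grad (?\<phi> n) x" and ?d\<psi> = "\<lambda>n x. indicator halfspace x *\<^sub>R grad (?\<psi> n) x"
  note Lv = cutoff_approx_L2[OF \<eta> Fv] and Lu = cutoff_approx_L2[OF \<eta> Fu]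
  have uC: "\<bar>u x\<bar> \<le> C" "\<bar>v x\<bar> \<le> C" for x using C1_approxD(3)[OF Fu] C1_approxD(3)[OF Fv] by auto
  have C: "0 \<le> C" using uC(1)[of 0] by linarith
  have v\<phi>: "L2_tendsto lborel (\<lambda>n x. v x *\<^sub>R ?\<phi>H n x) (\<lambda>x. v x *\<^sub>R (\<eta> x * v x))"
    by (rule L2_tendsto_bounded_scaleR[OF Lv(1), where K=C]) (use uC in auto)
  have u\<psi>: "L2_tendsto lborel (\<lambda>n x. u x *\<^sub>R ?\<psi>H n x) (\<lambda>x. u x *\<^sub>R (\<eta> x * u x))"
    by (rule L2_tendsto_bounded_scaleR[OF Lu(1), where K=C]) (use uC in auto)
  \<comment> \<open>This sequence and the next serve the mixed term, read as the inner product of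
    \<open>u * \<phi>\<close> and \<open>v * \<psi>\<close>; the two preceding ones serve the
    squares.\<close>
  have u\<phi>: "L2_tendsto lborel (\<lambda>n x. u x *\<^sub>R ?\<phi>H n x) (\<lambda>x. u x *\<^sub>R (\<eta> x * v x))"
    by (rule L2_tendsto_bounded_scaleR[OF Lv(1), where K=C]) (use uC in auto)
  have v\<psi>: "L2_tendsto lborel (\<lambda>n x. v x *\<^sub>R ?\<psi>H n x) (\<lambda>x. v x *\<^sub>R (\<eta> x * u x))"
    by (rule L2_tendsto_bounded_scaleR[OF Lu(1), where K=C]) (use uC in auto)
  have uv0: "u x = 0" "v x = 0" if "x \<notin> halfspace" for x
    using C1_approxD(4)[OF Fu that] C1_approxD(4)[OF Fv that] by auto
  have ineq: "(\<integral>x. (norm (v x *\<^sub>R ?\<phi>H n x))\<^sup>2 \<partial>lborel) + (\<integral>x. (norm (u x *\<^sub>R ?\<psi>H n x))\<^sup>2 \<partial>lborel)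
        + 4 * (\<integral>x. (u x *\<^sub>R ?\<phi>H n x) \<bullet> (v x *\<^sub>R ?\<psi>H n x) \<partial>lborel)
      \<le> (\<integral>x. (norm (?d\<phi> n x))\<^sup>2 \<partial>lborel) + (\<integral>x. (norm (?d\<psi> n x))\<^sup>2 \<partial>lborel)" for n
  proof -
    have sqi: "square_integrable lborel (\<lambda>x. v x *\<^sub>R ?\<phi>H n x)" "square_integrable lborel (\<lambda>x. u x *\<^sub>R ?\<psi>H n x)"
      "square_integrable lborel (\<lambda>x. u x *\<^sub>R ?\<phi>H n x)" "square_integrable lborel (\<lambda>x. v x *\<^sub>R ?\<psi>H n x)"
      "square_integrable lborel (?d\<phi> n)" "square_integrable lborel (?d\<psi> n)"
      using v\<phi> u\<psi> u\<phi> v\<psi> Lv(2) Lu(2) unfolding L2_tendsto_def by auto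
    have "(\<integral>x. (norm (v x *\<^sub>R ?\<phi>H n x))\<^sup>2 \<partial>lborel) + (\<integral>x. (norm (u x *\<^sub>R ?\<psi>H n x))\<^sup>2 \<partial>lborel)
        + 4 * (\<integral>x. (u x *\<^sub>R ?\<phi>H n x) \<bullet> (v x *\<^sub>R ?\<psi>H n x) \<partial>lborel)
      = (\<integral>x. (norm (v x *\<^sub>R ?\<phi>H n x))\<^sup>2 + (norm (u x *\<^sub>R ?\<psi>H n x))\<^sup>2
          + 4 * ((u x *\<^sub>R ?\<phi>H n x) \<bullet> (v x *\<^sub>R ?\<psi>H n x)) \<partial>lborel)"
      using square_integrable_integrable[OF sqi(1)] square_integrable_integrable[OF sqi(2)]
        square_integrable_inner[OF sqi(3,4)]
      by (simp only: Bochner_Integration.integral_add Bochner_Integration.integrable_add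
          integrable_mult_right integral_mult_right_zero)
    also have "\<dots> = (\<integral>x. (v x)\<^sup>2 * (?\<phi> n x)\<^sup>2 + (u x)\<^sup>2 * (?\<psi> n x)\<^sup>2 + 4 * u x * v x * ?\<phi> n x * ?\<psi> n x \<partial>lborel)"
      by (rule Bochner_Integration.integral_cong)
        (use uv0 in \<open>auto simp: indicator_def power_mult_distrib\<close>)
    also have "\<dots> \<le> (\<integral>x. indicator halfspace x * ((norm (grad (?\<phi> n) x))\<^sup>2 + (norm (grad (?\<psi> n) x))\<^sup>2) \<partial>lborel)"
      using stab[unfolded stable_outside_def, rule_format, OF cutoff_approx_C1c(1)[OF \<eta> Fv] cutoff_approx_C1c(1)[OF \<eta> Fu], of n n]
      by (simp add: cutoff_approx_def \<eta>0)
    also have "\<dots> = (\<integral>x. (norm (?d\<phi> n x))\<^sup>2 + (norm (?d\<psi> n x))\<^sup>2 \<partial>lborel)"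
      by (rule Bochner_Integration.integral_cong) (auto simp: indicator_def)
    also have "\<dots> = (\<integral>x. (norm (?d\<phi> n x))\<^sup>2 \<partial>lborel) + (\<integral>x. (norm (?d\<psi> n x))\<^sup>2 \<partial>lborel)"
      by (rule Bochner_Integration.integral_add; rule square_integrable_integrable; rule sqi)
    finally show ?thesis .
  qed
  have lim: "(\<integral>x. (norm (v x *\<^sub>R (\<eta> x * v x)))\<^sup>2 \<partial>lborel) + (\<integral>x. (norm (u x *\<^sub>R (\<eta> x * u x)))\<^sup>2 \<partial>lborel)
        + 4 * (\<integral>x. (u x *\<^sub>R (\<eta> x * v x)) \<bullet> (v x *\<^sub>R (\<eta> x * u x)) \<partial>lborel)
      \<le> (\<integral>x. (norm (\<eta> x *\<^sub>R gv x + v x *\<^sub>R \<eta>' x))\<^sup>2 \<partial>lborel) + (\<integral>x. (norm (\<eta> x *\<^sub>R gu x + u x *\<^sub>R \<eta>' x))\<^sup>2 \<partial>lborel)"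
  proof (rule LIMSEQ_le)
    show "(\<lambda>n. (\<integral>x. (norm (v x *\<^sub>R ?\<phi>H n x))\<^sup>2 \<partial>lborel) + (\<integral>x. (norm (u x *\<^sub>R ?\<psi>H n x))\<^sup>2 \<partial>lborel)
        + 4 * (\<integral>x. (u x *\<^sub>R ?\<phi>H n x) \<bullet> (v x *\<^sub>R ?\<psi>H n x) \<partial>lborel))
      \<longlonglongrightarrow> (\<integral>x. (norm (v x *\<^sub>R (\<eta> x * v x)))\<^sup>2 \<partial>lborel) + (\<integral>x. (norm (u x *\<^sub>R (\<eta> x * u x)))\<^sup>2 \<partial>lborel)
        + 4 * (\<integral>x. (u x *\<^sub>R (\<eta> x * v x)) \<bullet> (v x *\<^sub>R (\<eta> x * u x)) \<partial>lborel)"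
      by (intro tendsto_add tendsto_mult tendsto_const L2_tendsto_norm L2_tendsto_inner v\<phi> u\<psi> u\<phi> v\<psi>)
    show "(\<lambda>n. (\<integral>x. (norm (?d\<phi> n x))\<^sup>2 \<partial>lborel) + (\<integral>x. (norm (?d\<psi> n x))\<^sup>2 \<partial>lborel))
      \<longlonglongrightarrow> (\<integral>x. (norm (\<eta> x *\<^sub>R gv x + v x *\<^sub>R \<eta>' x))\<^sup>2 \<partial>lborel) + (\<integral>x. (norm (\<eta> x *\<^sub>R gu x + u x *\<^sub>R \<eta>' x))\<^sup>2 \<partial>lborel)"
      by (intro tendsto_add L2_tendsto_norm Lv(2) Lu(2))
  qed (use ineq in blast)
  have i: "integrable lborel (\<lambda>x. (u x)\<^sup>2 * (v x)\<^sup>2 * (\<eta> x)\<^sup>2)" "integrable lborel (\<lambda>x. (u x)^4 * (\<eta> x)\<^sup>2)"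
     "integrable lborel (\<lambda>x. (v x)^4 * (\<eta> x)\<^sup>2)" "integrable lborel (\<lambda>x. (u x)\<^sup>2 * (norm (\<eta>' x))\<^sup>2)"
     "integrable lborel (\<lambda>x. (v x)\<^sup>2 * (norm (\<eta>' x))\<^sup>2)"
    by (rule bounded_borel_integrable[where R=R]; (intro bb | simp add: z))+
  define A B D where "A = (\<integral>x. (u x)\<^sup>2 * (v x)\<^sup>2 * (\<eta> x)\<^sup>2 \<partial>lborel)"
    and "B = (\<integral>x. (u x)^4 * (\<eta> x)\<^sup>2 \<partial>lborel)" and "D = (\<integral>x. (v x)^4 * (\<eta> x)\<^sup>2 \<partial>lborel)"
  have "(\<integral>x. (norm (v x *\<^sub>R (\<eta> x * v x)))\<^sup>2 \<partial>lborel) = D"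
    "(\<integral>x. (norm (u x *\<^sub>R (\<eta> x * u x)))\<^sup>2 \<partial>lborel) = B"
    "(\<integral>x. (u x *\<^sub>R (\<eta> x * v x)) \<bullet> (v x *\<^sub>R (\<eta> x * u x)) \<partial>lborel) = A"
    unfolding A_def B_def D_def
    by (auto intro!: Bochner_Integration.integral_cong simp: power_mult_distrib power2_eq_square power4_eq_xxxx ac_simps)
  moreover have "(\<integral>x. u x * (v x)\<^sup>2 * u x * (\<eta> x)\<^sup>2 \<partial>lborel) = A" "(\<integral>x. (u x)\<^sup>2 * v x * v x * (\<eta> x)\<^sup>2 \<partial>lborel) = A"
    unfolding A_def by (auto intro!: Bochner_Integration.integral_cong simp: power2_eq_square ac_simps)
  \<comment> \<open>Each energy identity contributes one \<open>A\<close> on the right. Moving them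
    over turns \<open>D + B + 4 * A\<close> into \<open>D + B + 2 * A\<close>, the integral of the
    full square \<open>(u^2 + v^2)^2\<close> against \<open>\<eta>^2\<close>.\<close>
  ultimately have main: "D + B + 4 * A \<le> 2 * A + (\<integral>x. (u x)\<^sup>2 * (norm (\<eta>' x))\<^sup>2 \<partial>lborel) + (\<integral>x. (v x)\<^sup>2 * (norm (\<eta>' x))\<^sup>2 \<partial>lborel)"
    using lim neumann_weak_energy[OF U \<eta>] neumann_weak_energy[OF V \<eta>] by linarith
  have "(\<integral>x. ((u x)\<^sup>2 + (v x)\<^sup>2)\<^sup>2 * (\<eta> x)\<^sup>2 \<partial>lborel)
     = (\<integral>x. (u x)^4 * (\<eta> x)\<^sup>2 + (v x)^4 * (\<eta> x)\<^sup>2 + 2 * ((u x)\<^sup>2 * (v x)\<^sup>2 * (\<eta> x)\<^sup>2) \<partial>lborel)"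
    by (rule Bochner_Integration.integral_cong) (auto simp: power2_eq_square power4_eq_xxxx algebra_simps)
  also have "\<dots> = B + D + 2 * A" using i by (simp add: A_def B_def D_def)
  finally have 1: "(\<integral>x. ((u x)\<^sup>2 + (v x)\<^sup>2)\<^sup>2 * (\<eta> x)\<^sup>2 \<partial>lborel) = B + D + 2 * A" .
  have 2: "(\<integral>x. ((u x)\<^sup>2 + (v x)\<^sup>2) * (norm (\<eta>' x))\<^sup>2 \<partial>lborel)
     = (\<integral>x. (u x)\<^sup>2 * (norm (\<eta>' x))\<^sup>2 \<partial>lborel) + (\<integral>x. (v x)\<^sup>2 * (norm (\<eta>' x))\<^sup>2 \<partial>lborel)"
    using i by (simp add: distrib_right)
  show ?thesis unfolding 1 2 using main by linarith
qed

section \<open>Integrability of the quartic and of the energy\<close>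

definition ball_cutoff :: "real \<Rightarrow> real^3 \<Rightarrow> real"
  where "ball_cutoff R x = bump ((1 / R) *\<^sub>R x)"

definition ball_cutoff_grad :: "real \<Rightarrow> real^3 \<Rightarrow> real^3"
  where "ball_cutoff_grad R x = (1 / R) *\<^sub>R bump_grad ((1 / R) *\<^sub>R x)"

lemma cutoff_ball_cutoff: "0 < R \<Longrightarrow> cutoff R (ball_cutoff R) (ball_cutoff_grad R)"
  unfolding ball_cutoff_def ball_cutoff_grad_def by (rule cutoff_bump)

lemma borel_measurable_ball_cutoff [measurable]:
  "ball_cutoff R \<in> borel_measurable borel" "ball_cutoff_grad R \<in> borel_measurable borel"
  unfolding ball_cutoff_def[abs_def] ball_cutoff_grad_def[abs_def] by measurable

lemma ball_cutoff_bounds: "0 \<le> ball_cutoff R x" "ball_cutoff R x \<le> 1"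
  by (simp_all add: ball_cutoff_def bump_le_1)

lemma norm_ball_cutoff_grad_le:
  assumes R: "0 < R"
  shows "norm (ball_cutoff_grad R x) \<le> 4 / R * indicator (cball 0 R) x"
proof (cases "x \<in> cball 0 R")
  case True
  have "norm (ball_cutoff_grad R x) = norm (bump_grad ((1 / R) *\<^sub>R x)) / R"
    using R by (simp add: ball_cutoff_grad_def)
  also have "\<dots> \<le> 4 / R" using R norm_bump_grad_le by (intro divide_right_mono) auto
  finally show ?thesis using True by simp
next
  case False
  then show ?thesis using cutoff_ball_cutoff[OF R] by (simp add: cutoff_def)
qed

lemma ball_cutoff_ge:
  assumes R: "0 < R" and x: "norm x \<le> R / 2"
  shows "9 / 16 \<le> ball_cutoff R x"
proof -
  have "norm ((1 / R) *\<^sub>R x) \<le> 1 / 2" using R x by (simp add: field_simps)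
  then have "(norm ((1 / R) *\<^sub>R x))\<^sup>2 \<le> (1 / 2)\<^sup>2" by (intro power_mono) auto
  moreover have "(1 / 2 :: real)\<^sup>2 = 1 / 4" by (simp add: power2_eq_square)
  ultimately have "3 / 4 \<le> 1 - (norm ((1 / R) *\<^sub>R x))\<^sup>2" by linarith
  then have *: "3 / 4 \<le> max 0 (1 - (norm ((1 / R) *\<^sub>R x))\<^sup>2)" by (rule max.coboundedI2)
  have "(3 / 4)\<^sup>2 \<le> bump ((1 / R) *\<^sub>R x)" unfolding bump_def by (rule power_mono[OF *]) simp
  then show ?thesis by (simp add: ball_cutoff_def power2_eq_square)
qed

lemma ball_cutoff_tendsto: "(\<lambda>n. ball_cutoff (real (Suc n)) x) \<longlonglongrightarrow> 1"
proof -
  have "(\<lambda>n. (1 / real (Suc n)) *\<^sub>R x) \<longlonglongrightarrow> 0 *\<^sub>R x"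
    by (intro tendsto_scaleR tendsto_const LIMSEQ_Suc[OF lim_1_over_n])
  moreover have "isCont bump (0::real^3)"
    using has_derivative_continuous[OF has_derivative_bump[of "0::real^3" UNIV]] by simp
  ultimately have "(\<lambda>n. bump ((1 / real (Suc n)) *\<^sub>R x)) \<longlonglongrightarrow> bump (0::real^3)"
    using isCont_tendsto_compose[of "0::real^3" bump] by simp
  then show ?thesis by (simp add: ball_cutoff_def bump_def)
qed

lemma integral_indicator_cball:
  assumes "0 \<le> R"
  shows "(\<integral>x. indicator (cball (0::real^3) R) x \<partial>lborel) = unit_ball_vol 3 * R ^ 3"
  using content_cball[OF assms, of "0::real^3"] by simp

text \<open>Removes a neighbourhood of the origin. Because of the factor 2 it vanishes wherever
  \<open>ball_cutoff\<close> is at least 1/2, in particular on the ball of radius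
  \<open>R / 2\<close>, where \<open>ball_cutoff\<close> is at least 9/16. Squaring the positive
  part restores C^1 regularity.\<close>

definition outer_cutoff :: "real \<Rightarrow> real^3 \<Rightarrow> real"
  where "outer_cutoff R x = (max 0 (1 - 2 * ball_cutoff R x))\<^sup>2"

definition outer_cutoff_grad :: "real \<Rightarrow> real^3 \<Rightarrow> real^3"
  where "outer_cutoff_grad R x = (- 4 * max 0 (1 - 2 * ball_cutoff R x)) *\<^sub>R ball_cutoff_grad R x"

lemma has_derivative_outer_cutoff:
  assumes "0 < R"
  shows "(outer_cutoff R has_derivative (\<lambda>h. h \<bullet> outer_cutoff_grad R x)) (at x)"
proof -
  have d: "((\<lambda>x. 1 - 2 * ball_cutoff R x) has_derivative (\<lambda>h. - 2 * (h \<bullet> ball_cutoff_grad R x))) (at x)"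
    using cutoff_ball_cutoff[OF assms] unfolding cutoff_def by (auto intro!: derivative_eq_intros)
  have "((\<lambda>x. (max 0 (1 - 2 * ball_cutoff R x))\<^sup>2) has_derivative
      (\<lambda>h. 2 * max 0 (1 - 2 * ball_cutoff R x) * (- 2 * (h \<bullet> ball_cutoff_grad R x)))) (at x)"
    using has_derivative_compose[OF d has_real_derivative_square_pos_part[unfolded has_field_derivative_def]] by simp
  then show ?thesis
    unfolding outer_cutoff_def[abs_def]
    by (rule has_derivative_eq_rhs) (simp add: outer_cutoff_grad_def fun_eq_iff)
qed

lemma continuous_outer_cutoff_grad: "0 < R \<Longrightarrow> continuous_on UNIV (outer_cutoff_grad R)"
  unfolding outer_cutoff_grad_def[abs_def]
  by (intro continuous_intros cutoff_continuous[OF cutoff_ball_cutoff])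

lemma outer_cutoff_bounds: "0 \<le> outer_cutoff R x" "outer_cutoff R x \<le> 1"
proof -
  have "(max 0 (1 - 2 * ball_cutoff R x))\<^sup>2 \<le> 1\<^sup>2"
    using ball_cutoff_bounds[of R x] by (intro power_mono) auto
  then show "outer_cutoff R x \<le> 1" by (simp add: outer_cutoff_def)
qed (simp add: outer_cutoff_def)

lemma outer_cutoff_inside: "0 < R \<Longrightarrow> norm x \<le> R / 2 \<Longrightarrow> outer_cutoff R x = 0"
  using ball_cutoff_ge[of R x] by (simp add: outer_cutoff_def)

lemma outer_cutoff_outside: "0 < R \<Longrightarrow> R \<le> norm x \<Longrightarrow> outer_cutoff R x = 1"
  using cutoff_ball_cutoff[of R] by (simp add: outer_cutoff_def cutoff_def)

lemma norm_outer_cutoff_grad_le: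
  assumes R: "0 < R"
  shows "norm (outer_cutoff_grad R x) \<le> 16 / R * indicator (cball 0 R) x"
proof -
  have "norm (outer_cutoff_grad R x) = 4 * max 0 (1 - 2 * ball_cutoff R x) * norm (ball_cutoff_grad R x)"
    by (simp add: outer_cutoff_grad_def abs_mult)
  also have "\<dots> \<le> 4 * 1 * (4 / R * indicator (cball 0 R) x)"
    using ball_cutoff_bounds[of R x] R
    by (intro mult_mono norm_ball_cutoff_grad_le[OF R]) auto
  finally show ?thesis by simp
qed

lemma power4_sum_le: "(a + b) ^ 4 \<le> 8 * (a ^ 4 + b ^ 4)" for a b :: real
proof -
  have "(a + b)\<^sup>2 \<le> 2 * (a\<^sup>2 + b\<^sup>2)"
    using zero_le_power2[of "a - b"] by (simp add: power2_eq_square algebra_simps)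
  then have "((a + b)\<^sup>2)\<^sup>2 \<le> (2 * (a\<^sup>2 + b\<^sup>2))\<^sup>2" by (intro power_mono) auto
  also have "\<dots> \<le> 8 * ((a\<^sup>2)\<^sup>2 + (b\<^sup>2)\<^sup>2)"
    using zero_le_power2[of "a\<^sup>2 - b\<^sup>2"] by (simp add: power2_eq_square algebra_simps)
  finally show ?thesis by (simp flip: power_mult)
qed

text \<open>With the cutoff \<theta>^2 in the stability inequality the right side becomes 4 w
  \<theta>^2 |\<theta>'|^2, whose factor w \<theta>^2 is the square root of the integrand on the
  left. Half of the left side then absorbs it and only |\<theta>'|^4 remains. The bound does not
  depend on the outer radius.\<close>

lemma stable_outside_quartic_integrable:
  assumes U: "neumann_weak C u gu Fu Gu (\<lambda>x. u x * (v x)\<^sup>2)"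
    and V: "neumann_weak C v gv Fv Gv (\<lambda>x. (u x)\<^sup>2 * v x)"
    and stab: "stable_outside R0 u v" and R0: "0 < R0"
  shows "integrable lborel (\<lambda>x. ((u x)\<^sup>2 + (v x)\<^sup>2)\<^sup>2)"
proof -
  have Fu: "C1_approx C u gu Fu Gu" and Fv: "C1_approx C v gv Fv Gv"
    using U V by (auto simp: neumann_weak_def)
  note bu = bounded_borel_C1_approx[OF Fu] and bv = bounded_borel_C1_approx[OF Fv]
  define w where "w x = (u x)\<^sup>2 + (v x)\<^sup>2" for x
  have bw: "bounded_borel w" unfolding w_def[abs_def] by (intro bounded_borel_intros bu bv)
  have w0: "0 \<le> w x" for x by (simp add: w_def)
  \<comment> \<open>\<open>outer_cutoff \<rho>\<close> vanishes up to half its radius, that is on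
    the ball of radius \<open>R0\<close>, as stability demands.\<close>
  define \<rho> where "\<rho> = 2 * R0"
  have \<rho>: "0 < \<rho>" using R0 by (simp add: \<rho>_def)
  let ?vol = "unit_ball_vol 3"
  have vol: "0 \<le> ?vol" by simp
  \<comment> \<open>The bound for the integral of |\<theta>'|^4: the factor 8 separates the two
    cutoff gradients, of sizes 4/R and 16/\<rho>, supported in balls of radii \<open>R\<close> and
    \<rho>.\<close>
  define K where "K = 8 * ((4 ^ 4 * ?vol) + (16 / \<rho>) ^ 4 * (?vol * \<rho> ^ 3))"
  \<comment> \<open>256 is 16 * 16: one factor comes from absorption, the other from
    \<open>1 \<le> 16 * \<theta>^4\<close> where \<theta> is at least 9/16. The added integral
    covers the ball that stability does not control.\<close>
  define L where "L = 256 * K + (\<integral>x. indicator (cball 0 \<rho>) x * (w x)\<^sup>2 \<partial>lborel)"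
  have main: "(\<integral>x. indicator (cball 0 (R / 2)) x * (w x)\<^sup>2 \<partial>lborel) \<le> L" if R: "1 \<le> R" for R
  proof -
    have R': "0 < R" using R by simp
    define \<theta> where "\<theta> x = ball_cutoff R x * outer_cutoff \<rho> x" for x
    define \<theta>' where "\<theta>' x = outer_cutoff \<rho> x *\<^sub>R ball_cutoff_grad R x + ball_cutoff R x *\<^sub>R outer_cutoff_grad \<rho> x" for x
    have c: "cutoff R \<theta> \<theta>'"
      unfolding \<theta>_def \<theta>'_def
      by (rule cutoff_mult[OF cutoff_ball_cutoff[OF R'] has_derivative_outer_cutoff[OF \<rho>] continuous_outer_cutoff_grad[OF \<rho>]])
    note b\<theta> = bounded_borel_cutoff[OF c]
    note bb = bounded_borel_intros bw b\<theta>
    have z: "\<theta> x = 0" "\<theta>' x = 0" if "R < norm x" for x using c that by (auto simp: cutoff_def)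
    have in0: "(\<theta> x)\<^sup>2 = 0" if "norm x < R0" for x
      using that outer_cutoff_inside[OF \<rho>, of x] by (simp add: \<theta>_def \<rho>_def)
    have st: "(\<integral>x. (w x)\<^sup>2 * ((\<theta> x)\<^sup>2)\<^sup>2 \<partial>lborel) \<le> (\<integral>x. w x * (norm ((2 * \<theta> x) *\<^sub>R \<theta>' x))\<^sup>2 \<partial>lborel)"
      unfolding w_def by (rule stable_outside_inequality[OF U V stab cutoff_square[OF c] in0])
    have i1: "integrable lborel (\<lambda>x. (w x)\<^sup>2 * (\<theta> x)^4)" "integrable lborel (\<lambda>x. (norm (\<theta>' x))^4)"
      by (rule bounded_borel_integrable[where R=R]; (intro bb | simp add: z))+
    have bi: "integrable lborel (\<lambda>x. w x * (norm ((2 * \<theta> x) *\<^sub>R \<theta>' x))\<^sup>2)"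
    proof (rule bounded_borel_integrable[where R=R])
      have "bounded_borel (\<lambda>x. w x * (4 * (\<theta> x)\<^sup>2 * (norm (\<theta>' x))\<^sup>2))" by (intro bb)
      then show "bounded_borel (\<lambda>x. w x * (norm ((2 * \<theta> x) *\<^sub>R \<theta>' x))\<^sup>2)"
        by (simp add: power_mult_distrib)
    qed (simp add: z)
    have "(\<integral>x. w x * (norm ((2 * \<theta> x) *\<^sub>R \<theta>' x))\<^sup>2 \<partial>lborel)
       \<le> (\<integral>x. (1/2) * ((w x)\<^sup>2 * (\<theta> x)^4) + 8 * (norm (\<theta>' x))^4 \<partial>lborel)"
    proof (rule integral_mono)
      fix x
      \<comment> \<open>Young's inequality for w \<theta>^2 and 4 |\<theta>'|^2, weighted so that
        exactly half of the left-hand integrand appears.\<close>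
      have "0 \<le> (w x * (\<theta> x)\<^sup>2 - 4 * (norm (\<theta>' x))\<^sup>2)\<^sup>2 / 2" by simp
      then show "w x * (norm ((2 * \<theta> x) *\<^sub>R \<theta>' x))\<^sup>2 \<le> (1/2) * ((w x)\<^sup>2 * (\<theta> x)^4) + 8 * (norm (\<theta>' x))^4"
        by (simp add: power_mult_distrib power2_diff power2_eq_square power4_eq_xxxx field_simps)
    qed (use i1 bi in auto)
    also have "\<dots> = (1/2) * (\<integral>x. (w x)\<^sup>2 * (\<theta> x)^4 \<partial>lborel) + 8 * (\<integral>x. (norm (\<theta>' x))^4 \<partial>lborel)"
      using i1 by simp
    finally have "(\<integral>x. (w x)\<^sup>2 * (\<theta> x)^4 \<partial>lborel) \<le> 16 * (\<integral>x. (norm (\<theta>' x))^4 \<partial>lborel)"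
      using st by (simp flip: power_mult)
    also have "(\<integral>x. (norm (\<theta>' x))^4 \<partial>lborel) \<le> K"
    proof -
      have "(\<integral>x. (norm (\<theta>' x))^4 \<partial>lborel)
        \<le> (\<integral>x. 8 * ((4 / R)^4 * indicator (cball 0 R) x + (16 / \<rho>)^4 * indicator (cball 0 \<rho>) x) \<partial>(lborel :: (real^3) measure))"
      proof (rule integral_mono)
        show "integrable lborel (\<lambda>x::real^3. 8 * ((4 / R)^4 * indicator (cball 0 R) x + (16 / \<rho>)^4 * indicator (cball 0 \<rho>) x))"
          by (intro Bochner_Integration.integrable_add integrable_mult_right integrable_indicator_cball)
        fix x
        have "norm (\<theta>' x) \<le> norm (ball_cutoff_grad R x) + norm (outer_cutoff_grad \<rho> x)"
        proof -
          have "norm (\<theta>' x) \<le> norm (outer_cutoff \<rho> x *\<^sub>R ball_cutoff_grad R x) + norm (ball_cutoff R x *\<^sub>R outer_cutoff_grad \<rho> x)"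
            unfolding \<theta>'_def by (rule norm_triangle_ineq)
          also have "\<dots> \<le> 1 * norm (ball_cutoff_grad R x) + 1 * norm (outer_cutoff_grad \<rho> x)"
            unfolding norm_scaleR
            using ball_cutoff_bounds[of R x] outer_cutoff_bounds[of \<rho> x] by (intro add_mono mult_right_mono) auto
          finally show ?thesis by simp
        qed
        also have "\<dots> \<le> 4 / R * indicator (cball 0 R) x + 16 / \<rho> * indicator (cball 0 \<rho>) x"
          by (intro add_mono norm_ball_cutoff_grad_le norm_outer_cutoff_grad_le R' \<rho>)
        finally have "(norm (\<theta>' x))^4 \<le> (4 / R * indicator (cball 0 R) x + 16 / \<rho> * indicator (cball 0 \<rho>) x)^4"
          by (intro power_mono) auto
        also have "\<dots> \<le> 8 * ((4 / R * indicator (cball 0 R) x)^4 + (16 / \<rho> * indicator (cball 0 \<rho>) x)^4)"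
          by (rule power4_sum_le)
        finally show "(norm (\<theta>' x))^4 \<le> 8 * ((4 / R)^4 * indicator (cball 0 R) x + (16 / \<rho>)^4 * indicator (cball 0 \<rho>) x)"
          by (auto simp: indicator_def split: if_splits)
      qed (rule i1)
      also have "\<dots> = 8 * ((4 / R)^4 * (?vol * R^3) + (16 / \<rho>)^4 * (?vol * \<rho>^3))"
        using R' \<rho> integral_indicator_cball[of R] integral_indicator_cball[of \<rho>] integrable_indicator_cball[of "0::real^3"]
        by simp
      \<comment> \<open>R^(-4) from the gradient against the volume R^3 leaves 1/R: this is where
        the dimension keeps the bound uniform in \<open>R\<close>.\<close>
      also have "(4 / R)^4 * (?vol * R^3) \<le> 4 ^ 4 * ?vol"
      proof -
        have "(4 / R)^4 * (?vol * R^3) = (4 ^ 4 * ?vol) / R"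
          using R' by (simp add: power_divide power4_eq_xxxx power3_eq_cube field_simps)
        also have "\<dots> \<le> (4 ^ 4 * ?vol) / 1"
          using R vol by (intro divide_left_mono) auto
        finally show ?thesis by simp
      qed
      finally show ?thesis by (simp add: K_def)
    qed
    finally have q: "(\<integral>x. (w x)\<^sup>2 * (\<theta> x)^4 \<partial>lborel) \<le> 16 * K" by simp
    have iw: "integrable lborel (\<lambda>x. indicator (cball 0 r) x * (w x)\<^sup>2)" for r
      by (rule bounded_borel_integrable[where R=r]) (intro bb, auto)
    have "(\<integral>x. indicator (cball 0 (R / 2)) x * (w x)\<^sup>2 \<partial>lborel)
      \<le> (\<integral>x. 16 * ((w x)\<^sup>2 * (\<theta> x)^4) + indicator (cball 0 \<rho>) x * (w x)\<^sup>2 \<partial>lborel)"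
    proof (rule integral_mono)
      fix x
      show "indicator (cball 0 (R / 2)) x * (w x)\<^sup>2 \<le> 16 * ((w x)\<^sup>2 * (\<theta> x)^4) + indicator (cball 0 \<rho>) x * (w x)\<^sup>2"
      proof (cases "norm x \<le> R / 2 \<and> \<rho> < norm x")
        case True
        then have "9/16 \<le> \<theta> x"
          using ball_cutoff_ge[OF R', of x] outer_cutoff_outside[OF \<rho>, of x] by (simp add: \<theta>_def)
        then have "(9/16)^4 \<le> (\<theta> x)^4" by (intro power_mono) auto
        then have "1 \<le> 16 * (\<theta> x)^4" by (simp add: power4_eq_xxxx)
        then have "(w x)\<^sup>2 * 1 \<le> (w x)\<^sup>2 * (16 * (\<theta> x)^4)" by (intro mult_left_mono) auto
        then show ?thesis using True by simp
      next
        case False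
        then have "indicator (cball 0 (R / 2)) x * (w x)\<^sup>2 \<le> indicator (cball 0 \<rho>) x * (w x)\<^sup>2"
          by (auto simp: indicator_def)
        moreover have "0 \<le> 16 * ((w x)\<^sup>2 * (\<theta> x)^4)" by simp
        ultimately show ?thesis by linarith
      qed
    qed (use i1 iw in auto)
    also have "\<dots> = 16 * (\<integral>x. (w x)\<^sup>2 * (\<theta> x)^4 \<partial>lborel) + (\<integral>x. indicator (cball 0 \<rho>) x * (w x)\<^sup>2 \<partial>lborel)"
      using i1 iw by simp
    also have "\<dots> \<le> L" using q by (simp add: L_def)
    finally show ?thesis .
  qed
  have "integrable lborel (\<lambda>x. (w x)\<^sup>2)"
  proof (rule integral_Fatou_bound(1)[where F="\<lambda>n x. indicator (cball 0 (real (Suc n) / 2)) x * (w x)\<^sup>2" and K="\<lambda>_. L" and k=L])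
    show "integrable lborel (\<lambda>x. indicator (cball 0 (real (Suc n) / 2)) x * (w x)\<^sup>2)" for n
      by (rule bounded_borel_integrable[where R="real (Suc n) / 2"]) (intro bounded_borel_intros bw, auto)
    show "(\<lambda>x. (w x)\<^sup>2) \<in> borel_measurable lborel"
      using bounded_borel_measurable[OF bounded_borel_power[OF bw, of 2]] by simp
    show "(\<lambda>n. indicator (cball 0 (real (Suc n) / 2)) x * (w x)\<^sup>2) \<longlonglongrightarrow> (w x)\<^sup>2" for x
    proof (rule tendsto_eventually)
      obtain N where N: "2 * norm x \<le> real N" using real_arch_simple by blast
      show "\<forall>\<^sub>F n in sequentially. indicator (cball 0 (real (Suc n) / 2)) x * (w x)\<^sup>2 = (w x)\<^sup>2"
        unfolding eventually_sequentially by (intro exI[of _ N]) (use N in auto)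
    qed
    show "(\<integral>x. indicator (cball 0 (real (Suc n) / 2)) x * (w x)\<^sup>2 \<partial>lborel) \<le> L" for n
      by (rule main) simp
  qed auto
  then show ?thesis by (simp add: w_def)
qed

text \<open>Integrate \<open>(t * u^2 - 1)^2 \<ge> 0\<close> over the ball. The free weight matters:
  of order R^(3/2) it makes the local L2 mass o(R^2), and of order R it gives the bound
  O(R^2).\<close>

lemma local_square_le_quartic:
  fixes u :: "real^3 \<Rightarrow> real"
  assumes b: "bounded_borel u" and u4: "integrable lborel (\<lambda>x. (u x)^4)" and R: "0 < R" and t: "0 < t"
  shows "(\<integral>x. indicator (cball 0 R) x * (u x)\<^sup>2 \<partial>lborel)
    \<le> t * (\<integral>x. (u x)^4 \<partial>lborel) + unit_ball_vol 3 * R ^ 3 / t"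
proof -
  have i: "integrable lborel (\<lambda>x. indicator (cball 0 R) x * (u x)\<^sup>2)"
    by (rule bounded_borel_integrable[where R=R]) (intro bounded_borel_intros b, auto)
  have "(\<integral>x. indicator (cball 0 R) x * (u x)\<^sup>2 \<partial>lborel)
      \<le> (\<integral>x. t * (u x)^4 + indicator (cball 0 R) x * (1 / t) \<partial>lborel)"
  proof (rule integral_mono[OF i])
    show "integrable lborel (\<lambda>x. t * (u x)^4 + indicator (cball 0 R) x * (1 / t))"
      by (intro Bochner_Integration.integrable_add integrable_mult_right u4 integrable_mult_left integrable_indicator_cball)
    fix x
    have "0 \<le> (t * (u x)\<^sup>2 - 1)\<^sup>2" "0 \<le> t * (u x)\<^sup>2" "0 \<le> t * (u x)^4" using t by auto
    then have "t * (u x)\<^sup>2 \<le> t * (t * (u x)^4) + 1"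
      by (simp add: power2_diff power_mult_distrib power2_eq_square power4_eq_xxxx algebra_simps)
    then have "t * (u x)\<^sup>2 \<le> t * (t * (u x)^4 + 1 / t)" using t by (simp add: distrib_left)
    then have "(u x)\<^sup>2 \<le> t * (u x)^4 + 1 / t" using t by simp
    then show "indicator (cball 0 R) x * (u x)\<^sup>2 \<le> t * (u x)^4 + indicator (cball 0 R) x * (1 / t)"
      using \<open>0 \<le> t * (u x)^4\<close> by (auto simp: indicator_def)
  qed
  also have "\<dots> = t * (\<integral>x. (u x)^4 \<partial>lborel) + unit_ball_vol 3 * R ^ 3 / t"
    using u4 integral_indicator_cball[of R] R integrable_indicator_cball[of "0::real^3"] by simp
  finally show ?thesis .
qed

text \<open>The energy identity with growing cutoffs. The error, 1/R^2 times the local L2 mass of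
  \<open>u\<close>, tends to 0 because \<open>u\<close> is in L^4. The factor 2 comes from
  separating \<open>\<eta> * g\<close> from \<open>u * \<eta>'\<close>; it costs nothing later, when
  the right side is shown to be nonpositive.\<close>

lemma neumann_weak_gradient_integrable:
  assumes w: "neumann_weak C u g F G b"
    and u4: "integrable lborel (\<lambda>x. (u x)^4)"
    and bu: "integrable lborel (\<lambda>x. b x * u x)" "\<And>x. 0 \<le> b x * u x"
  shows "integrable lborel (\<lambda>x. (norm (g x))\<^sup>2)"
    "(\<integral>x. (norm (g x))\<^sup>2 \<partial>lborel) \<le> 2 * (\<integral>x. b x * u x \<partial>lborel)"
proof -
  have F: "C1_approx C u g F G" using w by (simp add: neumann_weak_def)
  note [measurable] = C1_approxD(1,2)[OF F]
  note bdu = bounded_borel_C1_approx[OF F]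
  define A where "A = (\<integral>x. (u x)^4 \<partial>lborel) + unit_ball_vol 3"
  define B where "B = (\<integral>x. b x * u x \<partial>lborel)"
  let ?\<eta> = "\<lambda>n. ball_cutoff (real (Suc n))" and ?\<eta>' = "\<lambda>n. ball_cutoff_grad (real (Suc n))"
  have est: "(\<integral>x. (norm (?\<eta> n x *\<^sub>R g x))\<^sup>2 \<partial>lborel) \<le> 2 * B + 64 * A * (1 / sqrt (real (Suc n)))" for n
  proof -
    let ?R = "real (Suc n)"
    have R: "0 < ?R" "1 \<le> ?R" by auto
    note c = cutoff_ball_cutoff[OF R(1)]
    note sq = cutoff_scaleR_square_integrable[OF c F]
    note m [measurable] = cutoff_measurable[OF c]
    have i: "integrable lborel (\<lambda>x. (norm (?\<eta> n x *\<^sub>R g x))\<^sup>2)"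
      "integrable lborel (\<lambda>x. (norm (?\<eta> n x *\<^sub>R g x + u x *\<^sub>R ?\<eta>' n x))\<^sup>2)"
      "integrable lborel (\<lambda>x. (norm (u x *\<^sub>R ?\<eta>' n x))\<^sup>2)"
      by (rule square_integrable_integrable; intro square_integrable_add sq)+
    have "(\<integral>x. (norm (?\<eta> n x *\<^sub>R g x))\<^sup>2 \<partial>lborel)
      \<le> (\<integral>x. 2 * (norm (?\<eta> n x *\<^sub>R g x + u x *\<^sub>R ?\<eta>' n x))\<^sup>2 + 2 * (norm (u x *\<^sub>R ?\<eta>' n x))\<^sup>2 \<partial>lborel)"
    proof (rule integral_mono)
      show "(norm (?\<eta> n x *\<^sub>R g x))\<^sup>2 \<le> 2 * (norm (?\<eta> n x *\<^sub>R g x + u x *\<^sub>R ?\<eta>' n x))\<^sup>2 + 2 * (norm (u x *\<^sub>R ?\<eta>' n x))\<^sup>2" for x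
        using norm_diff_squared_le[of "?\<eta> n x *\<^sub>R g x + u x *\<^sub>R ?\<eta>' n x" "u x *\<^sub>R ?\<eta>' n x"] by simp
    qed (use i in auto)
    also have "\<dots> = 2 * (\<integral>x. (norm (?\<eta> n x *\<^sub>R g x + u x *\<^sub>R ?\<eta>' n x))\<^sup>2 \<partial>lborel)
        + 2 * (\<integral>x. (norm (u x *\<^sub>R ?\<eta>' n x))\<^sup>2 \<partial>lborel)"
      using i by (simp only: Bochner_Integration.integral_add integrable_mult_right integral_mult_right_zero)
    also have "\<dots> = 2 * (\<integral>x. b x * u x * (?\<eta> n x)\<^sup>2 \<partial>lborel) + 4 * (\<integral>x. (u x)\<^sup>2 * (norm (?\<eta>' n x))\<^sup>2 \<partial>lborel)"
      unfolding neumann_weak_energy[OF w c] by (simp add: power_mult_distrib)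
    also have "\<dots> \<le> 2 * B + 4 * (16 * A / sqrt ?R)"
    proof (intro add_mono mult_left_mono)
      show "(\<integral>x. b x * u x * (?\<eta> n x)\<^sup>2 \<partial>lborel) \<le> B"
        unfolding B_def
      proof (rule integral_mono[OF _ bu(1)])
        have le: "b x * u x * (?\<eta> n x)\<^sup>2 \<le> b x * u x" for x
        proof -
          have "(?\<eta> n x)\<^sup>2 \<le> 1\<^sup>2" using ball_cutoff_bounds[of ?R x] by (intro power_mono) auto
          then show ?thesis using bu(2)[of x] by (intro mult_left_le) auto
        qed
        then show "b x * u x * (?\<eta> n x)\<^sup>2 \<le> b x * u x" for x .
        have [measurable]: "b \<in> borel_measurable borel" using w by (simp add: neumann_weak_def bounded_borel_def)
        show "integrable lborel (\<lambda>x. b x * u x * (?\<eta> n x)\<^sup>2)"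
          by (rule Bochner_Integration.integrable_bound[OF bu(1)]) (use le bu(2) in \<open>auto simp: abs_of_nonneg\<close>)
      qed
      have "(\<integral>x. (u x)\<^sup>2 * (norm (?\<eta>' n x))\<^sup>2 \<partial>lborel)
          \<le> (\<integral>x. (16 / ?R\<^sup>2) * (indicator (cball 0 ?R) x * (u x)\<^sup>2) \<partial>lborel)"
      proof (rule integral_mono)
        show "integrable lborel (\<lambda>x. (u x)\<^sup>2 * (norm (?\<eta>' n x))\<^sup>2)"
          using i(3) by (simp add: power_mult_distrib)
        have "integrable lborel (\<lambda>x. indicator (cball 0 ?R) x * (u x)\<^sup>2)"
          by (rule bounded_borel_integrable[where R="?R"]) (intro bounded_borel_intros bdu, auto)
        then show "integrable lborel (\<lambda>x. (16 / ?R\<^sup>2) * (indicator (cball 0 ?R) x * (u x)\<^sup>2))"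
          by (rule integrable_mult_right)
        fix x
        have "(norm (?\<eta>' n x))\<^sup>2 \<le> (4 / ?R * indicator (cball 0 ?R) x)\<^sup>2"
          by (intro power_mono norm_ball_cutoff_grad_le R) auto
        also have "\<dots> = (16 / ?R\<^sup>2) * indicator (cball 0 ?R) x"
          by (auto simp: indicator_def power_divide)
        finally have "(u x)\<^sup>2 * (norm (?\<eta>' n x))\<^sup>2 \<le> (u x)\<^sup>2 * ((16 / ?R\<^sup>2) * indicator (cball 0 ?R) x)"
          by (rule mult_left_mono) simp
        then show "(u x)\<^sup>2 * (norm (?\<eta>' n x))\<^sup>2 \<le> (16 / ?R\<^sup>2) * (indicator (cball 0 ?R) x * (u x)\<^sup>2)"
          by (simp add: ac_simps)
      qed
      also have "\<dots> = (16 / ?R\<^sup>2) * (\<integral>x. indicator (cball 0 ?R) x * (u x)\<^sup>2 \<partial>lborel)" by simp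
      \<comment> \<open>The weight R^(3/2) balances the two terms, both of order R^(3/2), so that
        division by R^2 leaves R^(-1/2).\<close>
      also have "\<dots> \<le> (16 / ?R\<^sup>2) * ((?R * sqrt ?R) * (\<integral>x. (u x)^4 \<partial>lborel) + unit_ball_vol 3 * ?R ^ 3 / (?R * sqrt ?R))"
        using R by (intro mult_left_mono local_square_le_quartic[OF bdu u4]) auto
      also have "\<dots> = 16 * A / sqrt ?R"
      proof -
        define s where "s = sqrt ?R"
        have s: "0 < s" "?R = s\<^sup>2" using R by (auto simp: s_def)
        show ?thesis unfolding A_def s_def[symmetric] unfolding s(2)
          using s(1) by (simp add: field_simps power2_eq_square power3_eq_cube)
      qed
      finally show "(\<integral>x. (u x)\<^sup>2 * (norm (?\<eta>' n x))\<^sup>2 \<partial>lborel) \<le> 16 * A / sqrt ?R" .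
    qed auto
    finally show ?thesis by simp
  qed
  have lim: "(\<lambda>n. 2 * B + 64 * A * (1 / sqrt (real (Suc n)))) \<longlonglongrightarrow> 2 * B + 64 * A * sqrt 0"
  proof (intro tendsto_intros)
    have "(\<lambda>n. sqrt (1 / real (Suc n))) \<longlonglongrightarrow> sqrt 0"
      by (intro tendsto_real_sqrt LIMSEQ_Suc[OF lim_1_over_n])
    then show "(\<lambda>n. 1 / sqrt (real (Suc n))) \<longlonglongrightarrow> sqrt 0" by (simp add: real_sqrt_divide)
  qed
  have 1: "integrable lborel (\<lambda>x. (norm (?\<eta> n x *\<^sub>R g x))\<^sup>2)" for n
    by (rule square_integrable_integrable, rule cutoff_scaleR_square_integrable(1)[OF cutoff_ball_cutoff F]) simp
  have 2: "(\<lambda>n. (norm (?\<eta> n x *\<^sub>R g x))\<^sup>2) \<longlonglongrightarrow> (norm (g x))\<^sup>2" for x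
  proof -
    have "(\<lambda>n. (norm (?\<eta> n x *\<^sub>R g x))\<^sup>2) \<longlonglongrightarrow> (norm (1 *\<^sub>R g x))\<^sup>2"
      by (intro tendsto_intros ball_cutoff_tendsto)
    then show ?thesis by simp
  qed
  have 3: "(\<lambda>x. (norm (g x))\<^sup>2) \<in> borel_measurable lborel" by simp
  note Fa = integral_Fatou_bound[OF 1 _ 3 2 est lim]
  show "integrable lborel (\<lambda>x. (norm (g x))\<^sup>2)" by (rule Fa(1)) simp
  show "(\<integral>x. (norm (g x))\<^sup>2 \<partial>lborel) \<le> 2 * (\<integral>x. b x * u x \<partial>lborel)"
    using Fa(2) by (simp add: B_def)
qed

section \<open>The Pohozaev argument by dilations\<close>

text \<open>When the equation for \<open>u\<close> is tested with the cutoff times u(c x), this is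
  the right-hand side. \<open>dilation_flux\<close> is the part of the left-hand side in which the
  derivative falls on the cutoff.\<close>

definition dilation_source :: "(real^3 \<Rightarrow> real) \<Rightarrow> (real^3 \<Rightarrow> real) \<Rightarrow> real \<Rightarrow> real \<Rightarrow> real"
  where "dilation_source b u R c = (\<integral>x. b x * (ball_cutoff R x * u (c *\<^sub>R x)) \<partial>lborel)"

definition dilation_flux :: "(real^3 \<Rightarrow> real^3) \<Rightarrow> (real^3 \<Rightarrow> real) \<Rightarrow> real \<Rightarrow> real \<Rightarrow> real"
  where "dilation_flux g u R c = (\<integral>x. (g x \<bullet> ball_cutoff_grad R x) * u (c *\<^sub>R x) \<partial>lborel)"

lemma ball_cutoff_scaleR: "0 < c \<Longrightarrow> ball_cutoff (c * R) (c *\<^sub>R x) = ball_cutoff R x"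
  by (simp add: ball_cutoff_def)

text \<open>
  Testing with the dilates of \<open>u\<close> by \<open>c\<close> and by \<open>1 / c\<close>, the two Dirichlet terms are scalings of each
  other and cancel; this replaces the test function \<open>x \<bullet> \<nabla>u\<close> and needs no second derivatives.
\<close>

lemma dilation_identity:
  assumes w: "neumann_weak C u g F G b" and R: "0 < R" and c: "0 < c"
  shows "c * (dilation_source b u R c - dilation_flux g u R c)
    = dilation_source b u (c * R) (1 / c) - dilation_flux g u (c * R) (1 / c)"
proof -
  have F: "C1_approx C u g F G" using w by (simp add: neumann_weak_def)
  note [measurable] = C1_approxD(1,2)[OF F]
  \<comment> \<open>The Dirichlet term that both weak formulations have in common.\<close>
  define P where "P R c = (\<integral>x. ball_cutoff R x * (c * (g x \<bullet> g (c *\<^sub>R x))) \<partial>lborel)" for R c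
  have split: "P R c = dilation_source b u R c - dilation_flux g u R c" if R: "0 < R" and c: "0 < c" for R c
  proof -
    note D = C1_approx_dilation[OF F c]
    note \<eta> = cutoff_ball_cutoff[OF R]
    note sq = cutoff_scaleR_square_integrable[OF \<eta> D]
    have z: "ball_cutoff R x = 0" "ball_cutoff_grad R x = 0" if "x \<notin> cball 0 R" for x
      using \<eta> that by (auto simp: cutoff_def)
    have "integrable lborel (\<lambda>x. (indicator (cball 0 R) x *\<^sub>R g x) \<bullet> (ball_cutoff R x *\<^sub>R (c *\<^sub>R g (c *\<^sub>R x))))"
      by (intro square_integrable_inner C1_approx_square_integrable(2)[OF F] sq)
    moreover have "(indicator (cball 0 R) x *\<^sub>R g x) \<bullet> (ball_cutoff R x *\<^sub>R (c *\<^sub>R g (c *\<^sub>R x)))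
        = ball_cutoff R x * (c * (g x \<bullet> g (c *\<^sub>R x)))" for x
      using z[of x] by (cases "x \<in> cball 0 R") auto
    ultimately have i1: "integrable lborel (\<lambda>x. ball_cutoff R x * (c * (g x \<bullet> g (c *\<^sub>R x))))" by (simp only:)
    have "integrable lborel (\<lambda>x. (indicator (cball 0 R) x *\<^sub>R g x) \<bullet> (u (c *\<^sub>R x) *\<^sub>R ball_cutoff_grad R x))"
      by (intro square_integrable_inner C1_approx_square_integrable(2)[OF F] sq)
    moreover have "(indicator (cball 0 R) x *\<^sub>R g x) \<bullet> (u (c *\<^sub>R x) *\<^sub>R ball_cutoff_grad R x)
        = (g x \<bullet> ball_cutoff_grad R x) * u (c *\<^sub>R x)" for x
      using z[of x] by (cases "x \<in> cball 0 R") auto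
    ultimately have i2: "integrable lborel (\<lambda>x. (g x \<bullet> ball_cutoff_grad R x) * u (c *\<^sub>R x))" by (simp only:)
    have "dilation_source b u R c
      = (\<integral>x. g x \<bullet> (ball_cutoff R x *\<^sub>R (c *\<^sub>R g (c *\<^sub>R x)) + u (c *\<^sub>R x) *\<^sub>R ball_cutoff_grad R x) \<partial>lborel)"
      unfolding dilation_source_def by (rule neumann_weak_test[OF w \<eta> D, symmetric])
    also have "\<dots> = (\<integral>x. ball_cutoff R x * (c * (g x \<bullet> g (c *\<^sub>R x)))
        + (g x \<bullet> ball_cutoff_grad R x) * u (c *\<^sub>R x) \<partial>lborel)"
      by (rule Bochner_Integration.integral_cong) (auto simp: inner_add_right)
    also have "\<dots> = P R c + dilation_flux g u R c"
      unfolding P_def dilation_flux_def by (rule Bochner_Integration.integral_add[OF i1 i2])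
    finally show ?thesis by simp
  qed
  \<comment> \<open>Substituting c x exchanges the two gradients. The radius \<open>c * R\<close>
    was chosen so that the cutoff returns to radius \<open>R\<close>; the Jacobian c^3 against the
    factor 1/c^2 leaves \<open>c\<close>.\<close>
  have "P (c * R) (1 / c)
    = c ^ 3 * (\<integral>x. ball_cutoff (c * R) (c *\<^sub>R x) * ((1 / c) * (g (c *\<^sub>R x) \<bullet> g ((1 / c) *\<^sub>R (c *\<^sub>R x)))) \<partial>lborel)"
    unfolding P_def
    using lborel_integral_affine[of "\<lambda>x. ball_cutoff (c * R) x * ((1 / c) * (g x \<bullet> g ((1 / c) *\<^sub>R x)))" c 0] c
    by simp
  also have "(\<integral>x. ball_cutoff (c * R) (c *\<^sub>R x) * ((1 / c) * (g (c *\<^sub>R x) \<bullet> g ((1 / c) *\<^sub>R (c *\<^sub>R x)))) \<partial>lborel)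
    = (\<integral>x. (1 / c\<^sup>2) * (ball_cutoff R x * (c * (g x \<bullet> g (c *\<^sub>R x)))) \<partial>lborel)"
    by (rule Bochner_Integration.integral_cong)
      (use c in \<open>auto simp: ball_cutoff_scaleR inner_commute power2_eq_square\<close>)
  also have "\<dots> = (1 / c\<^sup>2) * P R c" unfolding P_def by (rule integral_mult_right_zero)
  finally have "P (c * R) (1 / c) = c * P R c"
    using c by (simp add: power2_eq_square power3_eq_cube)
  then show ?thesis using split[OF R c] split[of "c * R" "1 / c"] R c by simp
qed

section \<open>Flux terms of order t\<close>

lemma dilated_profile_bound:
  fixes t s :: real
  assumes t: "0 < t" "t \<le> 1" and s: "0 \<le> s" "s \<le> 4"
  shows "\<bar>(1 + t) * max 0 (1 - s) - 1 / (1 + t)\<^sup>2 * max 0 (1 - s * (1 / (1 + t)\<^sup>2))\<bar> \<le> 11 * t"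
proof -
  \<comment> \<open>\<open>d\<close> is the squared ratio of the radii \<open>R\<close> and
    \<open>(1 + t) * R\<close>, and \<open>1 - d \<le> 2 * t\<close>. The profiles are joined in
    three moves: dropping the factor \<open>1 + t\<close> costs \<open>t\<close>, rescaling
    \<open>s \<le> 4\<close> by \<open>d\<close> costs \<open>4 * (2 * t)\<close>, and inserting the
    factor \<open>d\<close> costs \<open>2 * t\<close>.\<close>
  define d where "d = 1 / (1 + t)\<^sup>2"
  have sq: "1 \<le> (1 + t)\<^sup>2" using t by (intro one_le_power) auto
  then have pos: "0 < (1 + t)\<^sup>2" by linarith
  then have d: "0 \<le> d" "d \<le> 1" using sq by (auto simp: d_def divide_le_eq)
  have "(1 - 2 * t) * (1 + t)\<^sup>2 = 1 - 3 * t\<^sup>2 - 2 * t ^ 3"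
    by (simp add: power2_eq_square power3_eq_cube algebra_simps)
  also have "\<dots> \<le> 1" using t zero_le_power2[of t] zero_le_power[of t 3] by linarith
  finally have "1 - 2 * t \<le> d" using pos by (simp add: d_def le_divide_eq)
  then have d2: "1 - d \<le> 2 * t" by simp
  have 1: "\<bar>(1 + t) * max 0 (1 - s) - max 0 (1 - s)\<bar> \<le> t"
  proof -
    have "(1 + t) * max 0 (1 - s) - max 0 (1 - s) = t * max 0 (1 - s)" by (simp add: algebra_simps)
    moreover have "t * max 0 (1 - s) \<le> t * 1" using t s by (intro mult_left_mono) auto
    ultimately show ?thesis using t by simp
  qed
  have "s * (1 - d) \<le> 4 * (2 * t)" using s d d2 t by (intro mult_mono) auto
  moreover have "0 \<le> s * (1 - d)" using s d by simp
  ultimately have 2: "\<bar>max 0 (1 - s) - max 0 (1 - s * d)\<bar> \<le> 8 * t" by (auto simp: algebra_simps max_def)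
  have 3: "\<bar>max 0 (1 - s * d) - d * max 0 (1 - s * d)\<bar> \<le> 2 * t"
  proof -
    have "max 0 (1 - s * d) - d * max 0 (1 - s * d) = (1 - d) * max 0 (1 - s * d)" by (simp add: algebra_simps)
    moreover have "(1 - d) * max 0 (1 - s * d) \<le> (2 * t) * 1" using d d2 s t by (intro mult_mono) auto
    moreover have "0 \<le> (1 - d) * max 0 (1 - s * d)" using d by simp
    ultimately show ?thesis by simp
  qed
  have tri: "\<bar>w - z\<bar> \<le> \<bar>w - x\<bar> + \<bar>x - y\<bar> + \<bar>y - z\<bar>" for w x y z :: real by linarith
  have "t + 8 * t + 2 * t = 11 * t" by simp
  with order_trans[OF tri add_mono[OF add_mono[OF 1 2] 3]]
  show ?thesis unfolding d_def[symmetric] by (simp only:)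
qed

lemma ball_cutoff_grad_eq:
  "0 < R \<Longrightarrow> ball_cutoff_grad R x = - (4 / R\<^sup>2 * max 0 (1 - (norm x)\<^sup>2 / R\<^sup>2)) *\<^sub>R x"
  by (simp add: ball_cutoff_grad_def bump_grad_def power_divide power2_eq_square)

lemma norm_ball_cutoff_grad_le_linear:
  assumes "0 < R" "R \<le> S"
  shows "norm (ball_cutoff_grad R x) \<le> 4 / R\<^sup>2 * (indicator (cball 0 S) x * norm x)"
proof (cases "x \<in> cball 0 S")
  case True
  have "4 / R\<^sup>2 * max 0 (1 - (norm x)\<^sup>2 / R\<^sup>2) * norm x \<le> 4 / R\<^sup>2 * 1 * norm x"
    by (intro mult_right_mono mult_left_mono) auto
  then show ?thesis using True assms by (simp add: ball_cutoff_grad_eq abs_mult)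
next
  case False
  then show ?thesis using cutoff_ball_cutoff[OF assms(1)] assms(2) by (simp add: cutoff_def)
qed

text \<open>The flux difference will be divided by \<open>t\<close>, so the two cutoff gradients
  must cancel to first order. Both are radial multiples of \<open>x\<close>; the constant 44 is 4
  times the 11 of the profile bound.\<close>

lemma dilated_cutoff_grad_bound:
  assumes R: "0 < R" and t: "0 < t" "t \<le> 1"
  shows "norm ((1 + t) *\<^sub>R ball_cutoff_grad R x - ball_cutoff_grad ((1 + t) * R) x)
    \<le> 44 * t / R\<^sup>2 * (indicator (cball 0 (2 * R)) x * norm x)"
proof (cases "x \<in> cball 0 (2 * R)")
  case True
  define s where "s = (norm x)\<^sup>2 / R\<^sup>2"
  have "(norm x)\<^sup>2 \<le> (2 * R)\<^sup>2" using True by (intro power_mono) auto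
  then have s: "0 \<le> s" "s \<le> 4" using R by (auto simp: s_def field_simps power_mult_distrib)
  let ?k = "(1 + t) * max 0 (1 - s) - 1 / (1 + t)\<^sup>2 * max 0 (1 - s * (1 / (1 + t)\<^sup>2))"
  have "ball_cutoff_grad R x = - (4 / R\<^sup>2 * max 0 (1 - s)) *\<^sub>R x"
    using R by (simp add: ball_cutoff_grad_eq s_def)
  moreover have "ball_cutoff_grad ((1 + t) * R) x
      = - (4 / R\<^sup>2 * (1 / (1 + t)\<^sup>2 * max 0 (1 - s * (1 / (1 + t)\<^sup>2)))) *\<^sub>R x"
    using R t by (subst ball_cutoff_grad_eq) (auto simp: s_def power_mult_distrib mult.commute)
  ultimately have "(1 + t) *\<^sub>R ball_cutoff_grad R x - ball_cutoff_grad ((1 + t) * R) x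
     = - (4 / R\<^sup>2 * ?k) *\<^sub>R x"
  proof -
    assume eqs: "ball_cutoff_grad R x = - (4 / R\<^sup>2 * max 0 (1 - s)) *\<^sub>R x"
      "ball_cutoff_grad ((1 + t) * R) x
        = - (4 / R\<^sup>2 * (1 / (1 + t)\<^sup>2 * max 0 (1 - s * (1 / (1 + t)\<^sup>2)))) *\<^sub>R x"
    have k: "4 / R\<^sup>2 * ?k = (1 + t) * (4 / R\<^sup>2 * max 0 (1 - s))
        - 4 / R\<^sup>2 * (1 / (1 + t)\<^sup>2 * max 0 (1 - s * (1 / (1 + t)\<^sup>2)))"
      by (simp only: right_diff_distrib mult.left_commute)
    show ?thesis
      unfolding k unfolding eqs by (simp only: scaleR_scaleR mult_minus_right scaleR_diff_left scaleR_minus_left) simp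
  qed
  then have "norm ((1 + t) *\<^sub>R ball_cutoff_grad R x - ball_cutoff_grad ((1 + t) * R) x)
     = 4 / R\<^sup>2 * \<bar>?k\<bar> * norm x"
    by (simp only: norm_scaleR abs_minus_cancel abs_mult) (simp add: abs_mult)
  also have "\<dots> \<le> 4 / R\<^sup>2 * (11 * t) * norm x"
    by (intro mult_right_mono mult_left_mono dilated_profile_bound t s) auto
  finally show ?thesis using True by simp
next
  case False
  then have far: "2 * R < norm x" by simp
  have "(1 + t) * R \<le> 2 * R" using t R by (intro mult_right_mono) auto
  then have "(1 + t) * R \<le> norm x" "R \<le> norm x" using far R by linarith+
  then have "ball_cutoff_grad R x = 0" "ball_cutoff_grad ((1 + t) * R) x = 0"
    using far R t cutoff_ball_cutoff[of R] cutoff_ball_cutoff[of "(1 + t) * R"] by (auto simp: cutoff_def)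
  then show ?thesis using t by simp
qed

definition radial_moment :: "(real^3 \<Rightarrow> real^3) \<Rightarrow> real \<Rightarrow> real"
  where "radial_moment g R = sqrt (\<integral>x. (indicator (cball 0 (2 * R)) x * (norm x * norm (g x)))\<^sup>2 \<partial>lborel)"

text \<open>Arranged as a factor meant to vanish as \<open>R\<close> grows times one meant to stay
  bounded. The constant 72 is 12 * 6: the increments of \<open>u\<close> under the two dilations
  carry the weights 8 and 4, and 6 exceeds sqrt 32 from the dilation estimate. The 44 comes from the
  difference of the cutoff gradients.\<close>

definition flux_bound :: "(real^3 \<Rightarrow> real) \<Rightarrow> (real^3 \<Rightarrow> real^3) \<Rightarrow> real \<Rightarrow> real"
  where "flux_bound u g R = radial_moment g R / R *
    (72 * sqrt (\<integral>x. (norm (g x))\<^sup>2 \<partial>lborel) + 44 * (sqrt (\<integral>x. indicator (cball 0 (2 * R)) x * (u x)\<^sup>2 \<partial>lborel) / R))"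

lemma C1_approx_dilation_estimate_global:
  assumes F: "C1_approx C f g F G" and g: "integrable lborel (\<lambda>x. (norm (g x))\<^sup>2)"
    and c: "1/2 \<le> c" "c \<le> 2" "\<bar>c - 1\<bar> \<le> t" and R: "0 \<le> R"
  shows "(\<integral>x. (indicator (cball 0 (2 * R)) x * (f (c *\<^sub>R x) - f x))\<^sup>2 \<partial>lborel)
    \<le> 32 * R\<^sup>2 * t\<^sup>2 * (\<integral>x. (norm (g x))\<^sup>2 \<partial>lborel)"
proof -
  have "(\<integral>x. (indicator (cball 0 (2 * R)) x * (f (c *\<^sub>R x) - f x))\<^sup>2 \<partial>lborel)
    \<le> 8 * (2 * R)\<^sup>2 * (c - 1)\<^sup>2 * (\<integral>x. (norm (indicator (cball 0 (2 * (2 * R))) x *\<^sub>R g x))\<^sup>2 \<partial>lborel)"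
    using R by (intro C1_approx_dilation_estimate[OF F c(1,2)]) auto
  also have "\<dots> \<le> 8 * (2 * R)\<^sup>2 * t\<^sup>2 * (\<integral>x. (norm (g x))\<^sup>2 \<partial>lborel)"
  proof (intro mult_mono)
    show "(c - 1)\<^sup>2 \<le> t\<^sup>2" using c(3) by (metis abs_ge_zero power2_abs power_mono)
    show "(\<integral>x. (norm (indicator (cball 0 (2 * (2 * R))) x *\<^sub>R g x))\<^sup>2 \<partial>lborel) \<le> (\<integral>x. (norm (g x))\<^sup>2 \<partial>lborel)"
      by (rule integral_mono[OF square_integrable_integrable[OF C1_approx_square_integrable(2)[OF F]] g])
        (auto simp: indicator_def)
  qed auto
  finally show ?thesis by (simp add: power_mult_distrib)
qed

text \<open>With \<open>q\<close> the pairing of the gradient and the cutoff gradient, the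
  difference splits into \<open>c * q R\<close> times the increment of \<open>u\<close> under
  \<open>c\<close>, minus \<open>q (c * R)\<close> times the increment under \<open>1 / c\<close>,
  plus \<open>c * q R - q (c * R)\<close> times \<open>u\<close>. Each piece is of order
  \<open>t\<close>: the first two by the dilation estimate, the last by comparison of the
  cutoffs.\<close>

lemma dilation_flux_bound:
  assumes F: "C1_approx C u g F G" and g: "integrable lborel (\<lambda>x. (norm (g x))\<^sup>2)"
    and R: "0 < R" and t: "0 < t" "t \<le> 1"
  shows "\<bar>(1 + t) * dilation_flux g u R (1 + t) - dilation_flux g u ((1 + t) * R) (1 / (1 + t))\<bar>
    \<le> t * flux_bound u g R"
proof -
  define c where "c = 1 + t"
  have c: "0 < c" "1 \<le> c" "c \<le> 2" "1/2 \<le> 1 / c" "1 / c \<le> 2" "\<bar>c - 1\<bar> \<le> t" "\<bar>1 / c - 1\<bar> \<le> t"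
    using t by (auto simp: c_def field_simps)
  have cR: "0 < c * R" "R \<le> c * R" "c * R \<le> 2 * R" using c R by auto
  note bu = bounded_borel_C1_approx[OF F]
  note [measurable] = C1_approxD(1,2)[OF F]
  let ?I = "indicator (cball 0 (2 * R)) :: real^3 \<Rightarrow> real"
  define P where "P x = ?I x * (norm x * norm (g x))" for x
  define D1 where "D1 x = ?I x * (u (c *\<^sub>R x) - u x)" for x
  define D2 where "D2 x = ?I x * (u ((1 / c) *\<^sub>R x) - u x)" for x
  define U where "U x = ?I x * u x" for x
  have "square_integrable lborel (\<lambda>x. ?I x * (u (a *\<^sub>R x) - u x))" for a
    using bounded_borel_local_L2[OF bounded_borel_diff[OF bounded_borel_scaled[OF bu, of a] bu], of "2 * R"] by simp
  then have sqU: "square_integrable lborel U" "square_integrable lborel D1" "square_integrable lborel D2"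
    using bounded_borel_local_L2[OF bu, of "2 * R"]
    unfolding U_def[abs_def] D1_def[abs_def] D2_def[abs_def] by simp_all
  have sqP: "square_integrable lborel P"
  proof (rule square_integrable_bound[where h="\<lambda>x. (2 * R)\<^sup>2 * (norm (g x))\<^sup>2"])
    show "integrable lborel (\<lambda>x. (2 * R)\<^sup>2 * (norm (g x))\<^sup>2)" by (intro integrable_mult_right g)
    show "(norm (P x))\<^sup>2 \<le> (2 * R)\<^sup>2 * (norm (g x))\<^sup>2" for x
    proof (cases "x \<in> cball 0 (2 * R)")
      case True
      then have "(norm x)\<^sup>2 \<le> (2 * R)\<^sup>2" by (intro power_mono) auto
      then have "(norm x)\<^sup>2 * (norm (g x))\<^sup>2 \<le> (2 * R)\<^sup>2 * (norm (g x))\<^sup>2" by (rule mult_right_mono) simp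
      then show ?thesis using True by (simp add: P_def power_mult_distrib)
    qed (simp add: P_def)
  qed (unfold P_def[abs_def], measurable)
  define q where "q R x = g x \<bullet> ball_cutoff_grad R x" for R x
  have qle: "\<bar>q r x\<bar> \<le> 4 / R\<^sup>2 * P x" if r: "R \<le> r" "r \<le> 2 * R" for r x
  proof -
    have "\<bar>q r x\<bar> \<le> norm (g x) * norm (ball_cutoff_grad r x)" unfolding q_def by (rule Cauchy_Schwarz_ineq2)
    also have "\<dots> \<le> norm (g x) * (4 / r\<^sup>2 * (?I x * norm x))"
      using R r by (intro mult_left_mono norm_ball_cutoff_grad_le_linear) auto
    also have "\<dots> = 4 / r\<^sup>2 * P x" by (simp add: P_def ac_simps)
    also have "\<dots> \<le> 4 / R\<^sup>2 * P x"
      using R r by (intro mult_right_mono divide_left_mono power_mono) (auto simp: P_def)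
    finally show ?thesis .
  qed
  have qd: "\<bar>c * q R x - q (c * R) x\<bar> \<le> 44 * t / R\<^sup>2 * P x" for x
  proof -
    have "c * q R x - q (c * R) x = g x \<bullet> (c *\<^sub>R ball_cutoff_grad R x - ball_cutoff_grad (c * R) x)"
      by (simp add: q_def inner_diff_right)
    also have "\<bar>\<dots>\<bar> \<le> norm (g x) * norm (c *\<^sub>R ball_cutoff_grad R x - ball_cutoff_grad (c * R) x)"
      by (rule Cauchy_Schwarz_ineq2)
    also have "\<dots> \<le> norm (g x) * (44 * t / R\<^sup>2 * (?I x * norm x))"
      unfolding c_def by (intro mult_left_mono dilated_cutoff_grad_bound R t) auto
    finally show ?thesis by (simp add: P_def ac_simps)
  qed
  have q0: "q r x = 0" if "r \<le> 2 * R" "0 < r" "x \<notin> cball 0 (2 * R)" for r x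
    using that cutoff_ball_cutoff[of r] by (simp add: q_def cutoff_def)
  have iq: "integrable lborel (\<lambda>x. q r x * f x)" if "R \<le> r" "r \<le> 2 * R" "bounded_borel f" for r f
  proof -
    have [measurable]: "f \<in> borel_measurable borel" using that(3) by (simp add: bounded_borel_def)
    have fL: "square_integrable lborel (\<lambda>x. ?I x *\<^sub>R f x)" by (rule bounded_borel_local_L2[OF that(3)])
    show ?thesis
    proof (rule Bochner_Integration.integrable_bound)
      show "integrable lborel (\<lambda>x. 4 / R\<^sup>2 * (norm (P x) * norm (?I x *\<^sub>R f x)))"
        by (intro integrable_mult_right square_integrable_norm_mult sqP fL)
      show "AE x in lborel. norm (q r x * f x) \<le> norm (4 / R\<^sup>2 * (norm (P x) * norm (?I x *\<^sub>R f x)))"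
      proof (rule AE_I2)
        fix x
        show "norm (q r x * f x) \<le> norm (4 / R\<^sup>2 * (norm (P x) * norm (?I x *\<^sub>R f x)))"
        proof (cases "x \<in> cball 0 (2 * R)")
          case True
          have "\<bar>q r x\<bar> * \<bar>f x\<bar> \<le> (4 / R\<^sup>2 * P x) * \<bar>f x\<bar>" by (intro mult_right_mono qle that) auto
          moreover have "0 \<le> P x" by (simp add: P_def)
          ultimately show ?thesis using True by (simp add: abs_mult)
        qed (use q0 that R in auto)
      qed
      show "(\<lambda>x. q r x * f x) \<in> borel_measurable lborel" unfolding q_def by measurable
    qed
  qed
  have P0: "0 \<le> P x" for x by (simp add: P_def)
  have bs: "bounded_borel (\<lambda>x. u (a *\<^sub>R x))" for a by (intro bounded_borel_intros bu)
  have eq: "c * dilation_flux g u R c - dilation_flux g u (c * R) (1 / c)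
    = (\<integral>x. c * (q R x * u (c *\<^sub>R x)) - q (c * R) x * u ((1 / c) *\<^sub>R x) \<partial>lborel)"
    unfolding dilation_flux_def q_def[symmetric]
    using iq[OF _ _ bs, of R c] iq[OF _ _ bs, of "c * R" "1 / c"] R cR by simp
  have "\<bar>c * dilation_flux g u R c - dilation_flux g u (c * R) (1 / c)\<bar>
      \<le> (\<integral>x. 8 / R\<^sup>2 * (norm (P x) * norm (D1 x)) + 4 / R\<^sup>2 * (norm (P x) * norm (D2 x))
       + 44 * t / R\<^sup>2 * (norm (P x) * norm (U x)) \<partial>lborel)"
    unfolding eq unfolding real_norm_def[symmetric]
  proof (rule order_trans[OF integral_norm_bound], rule integral_mono)
    show "integrable lborel (\<lambda>x. norm (c * (q R x * u (c *\<^sub>R x)) - q (c * R) x * u ((1 / c) *\<^sub>R x)))"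
      using R cR by (intro integrable_norm Bochner_Integration.integrable_diff integrable_mult_right iq bs) auto
    show "integrable lborel (\<lambda>x. 8 / R\<^sup>2 * (norm (P x) * norm (D1 x)) + 4 / R\<^sup>2 * (norm (P x) * norm (D2 x))
       + 44 * t / R\<^sup>2 * (norm (P x) * norm (U x)))"
      by (intro Bochner_Integration.integrable_add integrable_mult_right square_integrable_norm_mult sqP sqU)
    fix x
    show "norm (c * (q R x * u (c *\<^sub>R x)) - q (c * R) x * u ((1 / c) *\<^sub>R x))
      \<le> 8 / R\<^sup>2 * (norm (P x) * norm (D1 x)) + 4 / R\<^sup>2 * (norm (P x) * norm (D2 x))
       + 44 * t / R\<^sup>2 * (norm (P x) * norm (U x))"
    proof (cases "x \<in> cball 0 (2 * R)")
      case True
      have "c * (q R x * u (c *\<^sub>R x)) - q (c * R) x * u ((1 / c) *\<^sub>R x)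
        = c * q R x * D1 x - q (c * R) x * D2 x + (c * q R x - q (c * R) x) * U x"
        using True by (simp add: D1_def D2_def U_def algebra_simps)
      moreover have "\<bar>c * q R x * D1 x\<bar> \<le> (2 * (4 / R\<^sup>2 * P x)) * \<bar>D1 x\<bar>"
        unfolding abs_mult using c R by (intro mult_right_mono mult_mono qle) auto
      moreover have "\<bar>q (c * R) x * D2 x\<bar> \<le> (4 / R\<^sup>2 * P x) * \<bar>D2 x\<bar>"
        unfolding abs_mult using cR c by (intro mult_right_mono qle) auto
      moreover have "\<bar>(c * q R x - q (c * R) x) * U x\<bar> \<le> (44 * t / R\<^sup>2 * P x) * \<bar>U x\<bar>"
        unfolding abs_mult by (intro mult_right_mono qd) auto
      ultimately have "\<bar>c * (q R x * u (c *\<^sub>R x)) - q (c * R) x * u ((1 / c) *\<^sub>R x)\<bar>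
        \<le> (2 * (4 / R\<^sup>2 * P x)) * \<bar>D1 x\<bar> + (4 / R\<^sup>2 * P x) * \<bar>D2 x\<bar> + (44 * t / R\<^sup>2 * P x) * \<bar>U x\<bar>"
        by linarith
      then show ?thesis using P0[of x] by simp
    next
      case False
      then show ?thesis using q0[of R x] q0[of "c * R" x] R cR t by simp
    qed
  qed
  also have "\<dots> = 8 / R\<^sup>2 * (\<integral>x. norm (P x) * norm (D1 x) \<partial>lborel) + 4 / R\<^sup>2 * (\<integral>x. norm (P x) * norm (D2 x) \<partial>lborel)
       + 44 * t / R\<^sup>2 * (\<integral>x. norm (P x) * norm (U x) \<partial>lborel)"
    using square_integrable_norm_mult[OF sqP sqU(1)] square_integrable_norm_mult[OF sqP sqU(2)]
      square_integrable_norm_mult[OF sqP sqU(3)]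
    by (simp only: Bochner_Integration.integral_add Bochner_Integration.integrable_add integrable_mult_right integral_mult_right_zero)
  also have "\<dots> \<le> 8 / R\<^sup>2 * (radial_moment g R * (6 * R * t * sqrt (\<integral>x. (norm (g x))\<^sup>2 \<partial>lborel)))
     + 4 / R\<^sup>2 * (radial_moment g R * (6 * R * t * sqrt (\<integral>x. (norm (g x))\<^sup>2 \<partial>lborel)))
     + 44 * t / R\<^sup>2 * (radial_moment g R * sqrt (\<integral>x. ?I x * (u x)\<^sup>2 \<partial>lborel))"
  proof -
    have Pm: "sqrt (\<integral>x. (norm (P x))\<^sup>2 \<partial>lborel) = radial_moment g R"
      by (simp add: radial_moment_def P_def)
    have m0: "0 \<le> radial_moment g R" by (simp add: radial_moment_def)
    \<comment> \<open>6 replaces sqrt 32, as 32 is below 36.\<close>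
    have root: "sqrt X \<le> 6 * R * t * sqrt Y" if "X \<le> 32 * R\<^sup>2 * t\<^sup>2 * Y" "0 \<le> Y" for X Y
    proof -
      have "32 * R\<^sup>2 * t\<^sup>2 * Y \<le> (6 * R * t)\<^sup>2 * Y" using that by (simp add: power_mult_distrib mult_right_mono)
      then have "sqrt X \<le> sqrt ((6 * R * t)\<^sup>2 * Y)" using that by (intro real_sqrt_le_mono) linarith
      then show ?thesis using R t by (simp add: real_sqrt_mult)
    qed
    have g0: "0 \<le> (\<integral>x. (norm (g x))\<^sup>2 \<partial>lborel)" by simp
    have d1: "sqrt (\<integral>x. (norm (D1 x))\<^sup>2 \<partial>lborel) \<le> 6 * R * t * sqrt (\<integral>x. (norm (g x))\<^sup>2 \<partial>lborel)"
      unfolding D1_def real_norm_def power2_abs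
      using C1_approx_dilation_estimate_global[OF F g _ c(3,6), of R] c R by (intro root g0) auto
    have d2: "sqrt (\<integral>x. (norm (D2 x))\<^sup>2 \<partial>lborel) \<le> 6 * R * t * sqrt (\<integral>x. (norm (g x))\<^sup>2 \<partial>lborel)"
      unfolding D2_def real_norm_def power2_abs
      using C1_approx_dilation_estimate_global[OF F g c(4,5,7), of R] R by (intro root g0) auto
    have u2: "(\<integral>x. (norm (U x))\<^sup>2 \<partial>lborel) = (\<integral>x. ?I x * (u x)\<^sup>2 \<partial>lborel)"
      by (rule Bochner_Integration.integral_cong) (auto simp: U_def indicator_def)
    show ?thesis
    proof (intro add_mono mult_left_mono)
      show "(\<integral>x. norm (P x) * norm (D1 x) \<partial>lborel) \<le> radial_moment g R * (6 * R * t * sqrt (\<integral>x. (norm (g x))\<^sup>2 \<partial>lborel))"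
        using L2_Cauchy_Schwarz[OF sqP sqU(2)] mult_left_mono[OF d1 m0] unfolding Pm by linarith
      show "(\<integral>x. norm (P x) * norm (D2 x) \<partial>lborel) \<le> radial_moment g R * (6 * R * t * sqrt (\<integral>x. (norm (g x))\<^sup>2 \<partial>lborel))"
        using L2_Cauchy_Schwarz[OF sqP sqU(3)] mult_left_mono[OF d2 m0] unfolding Pm by linarith
      show "(\<integral>x. norm (P x) * norm (U x) \<partial>lborel) \<le> radial_moment g R * sqrt (\<integral>x. ?I x * (u x)\<^sup>2 \<partial>lborel)"
        using L2_Cauchy_Schwarz[OF sqP sqU(1)] unfolding Pm u2 .
    qed (use t in auto)
  qed
  also have "\<dots> = t * flux_bound u g R"
    using R by (simp add: flux_bound_def field_simps power2_eq_square)
  finally show ?thesis unfolding c_def .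
qed

text \<open>For H(a,b) = a^2 b^2 / 2 the expression \<open>a * b^2 * a' + a^2 * b * b'\<close> is
  the gradient of H at (a,b) paired with (a',b'). By homogeneity of degree 4 its pairing with (a,b)
  is 4 H, and its pairing with the increment is the increment of H up to second order. So it equals
  3 H(a,b) + H(a',b') to that order, which explains the coefficients 3/2 and 1/2.\<close>

lemma quartic_taylor_bound:
  fixes a b a' b' C :: real
  assumes "\<bar>a\<bar> \<le> C" "\<bar>b\<bar> \<le> C" "\<bar>a'\<bar> \<le> C" "\<bar>b'\<bar> \<le> C"
  shows "\<bar>a * b\<^sup>2 * a' + a\<^sup>2 * b * b' - (3/2 * (a\<^sup>2 * b\<^sup>2) + 1/2 * (a'\<^sup>2 * b'\<^sup>2))\<bar>
    \<le> 6 * C\<^sup>2 * ((a' - a)\<^sup>2 + (b' - b)\<^sup>2)"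
proof -
  define s r where "s = a' - a" and "r = b' - b"
  have C: "0 \<le> C" using assms(1) by linarith
  have eq: "a * b\<^sup>2 * a' + a\<^sup>2 * b * b' - (3/2 * (a\<^sup>2 * b\<^sup>2) + 1/2 * (a'\<^sup>2 * b'\<^sup>2))
    = - (a\<^sup>2 * r\<^sup>2 / 2 + b\<^sup>2 * s\<^sup>2 / 2 + 2 * (a * b * (s * r)) + a * s * r\<^sup>2 + b * r * s\<^sup>2 + s\<^sup>2 * r\<^sup>2 / 2)"
  proof -
    have a': "a' = a + s" and b': "b' = b + r" by (simp_all add: s_def r_def)
    show ?thesis unfolding a' b' by (simp add: power2_eq_square field_simps)
  qed
  have s: "\<bar>s\<bar> \<le> 2 * C" "\<bar>r\<bar> \<le> 2 * C" using assms by (auto simp: s_def r_def)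
  have sq: "a\<^sup>2 \<le> C\<^sup>2" "b\<^sup>2 \<le> C\<^sup>2" using assms C by (auto intro: abs_le_square_iff[THEN iffD1])
  have "s\<^sup>2 \<le> (2 * C)\<^sup>2" using s C by (intro abs_le_square_iff[THEN iffD1]) auto
  then have s2: "s\<^sup>2 \<le> 4 * C\<^sup>2" by (simp add: power_mult_distrib)
  have "a\<^sup>2 * r\<^sup>2 \<le> C\<^sup>2 * r\<^sup>2" "b\<^sup>2 * s\<^sup>2 \<le> C\<^sup>2 * s\<^sup>2" "s\<^sup>2 * r\<^sup>2 \<le> 4 * C\<^sup>2 * r\<^sup>2"
    using sq s2 by (auto intro: mult_right_mono)
  moreover have "0 \<le> a\<^sup>2 * r\<^sup>2" "0 \<le> b\<^sup>2 * s\<^sup>2" "0 \<le> s\<^sup>2 * r\<^sup>2" "0 \<le> C\<^sup>2 * r\<^sup>2" "0 \<le> C\<^sup>2 * s\<^sup>2" by auto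
  moreover have "2 * \<bar>a * b * (s * r)\<bar> \<le> C\<^sup>2 * s\<^sup>2 + C\<^sup>2 * r\<^sup>2"
  proof -
    have "\<bar>a * b * (s * r)\<bar> \<le> C * C * \<bar>s * r\<bar>"
      unfolding abs_mult[of "a * b"] using assms C by (intro mult_right_mono) (auto simp: abs_mult intro: mult_mono)
    moreover have "2 * \<bar>s * r\<bar> \<le> s\<^sup>2 + r\<^sup>2"
      using sum_squares_bound[of "\<bar>s\<bar>" "\<bar>r\<bar>"] by (simp add: abs_mult)
    then have "C * C * (2 * \<bar>s * r\<bar>) \<le> C * C * (s\<^sup>2 + r\<^sup>2)" by (intro mult_left_mono) auto
    ultimately show ?thesis by (simp add: power2_eq_square algebra_simps)
  qed
  moreover have "\<bar>a * s * r\<^sup>2\<bar> \<le> 2 * (C\<^sup>2 * r\<^sup>2)"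
  proof -
    have "\<bar>a\<bar> * \<bar>s\<bar> * r\<^sup>2 \<le> C * (2 * C) * r\<^sup>2" using assms s C by (intro mult_right_mono mult_mono) auto
    then show ?thesis by (simp add: abs_mult power2_eq_square)
  qed
  moreover have "\<bar>b * r * s\<^sup>2\<bar> \<le> 2 * (C\<^sup>2 * s\<^sup>2)"
  proof -
    have "\<bar>b\<bar> * \<bar>r\<bar> * s\<^sup>2 \<le> C * (2 * C) * s\<^sup>2" using assms s C by (intro mult_right_mono mult_mono) auto
    then show ?thesis by (simp add: abs_mult power2_eq_square)
  qed
  moreover have "6 * C\<^sup>2 * (s\<^sup>2 + r\<^sup>2) = 6 * (C\<^sup>2 * s\<^sup>2) + 6 * (C\<^sup>2 * r\<^sup>2)" by (simp add: algebra_simps)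
  ultimately show ?thesis unfolding eq s_def[symmetric] r_def[symmetric] by linarith
qed

text \<open>The sign that encodes subcriticality. With \<open>c = 1 + t\<close> the left side
  collects the coefficients of the potential energy in the dilation identity; its derivative at
  \<open>t = 0\<close> is -1, and the same count in dimension n would give n - 4. The second part is
  the sign that allows the energy at radius \<open>c * R\<close> to be replaced by that at
  \<open>R\<close>.\<close>

lemma dilation_coefficient_bound:
  fixes t :: real
  assumes t: "0 < t" "t \<le> 1"
  shows "3/2 * (1 + t) - (1 + t) ^ 3 / 2 - (3/2 - 1 / (2 * (1 + t)\<^sup>2)) \<le> - t + 3/2 * t\<^sup>2"
    and "0 \<le> 3/2 - 1 / (2 * (1 + t)\<^sup>2)"
proof -
  have sq: "1 \<le> (1 + t)\<^sup>2" using t by (intro one_le_power) auto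
  then have "0 < (1 + t)\<^sup>2" by linarith
  have "1 + 4 * t ^ 3 + 3 * t ^ 4 = (1 - 2 * t + 3 * t\<^sup>2) * (1 + t)\<^sup>2"
    by (simp add: power2_eq_square power3_eq_cube power4_eq_xxxx algebra_simps)
  then have "1 \<le> (1 - 2 * t + 3 * t\<^sup>2) * (1 + t)\<^sup>2"
    using zero_le_power[of t 3] zero_le_power[of t 4] t by linarith
  then have 1: "1 / (1 + t)\<^sup>2 \<le> 1 - 2 * t + 3 * t\<^sup>2"
    using \<open>0 < (1 + t)\<^sup>2\<close> by (simp add: divide_le_eq)
  have "(1 + t) ^ 3 = 1 + 3 * t + 3 * t\<^sup>2 + t ^ 3"
    by (simp add: power2_eq_square power3_eq_cube algebra_simps)
  then have 2: "1 + 3 * t \<le> (1 + t) ^ 3"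
    using zero_le_power[of t 3] zero_le_power2[of t] t by linarith
  have e: "1 / (2 * (1 + t)\<^sup>2) = (1 / (1 + t)\<^sup>2) / 2" by simp
  show "3/2 * (1 + t) - (1 + t) ^ 3 / 2 - (3/2 - 1 / (2 * (1 + t)\<^sup>2)) \<le> - t + 3/2 * t\<^sup>2"
    unfolding e using 1 2 by (simp add: field_simps)
  have "1 / (1 + t)\<^sup>2 \<le> 1" using sq \<open>0 < (1 + t)\<^sup>2\<close> by (simp add: divide_le_eq)
  moreover have "0 \<le> 3/2 - y / 2" if "y \<le> 1" for y :: real using that by linarith
  ultimately show "0 \<le> 3/2 - 1 / (2 * (1 + t)\<^sup>2)" unfolding e by blast
qed

lemma ball_cutoff_mono:
  assumes "0 < R" "R \<le> S"
  shows "ball_cutoff R x \<le> ball_cutoff S x"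
proof -
  have "norm ((1 / S) *\<^sub>R x) \<le> norm ((1 / R) *\<^sub>R x)"
    using assms by (simp add: frac_le)
  then have "(norm ((1 / S) *\<^sub>R x))\<^sup>2 \<le> (norm ((1 / R) *\<^sub>R x))\<^sup>2" by (intro power_mono) auto
  then show ?thesis unfolding ball_cutoff_def bump_def by (intro power_mono max.mono) auto
qed

text \<open>The quartic expansion is applied pointwise to the values at x and at c x. Its error is
  quadratic in the increments, hence of order \<open>t^2\<close> by the dilation estimate, and the
  dilated potential is scaled back with Jacobian 1/c^3. The separate radius \<open>r\<close> covers
  both cutoffs, \<open>R\<close> and \<open>c * R\<close>.\<close>

lemma dilation_source_estimate:
  assumes Fu: "C1_approx C u gu Fu Gu" and Fv: "C1_approx C v gv Fv Gv"
    and gu: "integrable lborel (\<lambda>x. (norm (gu x))\<^sup>2)" and gv: "integrable lborel (\<lambda>x. (norm (gv x))\<^sup>2)"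
    and R: "0 < R" and r: "0 < r" "r \<le> 2 * R"
    and c: "1/2 \<le> c" "c \<le> 2" "\<bar>c - 1\<bar> \<le> t"
  shows "\<bar>dilation_source (\<lambda>x. u x * (v x)\<^sup>2) u r c + dilation_source (\<lambda>x. (u x)\<^sup>2 * v x) v r c
      - (3/2 * (\<integral>x. ball_cutoff r x * ((u x)\<^sup>2 * (v x)\<^sup>2) \<partial>lborel)
        + 1/2 * (1 / c ^ 3 * (\<integral>x. ball_cutoff (c * r) x * ((u x)\<^sup>2 * (v x)\<^sup>2) \<partial>lborel)))\<bar>
    \<le> 6 * C\<^sup>2 * (32 * R\<^sup>2 * t\<^sup>2 * ((\<integral>x. (norm (gu x))\<^sup>2 \<partial>lborel) + (\<integral>x. (norm (gv x))\<^sup>2 \<partial>lborel)))"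
proof -
  have c0: "0 < c" using c by simp
  note bu = bounded_borel_C1_approx[OF Fu] and bv = bounded_borel_C1_approx[OF Fv]
  note [measurable] = bounded_borel_measurable[OF bu] bounded_borel_measurable[OF bv]
  note \<eta> = cutoff_ball_cutoff[OF r(1)]
  note bb = bounded_borel_intros bu bv bounded_borel_cutoff(1)[OF \<eta>]
  have z: "ball_cutoff r x = 0" if "r < norm x" for x using \<eta> that by (auto simp: cutoff_def)
  define Q where "Q x = (u x)\<^sup>2 * (v x)\<^sup>2" for x
  let ?I = "indicator (cball 0 (2 * R)) :: real^3 \<Rightarrow> real"
  let ?du = "\<lambda>x. (?I x * (u (c *\<^sub>R x) - u x))\<^sup>2" and ?dv = "\<lambda>x. (?I x * (v (c *\<^sub>R x) - v x))\<^sup>2"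
  have bQ: "bounded_borel Q" unfolding Q_def[abs_def] by (intro bb)
  have iQ: "integrable lborel (\<lambda>x. ball_cutoff r x * Q x)" "integrable lborel (\<lambda>x. ball_cutoff r x * Q (c *\<^sub>R x))"
    "integrable lborel (\<lambda>x. u x * (v x)\<^sup>2 * (ball_cutoff r x * u (c *\<^sub>R x)))"
    "integrable lborel (\<lambda>x. (u x)\<^sup>2 * v x * (ball_cutoff r x * v (c *\<^sub>R x)))"
    by (rule bounded_borel_integrable[where R=r]; (intro bb bQ | simp add: z))+
  have id: "integrable lborel ?du" "integrable lborel ?dv"
    by (rule bounded_borel_integrable[where R="2 * R"]; (intro bb | simp); simp)+
  have sc: "(\<integral>x. ball_cutoff r x * Q (c *\<^sub>R x) \<partial>lborel) = 1 / c ^ 3 * (\<integral>x. ball_cutoff (c * r) x * Q x \<partial>lborel)"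
    using lborel_integral_affine[of "\<lambda>x. ball_cutoff (c * r) x * Q x" c 0] c0 bounded_borel_measurable[OF bQ]
    by (simp add: ball_cutoff_scaleR)
  have eq: "dilation_source (\<lambda>x. u x * (v x)\<^sup>2) u r c + dilation_source (\<lambda>x. (u x)\<^sup>2 * v x) v r c
      - (3/2 * (\<integral>x. ball_cutoff r x * Q x \<partial>lborel) + 1/2 * (\<integral>x. ball_cutoff r x * Q (c *\<^sub>R x) \<partial>lborel))
    = (\<integral>x. u x * (v x)\<^sup>2 * (ball_cutoff r x * u (c *\<^sub>R x)) + (u x)\<^sup>2 * v x * (ball_cutoff r x * v (c *\<^sub>R x))
        - (3/2 * (ball_cutoff r x * Q x) + 1/2 * (ball_cutoff r x * Q (c *\<^sub>R x))) \<partial>lborel)"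
    unfolding dilation_source_def using iQ by simp
  have "\<bar>dilation_source (\<lambda>x. u x * (v x)\<^sup>2) u r c + dilation_source (\<lambda>x. (u x)\<^sup>2 * v x) v r c
      - (3/2 * (\<integral>x. ball_cutoff r x * Q x \<partial>lborel) + 1/2 * (\<integral>x. ball_cutoff r x * Q (c *\<^sub>R x) \<partial>lborel))\<bar>
      \<le> (\<integral>x. 6 * C\<^sup>2 * (?du x + ?dv x) \<partial>lborel)"
    unfolding eq unfolding real_norm_def[symmetric]
  proof (rule order_trans[OF integral_norm_bound], rule integral_mono)
    show "integrable lborel (\<lambda>x. norm (u x * (v x)\<^sup>2 * (ball_cutoff r x * u (c *\<^sub>R x)) + (u x)\<^sup>2 * v x * (ball_cutoff r x * v (c *\<^sub>R x))
        - (3/2 * (ball_cutoff r x * Q x) + 1/2 * (ball_cutoff r x * Q (c *\<^sub>R x)))))"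
      by (intro integrable_norm Bochner_Integration.integrable_diff Bochner_Integration.integrable_add integrable_mult_right iQ)
    show "integrable lborel (\<lambda>x. 6 * C\<^sup>2 * (?du x + ?dv x))"
      by (intro integrable_mult_right Bochner_Integration.integrable_add id)
    fix x
    let ?E = "u x * (v x)\<^sup>2 * u (c *\<^sub>R x) + (u x)\<^sup>2 * v x * v (c *\<^sub>R x)
       - (3/2 * ((u x)\<^sup>2 * (v x)\<^sup>2) + 1/2 * ((u (c *\<^sub>R x))\<^sup>2 * (v (c *\<^sub>R x))\<^sup>2))"
    have e: "u x * (v x)\<^sup>2 * (ball_cutoff r x * u (c *\<^sub>R x)) + (u x)\<^sup>2 * v x * (ball_cutoff r x * v (c *\<^sub>R x))
        - (3/2 * (ball_cutoff r x * Q x) + 1/2 * (ball_cutoff r x * Q (c *\<^sub>R x))) = ball_cutoff r x * ?E"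
      unfolding Q_def by (simp add: algebra_simps)
    have "norm (u x * (v x)\<^sup>2 * (ball_cutoff r x * u (c *\<^sub>R x)) + (u x)\<^sup>2 * v x * (ball_cutoff r x * v (c *\<^sub>R x))
        - (3/2 * (ball_cutoff r x * Q x) + 1/2 * (ball_cutoff r x * Q (c *\<^sub>R x)))) = ball_cutoff r x * \<bar>?E\<bar>"
      unfolding e real_norm_def abs_mult using ball_cutoff_bounds[of r x] by simp
    also have "\<dots> \<le> ?I x * \<bar>?E\<bar>"
      using ball_cutoff_bounds[of r x] z[of x] r by (intro mult_right_mono) (auto simp: indicator_def)
    also have "\<dots> \<le> ?I x * (6 * C\<^sup>2 * ((u (c *\<^sub>R x) - u x)\<^sup>2 + (v (c *\<^sub>R x) - v x)\<^sup>2))"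
      by (intro mult_left_mono quartic_taylor_bound C1_approxD(3)[OF Fu] C1_approxD(3)[OF Fv]) auto
    also have "\<dots> = 6 * C\<^sup>2 * (?du x + ?dv x)" by (auto simp: indicator_def)
    finally show "norm (u x * (v x)\<^sup>2 * (ball_cutoff r x * u (c *\<^sub>R x)) + (u x)\<^sup>2 * v x * (ball_cutoff r x * v (c *\<^sub>R x))
        - (3/2 * (ball_cutoff r x * Q x) + 1/2 * (ball_cutoff r x * Q (c *\<^sub>R x)))) \<le> 6 * C\<^sup>2 * (?du x + ?dv x)" .
  qed
  also have "\<dots> = 6 * C\<^sup>2 * ((\<integral>x. ?du x \<partial>lborel) + (\<integral>x. ?dv x \<partial>lborel))"
    using id by simp
  also have "\<dots> \<le> 6 * C\<^sup>2 * (32 * R\<^sup>2 * t\<^sup>2 * (\<integral>x. (norm (gu x))\<^sup>2 \<partial>lborel) + 32 * R\<^sup>2 * t\<^sup>2 * (\<integral>x. (norm (gv x))\<^sup>2 \<partial>lborel))"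
    using R by (intro mult_left_mono add_mono C1_approx_dilation_estimate_global[OF Fu gu c]
        C1_approx_dilation_estimate_global[OF Fv gv c]) auto
  finally show ?thesis unfolding sc unfolding Q_def by (simp only: distrib_left)
qed

text \<open>The Pohozaev inequality at a fixed radius. In the sum of the dilation identities for
  \<open>u\<close> and \<open>v\<close>, the sources give at most \<open>- t\<close> times the
  truncated energy up to \<open>t^2\<close>, and the fluxes at least \<open>- t\<close> times their
  bound. Division by \<open>t\<close> and the limit \<open>t \<longlonglongrightarrow> 0\<close>
  leave the claim.\<close>

lemma truncated_potential_le_flux:
  assumes U: "neumann_weak C u gu Fu Gu (\<lambda>x. u x * (v x)\<^sup>2)"
    and V: "neumann_weak C v gv Fv Gv (\<lambda>x. (u x)\<^sup>2 * v x)"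
    and gu: "integrable lborel (\<lambda>x. (norm (gu x))\<^sup>2)" and gv: "integrable lborel (\<lambda>x. (norm (gv x))\<^sup>2)"
    and R: "0 < R"
  shows "(\<integral>x. ball_cutoff R x * ((u x)\<^sup>2 * (v x)\<^sup>2) \<partial>lborel) \<le> flux_bound u gu R + flux_bound v gv R"
proof -
  have Fu: "C1_approx C u gu Fu Gu" and Fv: "C1_approx C v gv Fv Gv"
    using U V by (auto simp: neumann_weak_def)
  note bu = bounded_borel_C1_approx[OF Fu] and bv = bounded_borel_C1_approx[OF Fv]
  define \<beta> where "\<beta> r = (\<integral>x. ball_cutoff r x * ((u x)\<^sup>2 * (v x)\<^sup>2) \<partial>lborel)" for r
  define M where "M = flux_bound u gu R + flux_bound v gv R"
  define K where "K = 6 * C\<^sup>2 * (32 * R\<^sup>2 * ((\<integral>x. (norm (gu x))\<^sup>2 \<partial>lborel) + (\<integral>x. (norm (gv x))\<^sup>2 \<partial>lborel)))"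
  have i\<beta>: "integrable lborel (\<lambda>x. ball_cutoff r x * ((u x)\<^sup>2 * (v x)\<^sup>2))" if "0 < r" for r
  proof (rule bounded_borel_integrable[where R=r])
    show "bounded_borel (\<lambda>x. ball_cutoff r x * ((u x)\<^sup>2 * (v x)\<^sup>2))"
      by (intro bounded_borel_intros bu bv bounded_borel_cutoff(1)[OF cutoff_ball_cutoff[OF that]])
    show "ball_cutoff r x * ((u x)\<^sup>2 * (v x)\<^sup>2) = 0" if "r < norm x" for x
      using cutoff_ball_cutoff[OF \<open>0 < r\<close>] that by (simp add: cutoff_def)
  qed
  have \<beta>0: "0 \<le> \<beta> R"
    unfolding \<beta>_def by (intro integral_nonneg_AE AE_I2 mult_nonneg_nonneg ball_cutoff_bounds) auto
  have ineq: "\<beta> R \<le> M + t * (3/2 * \<beta> R + 3 * K)" if t: "0 < t" "t \<le> 1" for t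
  proof -
    define c where "c = 1 + t"
    have c: "0 < c" "1 \<le> c" "c \<le> 2" "1/2 \<le> c" "1/2 \<le> 1 / c" "1 / c \<le> 2" "\<bar>c - 1\<bar> \<le> t" "\<bar>1 / c - 1\<bar> \<le> t"
      using t by (auto simp: c_def field_simps)
    have cR: "0 < c * R" "R \<le> c * R" "c * R \<le> 2 * R" using c R by auto
    define S where "S r d = dilation_source (\<lambda>x. u x * (v x)\<^sup>2) u r d + dilation_source (\<lambda>x. (u x)\<^sup>2 * v x) v r d" for r d
    \<comment> \<open>The energy at radius \<open>c * R\<close> enters with a negative coefficient,
      so this direction suffices and no continuity of \<beta> in the radius is required.\<close>
    have mono: "\<beta> R \<le> \<beta> (c * R)"
      unfolding \<beta>_def
      by (intro integral_mono i\<beta> R cR mult_right_mono ball_cutoff_mono) auto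
    have Kt: "6 * C\<^sup>2 * (32 * R\<^sup>2 * t\<^sup>2 * ((\<integral>x. (norm (gu x))\<^sup>2 \<partial>lborel) + (\<integral>x. (norm (gv x))\<^sup>2 \<partial>lborel))) = t\<^sup>2 * K"
      by (simp add: K_def ac_simps)
    have S1: "\<bar>S R c - (3/2 * \<beta> R + 1/2 * (1 / c ^ 3 * \<beta> (c * R)))\<bar> \<le> t\<^sup>2 * K"
      using dilation_source_estimate[OF Fu Fv gu gv R R _ c(4,3,7)] R unfolding Kt S_def \<beta>_def by simp
    have "\<bar>S (c * R) (1 / c) - (3/2 * \<beta> (c * R) + 1/2 * (1 / (1 / c) ^ 3 * \<beta> (1 / c * (c * R))))\<bar> \<le> t\<^sup>2 * K"
      using dilation_source_estimate[OF Fu Fv gu gv R cR(1,3) c(5,6,8)] unfolding Kt S_def \<beta>_def .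
    then have S2: "\<bar>S (c * R) (1 / c) - (3/2 * \<beta> (c * R) + 1/2 * (c ^ 3 * \<beta> R))\<bar> \<le> t\<^sup>2 * K"
      using c(1) by (simp add: power_divide)
    have "c * S R c - S (c * R) (1 / c)
       = (c * dilation_flux gu u R c - dilation_flux gu u (c * R) (1 / c))
         + (c * dilation_flux gv v R c - dilation_flux gv v (c * R) (1 / c))"
      using dilation_identity[OF U R c(1)] dilation_identity[OF V R c(1)]
      unfolding S_def by (simp add: algebra_simps)
    moreover have "\<bar>c * dilation_flux gu u R c - dilation_flux gu u (c * R) (1 / c)\<bar> \<le> t * flux_bound u gu R"
      "\<bar>c * dilation_flux gv v R c - dilation_flux gv v (c * R) (1 / c)\<bar> \<le> t * flux_bound v gv R"
      unfolding c_def by (rule dilation_flux_bound[OF Fu gu R t], rule dilation_flux_bound[OF Fv gv R t])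
    ultimately have "- (t * M) \<le> c * S R c - S (c * R) (1 / c)"
      unfolding M_def by (simp add: distrib_left)
    moreover have "c * S R c \<le> c * (3/2 * \<beta> R + 1/2 * (1 / c ^ 3 * \<beta> (c * R)) + t\<^sup>2 * K)"
      using S1 c(1) by (intro mult_left_mono) auto
    moreover have "c * (3/2 * \<beta> R + 1/2 * (1 / c ^ 3 * \<beta> (c * R)) + t\<^sup>2 * K)
        = 3/2 * c * \<beta> R + 1 / (2 * c\<^sup>2) * \<beta> (c * R) + c * (t\<^sup>2 * K)"
      using c(1) by (simp add: field_simps power2_eq_square power3_eq_cube)
    moreover have "c * (t\<^sup>2 * K) \<le> 2 * (t\<^sup>2 * K)"
      using c(3) by (intro mult_right_mono) (auto simp: K_def)
    ultimately have "- (t * M) \<le> 3/2 * c * \<beta> R + 1 / (2 * c\<^sup>2) * \<beta> (c * R) + 3 * (t\<^sup>2 * K)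
        - (3/2 * \<beta> (c * R) + 1/2 * (c ^ 3 * \<beta> R))"
      using S2 by linarith
    also have "\<dots> = (3/2 * c - c ^ 3 / 2) * \<beta> R - (3/2 - 1 / (2 * c\<^sup>2)) * \<beta> (c * R) + 3 * (t\<^sup>2 * K)"
      by (simp add: algebra_simps)
    also have "\<dots> \<le> (3/2 * c - c ^ 3 / 2) * \<beta> R - (3/2 - 1 / (2 * c\<^sup>2)) * \<beta> R + 3 * (t\<^sup>2 * K)"
      using mult_left_mono[OF mono dilation_coefficient_bound(2)[OF t]] unfolding c_def by linarith
    also have "\<dots> = (3/2 * c - c ^ 3 / 2 - (3/2 - 1 / (2 * c\<^sup>2))) * \<beta> R + 3 * (t\<^sup>2 * K)"
      by (simp add: left_diff_distrib)
    also have "\<dots> \<le> (- t + 3/2 * t\<^sup>2) * \<beta> R + 3 * (t\<^sup>2 * K)"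
      using mult_right_mono[OF dilation_coefficient_bound(1)[OF t] \<beta>0] unfolding c_def by linarith
    finally have "t * \<beta> R \<le> t * (M + t * (3/2 * \<beta> R + 3 * K))"
      by (simp add: algebra_simps power2_eq_square)
    then show ?thesis using t(1) by simp
  qed
  \<comment> \<open>Here \<open>R\<close> is fixed and \<open>t\<close> runs through 1/(n+1). The
    constant \<open>K\<close> grows with \<open>R\<close>, so this limit must be taken before
    \<open>R\<close> tends to infinity.\<close>
  have "\<beta> R \<le> M"
  proof (rule LIMSEQ_le_const)
    have "(\<lambda>n. M + (1 / real (Suc n)) * (3/2 * \<beta> R + 3 * K)) \<longlonglongrightarrow> M + 0 * (3/2 * \<beta> R + 3 * K)"
      by (intro tendsto_intros LIMSEQ_Suc[OF lim_1_over_n])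
    then show "(\<lambda>n. M + (1 / real (Suc n)) * (3/2 * \<beta> R + 3 * K)) \<longlonglongrightarrow> M" by simp
    show "\<exists>N. \<forall>n\<ge>N. \<beta> R \<le> M + (1 / real (Suc n)) * (3/2 * \<beta> R + 3 * K)"
      by (intro exI[of _ 0] allI impI ineq) auto
  qed
  then show ?thesis by (simp add: \<beta>_def M_def)
qed

text \<open>On the ball of radius 2 R the weight |x|/R is at most 2, and at each fixed point it
  tends to 0. Square integrability of \<open>g\<close> thus yields decay, not just boundedness, by
  dominated convergence.\<close>

lemma radial_moment_tendsto:
  assumes [measurable]: "g \<in> borel_measurable borel" and g: "integrable lborel (\<lambda>x. (norm (g x))\<^sup>2)"
  shows "(\<lambda>n. radial_moment g (real (Suc n)) / real (Suc n)) \<longlonglongrightarrow> 0"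
proof -
  let ?h = "\<lambda>n x. (indicator (cball 0 (2 * real (Suc n))) x * (norm (x::real^3) / real (Suc n) * norm (g x)))\<^sup>2"
  have "(\<lambda>n. \<integral>x. ?h n x \<partial>lborel) \<longlonglongrightarrow> (\<integral>x. 0 \<partial>(lborel :: (real^3) measure))"
  proof (rule integral_dominated_convergence[where w="\<lambda>x. 4 * (norm (g x))\<^sup>2"])
    show "integrable lborel (\<lambda>x. 4 * (norm (g x))\<^sup>2)" by (intro integrable_mult_right g)
    show "AE x in lborel. norm (?h n x) \<le> 4 * (norm (g x))\<^sup>2" for n
    proof (rule AE_I2)
      fix x
      show "norm (?h n x) \<le> 4 * (norm (g x))\<^sup>2"
      proof (cases "x \<in> cball 0 (2 * real (Suc n))")
        case True
        then have "norm x / real (Suc n) \<le> 2" by (simp add: divide_le_eq)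
        then have "(norm x / real (Suc n))\<^sup>2 \<le> 2\<^sup>2" by (intro power_mono) auto
        then have "(norm x / real (Suc n))\<^sup>2 * (norm (g x))\<^sup>2 \<le> 4 * (norm (g x))\<^sup>2"
          by (intro mult_right_mono) auto
        then show ?thesis using True by (simp add: power_mult_distrib power_divide del: of_nat_Suc)
      qed simp
    qed
    show "AE x in lborel. (\<lambda>n. ?h n x) \<longlonglongrightarrow> 0"
    proof (rule AE_I2)
      fix x :: "real^3"
      have "(\<lambda>n. (norm x * (1 / real (Suc n)) * norm (g x))\<^sup>2) \<longlonglongrightarrow> (norm x * 0 * norm (g x))\<^sup>2"
        by (intro tendsto_intros LIMSEQ_Suc[OF lim_1_over_n])
      then have "(\<lambda>n. (norm x / real (Suc n) * norm (g x))\<^sup>2) \<longlonglongrightarrow> 0" by simp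
      then show "(\<lambda>n. ?h n x) \<longlonglongrightarrow> 0"
        by (rule tendsto_sandwich[OF _ _ tendsto_const, rotated 2]) (auto simp: indicator_def)
    qed
    show "?h n \<in> borel_measurable lborel" for n by measurable
  qed simp
  then have "(\<lambda>n. sqrt (\<integral>x. ?h n x \<partial>lborel)) \<longlonglongrightarrow> sqrt 0" by (intro tendsto_real_sqrt) simp
  moreover have "sqrt (\<integral>x. ?h n x \<partial>lborel) = radial_moment g (real (Suc n)) / real (Suc n)" for n
  proof -
    have "(\<integral>x. ?h n x \<partial>lborel)
      = (\<integral>x. (1 / (real (Suc n))\<^sup>2) * (indicator (cball 0 (2 * real (Suc n))) x * (norm x * norm (g x)))\<^sup>2 \<partial>lborel)"
      by (rule Bochner_Integration.integral_cong) (auto simp: power_mult_distrib power_divide)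
    also have "\<dots> = (1 / (real (Suc n))\<^sup>2) * (\<integral>x. (indicator (cball 0 (2 * real (Suc n))) x * (norm x * norm (g x)))\<^sup>2 \<partial>lborel)"
      by (rule integral_mult_right_zero)
    finally show ?thesis by (simp add: radial_moment_def real_sqrt_mult real_sqrt_divide)
  qed
  ultimately show ?thesis by simp
qed

text \<open>The local L2 norm of \<open>u\<close> divided by the radius stays bounded: the quartic
  comparison with weight \<open>t = R\<close> on the ball of radius 2 R gives \<open>R\<close> times
  the L^4 term plus a multiple of R^2. The decay of the radial moment does the rest.\<close>

lemma flux_bound_tendsto:
  assumes F: "C1_approx C u g F G" and g: "integrable lborel (\<lambda>x. (norm (g x))\<^sup>2)"
    and u4: "integrable lborel (\<lambda>x. (u x)^4)"
  shows "(\<lambda>n. flux_bound u g (real (Suc n))) \<longlonglongrightarrow> 0"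
proof -
  define A where "A = 72 * sqrt (\<integral>x. (norm (g x))\<^sup>2 \<partial>lborel)
    + 44 * sqrt ((\<integral>x. (u x)^4 \<partial>lborel) + 8 * unit_ball_vol 3)"
  have le: "flux_bound u g (real (Suc n)) \<le> radial_moment g (real (Suc n)) / real (Suc n) * A" for n
  proof -
    let ?R = "real (Suc n)"
    have R: "0 < ?R" "1 \<le> ?R" by auto
    have "(\<integral>x. indicator (cball 0 (2 * ?R)) x * (u x)\<^sup>2 \<partial>lborel)
        \<le> ?R * (\<integral>x. (u x)^4 \<partial>lborel) + unit_ball_vol 3 * (2 * ?R) ^ 3 / ?R"
      by (rule local_square_le_quartic[OF bounded_borel_C1_approx[OF F] u4]) auto
    also have "\<dots> = ?R * (\<integral>x. (u x)^4 \<partial>lborel) + ?R\<^sup>2 * (8 * unit_ball_vol 3)"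
      using R(1) by (simp add: power2_eq_square power3_eq_cube field_simps del: of_nat_Suc)
    also have "?R * (\<integral>x. (u x)^4 \<partial>lborel) \<le> ?R\<^sup>2 * (\<integral>x. (u x)^4 \<partial>lborel)"
      using R by (intro mult_right_mono) (auto simp: power2_eq_square)
    finally have "(\<integral>x. indicator (cball 0 (2 * ?R)) x * (u x)\<^sup>2 \<partial>lborel)
        \<le> ?R\<^sup>2 * ((\<integral>x. (u x)^4 \<partial>lborel) + 8 * unit_ball_vol 3)" by (simp add: distrib_left)
    from real_sqrt_le_mono[OF this]
    have "sqrt (\<integral>x. indicator (cball 0 (2 * ?R)) x * (u x)\<^sup>2 \<partial>lborel)
        \<le> ?R * sqrt ((\<integral>x. (u x)^4 \<partial>lborel) + 8 * unit_ball_vol 3)"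
      by (simp add: real_sqrt_mult)
    then have "sqrt (\<integral>x. indicator (cball 0 (2 * ?R)) x * (u x)\<^sup>2 \<partial>lborel) / ?R
        \<le> sqrt ((\<integral>x. (u x)^4 \<partial>lborel) + 8 * unit_ball_vol 3)"
      using R(1) by (simp add: divide_le_eq mult.commute del: of_nat_Suc)
    then show ?thesis unfolding flux_bound_def A_def
      by (intro mult_left_mono add_mono) (auto simp: radial_moment_def)
  qed
  have ge: "0 \<le> flux_bound u g (real (Suc n))" for n
    unfolding flux_bound_def by (auto simp: radial_moment_def intro!: mult_nonneg_nonneg divide_nonneg_nonneg add_nonneg_nonneg)
  have "(\<lambda>n. radial_moment g (real (Suc n)) / real (Suc n) * A) \<longlonglongrightarrow> 0 * A"
    by (intro tendsto_intros radial_moment_tendsto C1_approxD(2)[OF F] g)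
  then have "(\<lambda>n. radial_moment g (real (Suc n)) / real (Suc n) * A) \<longlonglongrightarrow> 0" by simp
  then show ?thesis
    by (rule tendsto_sandwich[OF _ _ tendsto_const, rotated 2]) (use le ge in auto)
qed

lemma potential_integral_le_0:
  assumes U: "neumann_weak C u gu Fu Gu (\<lambda>x. u x * (v x)\<^sup>2)"
    and V: "neumann_weak C v gv Fv Gv (\<lambda>x. (u x)\<^sup>2 * v x)"
    and gu: "integrable lborel (\<lambda>x. (norm (gu x))\<^sup>2)" and gv: "integrable lborel (\<lambda>x. (norm (gv x))\<^sup>2)"
    and u4: "integrable lborel (\<lambda>x. (u x)^4)" and v4: "integrable lborel (\<lambda>x. (v x)^4)"
  shows "(\<integral>x. (u x)\<^sup>2 * (v x)\<^sup>2 \<partial>lborel) \<le> 0"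
proof -
  have Fu: "C1_approx C u gu Fu Gu" and Fv: "C1_approx C v gv Fv Gv"
    using U V by (auto simp: neumann_weak_def)
  note bu = bounded_borel_C1_approx[OF Fu] and bv = bounded_borel_C1_approx[OF Fv]
  let ?R = "\<lambda>n. real (Suc n)"
  show ?thesis
  proof (rule integral_Fatou_bound(2)[where F="\<lambda>n x. ball_cutoff (?R n) x * ((u x)\<^sup>2 * (v x)\<^sup>2)"])
    show "(\<lambda>n. flux_bound u gu (?R n) + flux_bound v gv (?R n)) \<longlonglongrightarrow> 0"
      using tendsto_add[OF flux_bound_tendsto[OF Fu gu u4] flux_bound_tendsto[OF Fv gv v4]] by simp
    show "(\<integral>x. ball_cutoff (?R n) x * ((u x)\<^sup>2 * (v x)\<^sup>2) \<partial>lborel) \<le> flux_bound u gu (?R n) + flux_bound v gv (?R n)" for n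
      by (rule truncated_potential_le_flux[OF U V gu gv]) simp
    show "integrable lborel (\<lambda>x. ball_cutoff (?R n) x * ((u x)\<^sup>2 * (v x)\<^sup>2))" for n
    proof (rule bounded_borel_integrable[where R="?R n"])
      note \<eta> = cutoff_ball_cutoff[of "?R n"]
      show "bounded_borel (\<lambda>x. ball_cutoff (?R n) x * ((u x)\<^sup>2 * (v x)\<^sup>2))"
        by (intro bounded_borel_intros bu bv bounded_borel_cutoff(1)[OF \<eta>]) simp
      show "ball_cutoff (?R n) x * ((u x)\<^sup>2 * (v x)\<^sup>2) = 0" if "?R n < norm x" for x
        using \<eta> that by (simp add: cutoff_def)
    qed
    show "0 \<le> ball_cutoff (?R n) x * ((u x)\<^sup>2 * (v x)\<^sup>2)" for n x
      using ball_cutoff_bounds by (intro mult_nonneg_nonneg) auto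
    show "(\<lambda>n. ball_cutoff (?R n) x * ((u x)\<^sup>2 * (v x)\<^sup>2)) \<longlonglongrightarrow> (u x)\<^sup>2 * (v x)\<^sup>2" for x
      using tendsto_mult[OF ball_cutoff_tendsto[of x] tendsto_const[of "(u x)\<^sup>2 * (v x)\<^sup>2"]] by simp
    show "(\<lambda>x. (u x)\<^sup>2 * (v x)\<^sup>2) \<in> borel_measurable lborel"
      using bounded_borel_measurable[OF bounded_borel_mult[OF bounded_borel_power[OF bu] bounded_borel_power[OF bv]], of 2 2]
      by simp
  qed
qed

text \<open>Invariance under the single dilation by 2 suffices, so there is no detour through local
  constancy and connectedness of the half-space.\<close>

lemma vanishing_gradient_imp_zero:
  assumes F: "C1_approx C u g F G" and g: "integrable lborel (\<lambda>x. (norm (g x))\<^sup>2)"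
    and g0: "(\<integral>x. (norm (g x))\<^sup>2 \<partial>lborel) \<le> 0" and u4: "integrable lborel (\<lambda>x. (u x)^4)"
  shows "AE x in lborel. u x = 0"
proof -
  note bu = bounded_borel_C1_approx[OF F]
  note [measurable] = bounded_borel_measurable[OF bu]
  \<comment> \<open>The dilation estimate is local; countably many balls exhaust the space and keep
    one common null set.\<close>
  have "AE x in lborel. \<forall>n::nat. indicator (cball 0 (2 * real n)) x * (u (2 *\<^sub>R x) - u x) = 0"
    unfolding AE_all_countable
  proof
    fix n :: nat
    let ?d = "\<lambda>x. indicator (cball 0 (2 * real n)) x * (u (2 *\<^sub>R x) - u x)"
    have b: "bounded_borel ?d" by (intro bounded_borel_intros bu) simp
    have i: "integrable lborel (\<lambda>x. (?d x)\<^sup>2)"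
      by (rule bounded_borel_integrable[where R="2 * real n"]) (use bounded_borel_power[OF b, of 2] in simp_all)
    have "(\<integral>x. (?d x)\<^sup>2 \<partial>lborel) \<le> 32 * (real n)\<^sup>2 * 1\<^sup>2 * (\<integral>x. (norm (g x))\<^sup>2 \<partial>lborel)"
      by (rule C1_approx_dilation_estimate_global[OF F g]) auto
    also have "\<dots> \<le> 0" using g0 by (simp add: mult_nonneg_nonpos)
    finally have "(\<integral>x. (?d x)\<^sup>2 \<partial>lborel) = 0"
      using integral_nonneg_AE[of "\<lambda>x. (?d x)\<^sup>2" lborel] by (simp add: order_antisym)
    then have "AE x in lborel. (?d x)\<^sup>2 = 0"
      using integral_nonneg_eq_0_iff_AE[OF i] by simp
    then show "AE x in lborel. ?d x = 0" by simp
  qed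
  then have eq: "AE x in lborel. u (2 *\<^sub>R x) = u x"
  proof (rule AE_mp, intro AE_I2 impI)
    fix x :: "real^3" assume *: "\<forall>n::nat. indicator (cball 0 (2 * real n)) x * (u (2 *\<^sub>R x) - u x) = 0"
    obtain N :: nat where "norm x \<le> real N" using real_arch_simple by blast
    then have "x \<in> cball 0 (2 * real N)" by simp
    then show "u (2 *\<^sub>R x) = u x" using *[rule_format, of N] by simp
  qed
  \<comment> \<open>The Jacobian 2^3 makes a finite number equal to eight times itself.\<close>
  have "(\<integral>x. (u x)^4 \<partial>lborel) = 8 * (\<integral>x. (u (2 *\<^sub>R x))^4 \<partial>lborel)"
    using lborel_integral_affine[of "\<lambda>x. (u x)^4" 2 0] by simp
  also have "(\<integral>x. (u (2 *\<^sub>R x))^4 \<partial>lborel) = (\<integral>x. (u x)^4 \<partial>lborel)"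
    by (rule integral_cong_AE) (use eq in auto)
  finally have "(\<integral>x. (u x)^4 \<partial>lborel) = 0" by simp
  then have "AE x in lborel. (u x)^4 = 0"
    using integral_nonneg_eq_0_iff_AE[OF u4] by simp
  then show ?thesis by simp
qed

lemma neumann_system_trivial:
  assumes U: "neumann_weak C u gu Fu Gu (\<lambda>x. u x * (v x)\<^sup>2)"
    and V: "neumann_weak C v gv Fv Gv (\<lambda>x. (u x)\<^sup>2 * v x)"
    and stab: "stable_outside R0 u v" and R0: "0 < R0"
  shows "AE x in lborel. u x = 0" "AE x in lborel. v x = 0"
proof -
  have Fu: "C1_approx C u gu Fu Gu" and Fv: "C1_approx C v gv Fv Gv"
    using U V by (auto simp: neumann_weak_def)
  note [measurable] = C1_approxD(1)[OF Fu] C1_approxD(1)[OF Fv]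
  note w = stable_outside_quartic_integrable[OF U V stab R0]
  have sq: "((u x)\<^sup>2 + (v x)\<^sup>2)\<^sup>2 = (u x)^4 + (v x)^4 + 2 * ((u x)\<^sup>2 * (v x)\<^sup>2)" for x
    by (simp add: power2_eq_square power4_eq_xxxx algebra_simps)
  have nn: "0 \<le> (u x)^4" "0 \<le> (v x)^4" "0 \<le> (u x)\<^sup>2 * (v x)\<^sup>2" for x by simp_all
  have u4: "integrable lborel (\<lambda>x. (u x)^4)" and v4: "integrable lborel (\<lambda>x. (v x)^4)"
    and uv: "integrable lborel (\<lambda>x. (u x)\<^sup>2 * (v x)\<^sup>2)"
    by (rule Bochner_Integration.integrable_bound[OF w]; (simp add: sq nn)?)+
  have e: "u x * (v x)\<^sup>2 * u x = (u x)\<^sup>2 * (v x)\<^sup>2" "(u x)\<^sup>2 * v x * v x = (u x)\<^sup>2 * (v x)\<^sup>2" for x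
    by (simp_all add: power2_eq_square)
  have i: "integrable lborel (\<lambda>x. u x * (v x)\<^sup>2 * u x)" "integrable lborel (\<lambda>x. (u x)\<^sup>2 * v x * v x)"
    unfolding e by (rule uv)+
  have p: "0 \<le> u x * (v x)\<^sup>2 * u x" "0 \<le> (u x)\<^sup>2 * v x * v x" for x
    unfolding e by simp_all
  note gu = neumann_weak_gradient_integrable[OF U u4 i(1) p(1), unfolded e(1)]
    and gv = neumann_weak_gradient_integrable[OF V v4 i(2) p(2), unfolded e(2)]
  have "(\<integral>x. (u x)\<^sup>2 * (v x)\<^sup>2 \<partial>lborel) \<le> 0"
    by (rule potential_integral_le_0[OF U V gu(1) gv(1) u4 v4])
  then show "AE x in lborel. u x = 0" "AE x in lborel. v x = 0"
    using vanishing_gradient_imp_zero[OF Fu gu(1) _ u4] vanishing_gradient_imp_zero[OF Fv gv(1) _ v4] gu(2) gv(2)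
    by auto
qed

section \<open>Borel representatives\<close>

lemma AE_lborel_imp_halfspace: "AE x in lborel. P x \<Longrightarrow> AE x in lebesgue_on halfspace. P x"
proof -
  assume "AE x in lborel. P x"
  then have "AE x in lebesgue. P x" by (rule AE_completion)
  then show ?thesis by (subst AE_restrict_space_iff) (auto elim: AE_mp)
qed

text \<open>Found coordinate by coordinate and set to zero off the half-space. Passing to Borel
  functions on \<open>lborel\<close> makes product measurability, Tonelli and affine substitution
  directly applicable.\<close>

lemma borel_representative:
  fixes f :: "real^3 \<Rightarrow> 'b::euclidean_space"
  assumes f: "f \<in> borel_measurable (lebesgue_on halfspace)"
  obtains f' where "f' \<in> borel_measurable borel" "\<And>x. x \<notin> halfspace \<Longrightarrow> f' x = 0"
    "AE x in lebesgue_on halfspace. f x = f' x"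
proof -
  have "\<exists>h \<in> borel_measurable lborel. AE x in lborel. (f x \<bullet> b) * indicator halfspace x = h x" for b
  proof (rule completion_ex_borel_measurable_real)
    have "(\<lambda>x. f x \<bullet> b) \<in> borel_measurable (lebesgue_on halfspace)" by (intro borel_measurable_inner f) simp
    then show "(\<lambda>x. (f x \<bullet> b) * indicator halfspace x) \<in> borel_measurable lebesgue"
      by (subst (asm) borel_measurable_restrict_space_iff) (auto simp: mult.commute)
  qed
  then have "\<forall>b. \<exists>h. h \<in> borel_measurable lborel \<and>
      (AE x in lborel. (f x \<bullet> b) * indicator halfspace x = h x)"
    by blast
  from choice[OF this] obtain h where h: "\<And>b. h b \<in> borel_measurable lborel"
    "\<And>b. AE x in lborel. (f x \<bullet> b) * indicator halfspace x = h b x" by blast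
  have [measurable]: "h b \<in> borel_measurable borel" for b using h(1)[of b] by simp
  define f' where "f' x = indicator halfspace x *\<^sub>R (\<Sum>b\<in>Basis. h b x *\<^sub>R b)" for x
  show ?thesis
  proof (rule that[of f'])
    show "f' \<in> borel_measurable borel" unfolding f'_def[abs_def] by measurable
    have "AE x in lborel. \<forall>b\<in>Basis. (f x \<bullet> b) * indicator halfspace x = h b x"
      by (rule AE_finite_allI) (use h(2) in auto)
    from AE_lborel_imp_halfspace[OF this]
    show "AE x in lebesgue_on halfspace. f x = f' x"
    proof (rule AE_mp, intro AE_I2 impI)
      fix x assume x: "x \<in> space (lebesgue_on halfspace)"
        and *: "\<forall>b\<in>Basis. (f x \<bullet> b) * indicator halfspace x = h b x"
      have xH: "x \<in> halfspace" using x by simp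
      have "(\<Sum>b\<in>Basis. h b x *\<^sub>R b) = (\<Sum>b\<in>Basis. (f x \<bullet> b) *\<^sub>R b)"
        by (rule sum.cong) (use * xH in auto)
      then show "f x = f' x" using xH by (simp add: f'_def euclidean_representation)
    qed
  qed (simp add: f'_def)
qed

lemma integral_halfspace_eq:
  fixes f :: "real^3 \<Rightarrow> 'b::euclidean_space"
  assumes f: "f \<in> borel_measurable (lebesgue_on halfspace)" and f': "f' \<in> borel_measurable borel"
    and zero: "\<And>x. x \<notin> halfspace \<Longrightarrow> f' x = 0" and eq: "AE x in lebesgue_on halfspace. f x = f' x"
  shows "(\<integral>x. f x \<partial>lebesgue_on halfspace) = (\<integral>x. f' x \<partial>lborel)"
proof -
  have f'L: "f' \<in> borel_measurable lebesgue" using f' by (auto intro: measurable_completion)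
  have "(\<integral>x. f x \<partial>lebesgue_on halfspace) = (\<integral>x. f' x \<partial>lebesgue_on halfspace)"
    by (rule integral_cong_AE[OF f _ eq]) (rule measurable_restrict_space1[OF f'L])
  also have "\<dots> = (\<integral>x. indicator halfspace x *\<^sub>R f' x \<partial>lebesgue)"
    by (rule integral_restrict_space) auto
  also have "(\<lambda>x. indicator halfspace x *\<^sub>R f' x) = f'"
    using zero by (auto simp: fun_eq_iff indicator_def)
  also have "(\<integral>x. f' x \<partial>lebesgue) = (\<integral>x. f' x \<partial>lborel)"
    using f' by (intro integral_completion) simp
  finally show ?thesis .
qed

text \<open>Resetting the values that exceed the essential bound to 0 alters the function on a null
  set only, and the bound then holds at every point.\<close>

lemma ess_bounded_representative:
  assumes "ess_bounded u"
  obtains u' C where "u' \<in> borel_measurable borel" "\<And>x. x \<notin> halfspace \<Longrightarrow> u' x = 0" "\<And>x. \<bar>u' x\<bar> \<le> C"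
    "AE x in lebesgue_on halfspace. u x = u' x"
proof -
  from assms obtain C where m: "u \<in> borel_measurable (lebesgue_on halfspace)"
    and C: "AE x in lebesgue_on halfspace. \<bar>u x\<bar> \<le> C" by (auto simp: ess_bounded_def)
  obtain f where f: "f \<in> borel_measurable borel" "\<And>x. x \<notin> halfspace \<Longrightarrow> f x = 0"
    "AE x in lebesgue_on halfspace. u x = f x"
    by (rule borel_representative[OF m]) blast
  note [measurable] = f(1)
  define u' where "u' x = (if \<bar>f x\<bar> \<le> C then f x else 0)" for x
  show ?thesis
  proof (rule that[of u' "\<bar>C\<bar>"])
    show "u' \<in> borel_measurable borel" unfolding u'_def[abs_def] by measurable
    show "u' x = 0" if "x \<notin> halfspace" for x using f(2)[OF that] by (simp add: u'_def)
    show "\<bar>u' x\<bar> \<le> \<bar>C\<bar>" for x by (auto simp: u'_def)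
    show "AE x in lebesgue_on halfspace. u x = u' x"
      using f(3) C by eventually_elim (simp add: u'_def)
  qed
qed

lemma L2loc_representative:
  fixes g :: "real^3 \<Rightarrow> real^3"
  assumes "L2loc g"
  obtains g' where "g' \<in> borel_measurable borel" "\<And>x. x \<notin> halfspace \<Longrightarrow> g' x = 0"
    "AE x in lebesgue_on halfspace. g x = g' x"
    "\<And>R. square_integrable lborel (\<lambda>x. indicator (cball 0 R) x *\<^sub>R g' x)"
proof -
  from assms have m: "g \<in> borel_measurable (lebesgue_on halfspace)"
    and L2: "\<And>R. integrable (lebesgue_on (halfspace \<inter> ball 0 R)) (\<lambda>x. (norm (g x))\<^sup>2)"
    by (auto simp: L2loc_def)
  obtain g' where g': "g' \<in> borel_measurable borel" "\<And>x. x \<notin> halfspace \<Longrightarrow> g' x = 0"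
    and ae: "AE x in lebesgue_on halfspace. g x = g' x"
    by (rule borel_representative[OF m]) blast
  note [measurable] = g'(1)
  have "square_integrable lborel (\<lambda>x. indicator (cball 0 R) x *\<^sub>R g' x)" for R
  proof -
    \<comment> \<open>\<open>L2loc\<close> speaks of open balls; the radius \<open>R + 1\<close>
      accommodates the closed ball of radius \<open>R\<close>.\<close>
    let ?A = "halfspace \<inter> ball 0 (R + 1) :: (real^3) set"
    have A [measurable]: "?A \<in> sets borel" by (intro sets.Int borel_open) auto
    have AL: "?A \<in> sets lebesgue" using A by simp
    have ae': "AE x in lebesgue_on ?A. g x = g' x"
      using ae AL by (subst AE_restrict_space_iff, simp, subst (asm) AE_restrict_space_iff) (auto elim: AE_mp)
    have g'L: "(\<lambda>x. (norm (g' x))\<^sup>2) \<in> borel_measurable lebesgue"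
      by (intro measurable_completion) simp
    have "AE x in lebesgue_on ?A. (norm (g x))\<^sup>2 = (norm (g' x))\<^sup>2"
      using ae' by eventually_elim simp
    then have "integrable (lebesgue_on ?A) (\<lambda>x. (norm (g' x))\<^sup>2)"
      using integrable_cong_AE_imp[OF L2[of "R + 1"] measurable_restrict_space1[OF g'L]] by (simp add: eq_commute)
    then have "integrable lebesgue (\<lambda>x. indicator ?A x *\<^sub>R (norm (g' x))\<^sup>2)"
      using AL by (subst (asm) integrable_restrict_space) auto
    then have i: "integrable lborel (\<lambda>x. indicator ?A x *\<^sub>R (norm (g' x))\<^sup>2)"
      by (subst (asm) integrable_completion) measurable
    show ?thesis
    proof (rule square_integrable_bound[OF i])
      show "(norm (indicator (cball 0 R) x *\<^sub>R g' x))\<^sup>2 \<le> indicator ?A x *\<^sub>R (norm (g' x))\<^sup>2" for x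
        using g'(2)[of x] by (auto simp: indicator_def)
    qed measurable
  qed
  then show ?thesis using that g' ae by blast
qed

text \<open>Connects the given notion of solution with \<open>neumann_weak\<close>: every integral
  over the half-space becomes one over the whole space, and mollification of the representatives in
  the inner normal direction provides the approximating sequences.\<close>

lemma neumann_weak_representative:
  assumes H: "H1loc_grad u g" and b: "b \<in> borel_measurable (lebesgue_on halfspace)"
    and weak: "\<And>\<phi>. \<phi> \<in> C1c (closure halfspace) \<Longrightarrow>
      (\<integral>x. g x \<bullet> grad \<phi> x \<partial>lebesgue_on halfspace) = (\<integral>x. b x * \<phi> x \<partial>lebesgue_on halfspace)"
    and u': "u' \<in> borel_measurable borel" "\<And>x. x \<notin> halfspace \<Longrightarrow> u' x = 0" "\<And>x. \<bar>u' x\<bar> \<le> C"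
      "AE x in lebesgue_on halfspace. u x = u' x"
    and b': "bounded_borel b'" "\<And>x. x \<notin> halfspace \<Longrightarrow> b' x = 0" "AE x in lebesgue_on halfspace. b x = b' x"
  shows "\<exists>g' F G. neumann_weak C u' g' F G b'"
proof -
  have m: "u \<in> borel_measurable (lebesgue_on halfspace)" "g \<in> borel_measurable (lebesgue_on halfspace)"
    "b \<in> borel_measurable (lebesgue_on halfspace)"
    using H b by (auto simp: H1loc_grad_def L2loc_def)
  have gL: "L2loc g" using H by (simp add: H1loc_grad_def)
  obtain g' where g': "g' \<in> borel_measurable borel" "\<And>x. x \<notin> halfspace \<Longrightarrow> g' x = 0"
    "AE x in lebesgue_on halfspace. g x = g' x"
    "\<And>R. square_integrable lborel (\<lambda>x. indicator (cball 0 R) x *\<^sub>R g' x)"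
    by (rule L2loc_representative[OF gL]) blast
  have "C1_approx C u' g' (\<lambda>n. mollify (axis 3 1) n u') (\<lambda>n. mollify (axis 3 1) n g')"
  proof (rule C1_approx_mollify[OF u'(1) g'(1) u'(3,2) g'(2,4)])
    fix \<phi> assume \<phi>: "\<phi> \<in> C1c halfspace"
    note B = C1c_halfspace_borel[OF \<phi> subset_refl]
    have "(\<integral>x. u x *\<^sub>R grad \<phi> x \<partial>lebesgue_on halfspace) = (\<integral>x. u' x *\<^sub>R (indicator halfspace x *\<^sub>R grad \<phi> x) \<partial>lborel)"
    proof (rule integral_halfspace_eq)
      show "AE x in lebesgue_on halfspace. u x *\<^sub>R grad \<phi> x = u' x *\<^sub>R (indicator halfspace x *\<^sub>R grad \<phi> x)"
        using u'(4) AE_space by eventually_elim simp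
      show "(\<lambda>x. u x *\<^sub>R grad \<phi> x) \<in> borel_measurable (lebesgue_on halfspace)"
        by (rule borel_measurable_scaleR[OF m(1) B(2)])
      show "(\<lambda>x. u' x *\<^sub>R (indicator halfspace x *\<^sub>R grad \<phi> x)) \<in> borel_measurable borel"
        by (rule borel_measurable_scaleR[OF u'(1) B(4)])
    qed (use u'(2) in simp)
    moreover have "u' x *\<^sub>R (indicator halfspace x *\<^sub>R grad \<phi> x) = u' x *\<^sub>R grad \<phi> x" for x
      using u'(2)[of x] by (auto simp: indicator_def)
    moreover have "(\<integral>x. \<phi> x *\<^sub>R g x \<partial>lebesgue_on halfspace) = (\<integral>x. (indicator halfspace x *\<^sub>R \<phi> x) *\<^sub>R g' x \<partial>lborel)"
    proof (rule integral_halfspace_eq)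
      show "AE x in lebesgue_on halfspace. \<phi> x *\<^sub>R g x = (indicator halfspace x *\<^sub>R \<phi> x) *\<^sub>R g' x"
        using g'(3) AE_space by eventually_elim simp
      show "(\<lambda>x. (indicator halfspace x *\<^sub>R \<phi> x) *\<^sub>R g' x) \<in> borel_measurable borel"
        by (rule borel_measurable_scaleR[OF B(3) g'(1)])
      show "(\<lambda>x. \<phi> x *\<^sub>R g x) \<in> borel_measurable (lebesgue_on halfspace)"
        by (rule borel_measurable_scaleR[OF B(1) m(2)])
    qed (use g'(2) in simp)
    moreover have "(indicator halfspace x *\<^sub>R \<phi> x) *\<^sub>R g' x = \<phi> x *\<^sub>R g' x" for x
      using g'(2)[of x] by (auto simp: indicator_def)
    moreover have "(\<integral>x. u x *\<^sub>R grad \<phi> x \<partial>lebesgue_on halfspace) = - (\<integral>x. \<phi> x *\<^sub>R g x \<partial>lebesgue_on halfspace)"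
      using H \<phi> by (auto simp: H1loc_grad_def weak_gradient_def)
    ultimately show "(\<integral>x. u' x *\<^sub>R grad \<phi> x \<partial>lborel) = - (\<integral>x. \<phi> x *\<^sub>R g' x \<partial>lborel)"
      by (simp only:)
  qed
  moreover have "(\<integral>x. g' x \<bullet> grad \<phi> x \<partial>lborel) = (\<integral>x. b' x * \<phi> x \<partial>lborel)"
    if \<phi>: "\<phi> \<in> C1c (closure halfspace)" for \<phi>
  proof -
    note B = C1c_halfspace_borel[OF \<phi> closure_subset]
    have "(\<integral>x. g x \<bullet> grad \<phi> x \<partial>lebesgue_on halfspace) = (\<integral>x. g' x \<bullet> (indicator halfspace x *\<^sub>R grad \<phi> x) \<partial>lborel)"
    proof (rule integral_halfspace_eq)
      show "AE x in lebesgue_on halfspace. g x \<bullet> grad \<phi> x = g' x \<bullet> (indicator halfspace x *\<^sub>R grad \<phi> x)"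
        using g'(3) AE_space by eventually_elim simp
      show "(\<lambda>x. g' x \<bullet> (indicator halfspace x *\<^sub>R grad \<phi> x)) \<in> borel_measurable borel"
        by (rule borel_measurable_inner[OF g'(1) B(4)])
      show "(\<lambda>x. g x \<bullet> grad \<phi> x) \<in> borel_measurable (lebesgue_on halfspace)"
        by (rule borel_measurable_inner[OF m(2) B(2)])
    qed (use g'(2) in simp)
    moreover have "g' x \<bullet> (indicator halfspace x *\<^sub>R grad \<phi> x) = g' x \<bullet> grad \<phi> x" for x
      using g'(2)[of x] by (auto simp: indicator_def)
    moreover have "(\<integral>x. b x * \<phi> x \<partial>lebesgue_on halfspace) = (\<integral>x. b' x * (indicator halfspace x *\<^sub>R \<phi> x) \<partial>lborel)"
    proof (rule integral_halfspace_eq)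
      show "AE x in lebesgue_on halfspace. b x * \<phi> x = b' x * (indicator halfspace x *\<^sub>R \<phi> x)"
        using b'(3) AE_space by eventually_elim simp
      show "(\<lambda>x. b' x * (indicator halfspace x *\<^sub>R \<phi> x)) \<in> borel_measurable borel"
        by (rule borel_measurable_times[OF bounded_borel_measurable[OF b'(1)] B(3)])
      show "(\<lambda>x. b x * \<phi> x) \<in> borel_measurable (lebesgue_on halfspace)"
        by (rule borel_measurable_times[OF m(3) B(1)])
    qed (use b'(2) in simp)
    moreover have "b' x * (indicator halfspace x *\<^sub>R \<phi> x) = b' x * \<phi> x" for x
      using b'(2)[of x] by (auto simp: indicator_def)
    ultimately show ?thesis using weak[OF \<phi>] by (simp only:)
  qed
  ultimately show ?thesis unfolding neumann_weak_def using b' by blast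
qed

lemma Qform_representative:
  assumes \<phi>: "\<phi> \<in> C1c (closure halfspace)" and \<psi>: "\<psi> \<in> C1c (closure halfspace)"
    and m: "u \<in> borel_measurable (lebesgue_on halfspace)" "v \<in> borel_measurable (lebesgue_on halfspace)"
    and u': "u' \<in> borel_measurable borel" "\<And>x. x \<notin> halfspace \<Longrightarrow> u' x = 0"
      "AE x in lebesgue_on halfspace. u x = u' x"
    and v': "v' \<in> borel_measurable borel" "\<And>x. x \<notin> halfspace \<Longrightarrow> v' x = 0"
      "AE x in lebesgue_on halfspace. v x = v' x"
  shows "Qform u v \<phi> \<psi> =
    (\<integral>x. indicator halfspace x * ((norm (grad \<phi> x))\<^sup>2 + (norm (grad \<psi> x))\<^sup>2) \<partial>lborel)
    - (\<integral>x. (v' x)\<^sup>2 * (\<phi> x)\<^sup>2 + (u' x)\<^sup>2 * (\<psi> x)\<^sup>2 + 4 * u' x * v' x * \<phi> x * \<psi> x \<partial>lborel)"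
proof -
  note B\<phi> = C1c_halfspace_borel[OF \<phi> closure_subset]
  note B\<psi> = C1c_halfspace_borel[OF \<psi> closure_subset]
  let ?I = "indicator halfspace :: real^3 \<Rightarrow> real"
  have gm: "(\<lambda>x. ?I x * ((norm (grad \<phi> x))\<^sup>2 + (norm (grad \<psi> x))\<^sup>2)) \<in> borel_measurable borel"
  proof -
    have "(\<lambda>x. (norm (?I x *\<^sub>R grad \<phi> x))\<^sup>2 + (norm (?I x *\<^sub>R grad \<psi> x))\<^sup>2) \<in> borel_measurable borel"
      by (intro borel_measurable_add borel_measurable_power
          measurable_compose[OF B\<phi>(4) borel_measurable_norm] measurable_compose[OF B\<psi>(4) borel_measurable_norm])
    moreover have "(norm (?I x *\<^sub>R grad \<phi> x))\<^sup>2 + (norm (?I x *\<^sub>R grad \<psi> x))\<^sup>2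
        = ?I x * ((norm (grad \<phi> x))\<^sup>2 + (norm (grad \<psi> x))\<^sup>2)" for x
      by (auto simp: indicator_def)
    ultimately show ?thesis by (simp only:)
  qed
  have 1: "(\<integral>x. (norm (grad \<phi> x))\<^sup>2 + (norm (grad \<psi> x))\<^sup>2 \<partial>lebesgue_on halfspace)
     = (\<integral>x. ?I x * ((norm (grad \<phi> x))\<^sup>2 + (norm (grad \<psi> x))\<^sup>2) \<partial>lborel)"
  proof (rule integral_halfspace_eq[OF _ gm])
    show "AE x in lebesgue_on halfspace. (norm (grad \<phi> x))\<^sup>2 + (norm (grad \<psi> x))\<^sup>2
        = ?I x * ((norm (grad \<phi> x))\<^sup>2 + (norm (grad \<psi> x))\<^sup>2)"
      using AE_space by eventually_elim simp
    show "(\<lambda>x. (norm (grad \<phi> x))\<^sup>2 + (norm (grad \<psi> x))\<^sup>2) \<in> borel_measurable (lebesgue_on halfspace)"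
      by (intro borel_measurable_add borel_measurable_power
          measurable_compose[OF B\<phi>(2) borel_measurable_norm] measurable_compose[OF B\<psi>(2) borel_measurable_norm])
  qed simp
  let ?q = "\<lambda>x. (v' x)\<^sup>2 * (?I x *\<^sub>R \<phi> x)\<^sup>2 + (u' x)\<^sup>2 * (?I x *\<^sub>R \<psi> x)\<^sup>2 + 4 * u' x * v' x * (?I x *\<^sub>R \<phi> x) * (?I x *\<^sub>R \<psi> x)"
  have 2: "(\<integral>x. (v x)\<^sup>2 * (\<phi> x)\<^sup>2 + (u x)\<^sup>2 * (\<psi> x)\<^sup>2 + 4 * u x * v x * \<phi> x * \<psi> x \<partial>lebesgue_on halfspace) = (\<integral>x. ?q x \<partial>lborel)"
  proof (rule integral_halfspace_eq)
    show "(\<lambda>x. (v x)\<^sup>2 * (\<phi> x)\<^sup>2 + (u x)\<^sup>2 * (\<psi> x)\<^sup>2 + 4 * u x * v x * \<phi> x * \<psi> x) \<in> borel_measurable (lebesgue_on halfspace)"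
      by (intro borel_measurable_add borel_measurable_power borel_measurable_times borel_measurable_const m B\<phi> B\<psi>)
    show "?q \<in> borel_measurable borel"
      by (intro borel_measurable_add borel_measurable_power borel_measurable_times borel_measurable_const u'(1) v'(1) B\<phi> B\<psi>)
    show "AE x in lebesgue_on halfspace. (v x)\<^sup>2 * (\<phi> x)\<^sup>2 + (u x)\<^sup>2 * (\<psi> x)\<^sup>2 + 4 * u x * v x * \<phi> x * \<psi> x = ?q x"
      using u'(3) v'(3) AE_space by eventually_elim simp
  qed simp
  have "?q x = (v' x)\<^sup>2 * (\<phi> x)\<^sup>2 + (u' x)\<^sup>2 * (\<psi> x)\<^sup>2 + 4 * u' x * v' x * \<phi> x * \<psi> x" for x
    using u'(2)[of x] v'(2)[of x] by (cases "x \<in> halfspace") auto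
  then show ?thesis unfolding Qform_def 1 2 by (simp only:)
qed

theorem proposition3p3:
  fixes u v :: "real^3 \<Rightarrow> real"
  assumes "weak_Neumann_solution u v"
    and "ess_bounded u" and "ess_bounded v"
    and "morse_index u v < \<infinity>"
  shows "AE x in lebesgue_on halfspace. u x = 0 \<and> v x = 0"
proof -
  obtain u' A where u': "u' \<in> borel_measurable borel" "\<And>x. x \<notin> halfspace \<Longrightarrow> u' x = 0" "\<And>x. \<bar>u' x\<bar> \<le> A"
    "AE x in lebesgue_on halfspace. u x = u' x"
    by (rule ess_bounded_representative[OF assms(2)]) blast
  obtain v' B where v': "v' \<in> borel_measurable borel" "\<And>x. x \<notin> halfspace \<Longrightarrow> v' x = 0" "\<And>x. \<bar>v' x\<bar> \<le> B"
    "AE x in lebesgue_on halfspace. v x = v' x"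
    by (rule ess_bounded_representative[OF assms(3)]) blast
  \<comment> \<open>The estimates for the system use one bound for both components.\<close>
  define C where "C = max A B"
  have C: "\<bar>u' x\<bar> \<le> C" "\<bar>v' x\<bar> \<le> C" for x
    using u'(3)[of x] v'(3)[of x] by (auto simp: C_def)
  have m: "u \<in> borel_measurable (lebesgue_on halfspace)" "v \<in> borel_measurable (lebesgue_on halfspace)"
    using assms(2,3) by (auto simp: ess_bounded_def)
  have bd: "bounded_borel u'" "bounded_borel v'"
    by (rule bounded_borelI[OF u'(1) C(1)], rule bounded_borelI[OF v'(1) C(2)])
  obtain gu gv where gu: "H1loc_grad u gu" and gv: "H1loc_grad v gv"
    and weak: "\<And>\<phi>. \<phi> \<in> C1c (closure halfspace) \<Longrightarrow>
        (\<integral>x. gu x \<bullet> grad \<phi> x \<partial>lebesgue_on halfspace) = (\<integral>x. u x * (v x)\<^sup>2 * \<phi> x \<partial>lebesgue_on halfspace)"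
      "\<And>\<phi>. \<phi> \<in> C1c (closure halfspace) \<Longrightarrow>
        (\<integral>x. gv x \<bullet> grad \<phi> x \<partial>lebesgue_on halfspace) = (\<integral>x. (u x)\<^sup>2 * v x * \<phi> x \<partial>lebesgue_on halfspace)"
    using assms(1) unfolding weak_Neumann_solution_def by blast
  have "\<exists>g F G. neumann_weak C u' g F G (\<lambda>x. u' x * (v' x)\<^sup>2)"
  proof (rule neumann_weak_representative[OF gu _ weak(1) u'(1,2) C(1) u'(4)])
    show "(\<lambda>x. u x * (v x)\<^sup>2) \<in> borel_measurable (lebesgue_on halfspace)"
      by (intro borel_measurable_times borel_measurable_power m)
    show "bounded_borel (\<lambda>x. u' x * (v' x)\<^sup>2)" by (intro bounded_borel_intros bd)
    show "AE x in lebesgue_on halfspace. u x * (v x)\<^sup>2 = u' x * (v' x)\<^sup>2"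
      using u'(4) v'(4) by eventually_elim simp
  qed (use u'(2) in simp_all)
  then obtain gu' Fu Gu where U: "neumann_weak C u' gu' Fu Gu (\<lambda>x. u' x * (v' x)\<^sup>2)" by blast
  have "\<exists>g F G. neumann_weak C v' g F G (\<lambda>x. (u' x)\<^sup>2 * v' x)"
  proof (rule neumann_weak_representative[OF gv _ weak(2) v'(1,2) C(2) v'(4)])
    show "(\<lambda>x. (u x)\<^sup>2 * v x) \<in> borel_measurable (lebesgue_on halfspace)"
      by (intro borel_measurable_times borel_measurable_power m)
    show "bounded_borel (\<lambda>x. (u' x)\<^sup>2 * v' x)" by (intro bounded_borel_intros bd)
    show "AE x in lebesgue_on halfspace. (u x)\<^sup>2 * v x = (u' x)\<^sup>2 * v' x"
      using u'(4) v'(4) by eventually_elim simp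
  qed (use u'(2) in simp_all)
  then obtain gv' Fv Gv where V: "neumann_weak C v' gv' Fv Gv (\<lambda>x. (u' x)\<^sup>2 * v' x)" by blast
  obtain R0 where R0: "0 < R0" and stab: "\<And>\<phi> \<psi>. \<phi> \<in> C1c (closure halfspace) \<Longrightarrow> \<psi> \<in> C1c (closure halfspace) \<Longrightarrow>
      (\<And>x. norm x < R0 \<Longrightarrow> \<phi> x = 0 \<and> \<psi> x = 0) \<Longrightarrow> 0 \<le> Qform u v \<phi> \<psi>"
    using finite_morse_index_stable_outside[OF assms(2,3,4)] by metis
  have "stable_outside R0 u' v'"
    unfolding stable_outside_def
  proof (intro ballI impI)
    fix \<phi> \<psi> assume \<phi>: "\<phi> \<in> C1c (closure halfspace)" and \<psi>: "\<psi> \<in> C1c (closure halfspace)"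
      and "\<forall>x. norm x < R0 \<longrightarrow> \<phi> x = 0 \<and> \<psi> x = 0"
    then have "0 \<le> Qform u v \<phi> \<psi>" by (intro stab) auto
    with Qform_representative[OF \<phi> \<psi> m u'(1,2,4) v'(1,2,4)] show "(\<integral>x. (v' x)\<^sup>2 * (\<phi> x)\<^sup>2 + (u' x)\<^sup>2 * (\<psi> x)\<^sup>2 + 4 * u' x * v' x * \<phi> x * \<psi> x \<partial>lborel)
        \<le> (\<integral>x. indicator halfspace x * ((norm (grad \<phi> x))\<^sup>2 + (norm (grad \<psi> x))\<^sup>2) \<partial>lborel)"
      by simp
  qed
  from neumann_system_trivial[OF U V this R0]
  have "AE x in lebesgue_on halfspace. u' x = 0" "AE x in lebesgue_on halfspace. v' x = 0"
    by (auto intro: AE_lborel_imp_halfspace)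
  then show ?thesis using u'(4) v'(4) by eventually_elim simp
qed

end
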